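(* Let $d$ be a positive integer and let $$w=w_d=s_{2d-1}s_{2d-2}\cdots s_{d+1}\,s_1s_2\cdots s_d\in\mathfrak{S}_{2d}.$$ Let $\mathbf{v}_1,\dots,\mathbf{v}_{2d-1},\mathbf{w}_1,\dots,\mathbf{w}_{2d-1}$ be the primitive ray generators of the fan of the toric Schubert variety $X_w^B$. For $v\in W^P$ with $v\le w$, the corresponding maximal cone $C_v$ in the fan $\Sigma_w$ of $X_w\subset\mathrm{Gr}(d,2d)$ is given as follows. (1) If $v=s_{2d-a-1}s_{2d-a-2}\cdots s_{d+1}\,s_1\cdots s_d$ for $1\le a\le d-1$, then $C_v=\mathrm{Cone}(\{\mathbf{v}_1\}\cup\{\mathbf{w}_i\mid i\in[2d-1]\setminus\{a\}\})$. (2) If $v=s_{2d-1}s_{2d-2}\cdots s_{d+1}\,s_{b+1}s_{b+2}\cdots s_d$ for $1\le b\le d-1$, then $C_v=\mathrm{Cone}(\{\mathbf{v}_d\}\cup\{\mathbf{w}_i\mid i\in[2d-1]\setminus\{d+b-1\}\})$. (3) If $v=s_{2d-a-1}s_{2d-a-2}\cdots s_{d+1}\,s_{b+1}s_{b+2}\cdots s_d$ for $1\le a\le d-1$ and $1\le b\le d-1$, then $C_v=\mathrm{Cone}(\{\mathbf{v}_1,\mathbf{v}_d\}\cup\{\mathbf{w}_i\mid i\in[2d-1]\setminus\{a,d+b-1\}\})$. (4) If $v=w$, then $C_w=\mathrm{Cone}(\{\mathbf{w}_i\mid i\in[2d-1]\})$. (5) If $v=e$, then $C_e=\mathrm{Cone}(\{\mathbf{v}_1,\mathbf{v}_d\}\cup\{\mathbf{w}_i\mid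 i\in[2d-2]\})$. Accordingly, for the fan $\Sigma_w$, the set of ray generators consists of the following $2d+1$ vectors: $$\{\mathbf{v}_1,\mathbf{v}_d,\mathbf{w}_1,\dots,\mathbf{w}_{2d-1}\}.$$
   Context: $[m]=\{1,\dots,m\}$ for $m>0$ and $[0]=\emptyset$. $G=\mathrm{SL}_{2d}(\mathbb{C})$, $B$ is the Borel subgroup of upper triangular matrices, $T\subset B$ is the maximal torus of diagonal matrices, $P=P_d\supset B$ is the maximal parabolic subgroup with $G/P\cong\mathrm{Gr}(d,2d)$. The Weyl group is $\mathfrak{S}_{2d}$ with simple reflections $s_i=(i\ i+1)$, $W_P=\langle s_i\mid i\ne d\rangle$, $W^P=\{v\in\mathfrak{S}_{2d}\mid v(1)<\cdots<v(d),\ v(d+1)<\cdots<v(2d)\}$; $\le$ is the Bruhat order; $e$ is the identity. For $a=d-1$ the factor $s_{2d-a-1}\cdots s_{d+1}$ means $e$. $X_w=\overline{BwP/P}\subset G/P$ and $X_w^B=\overline{BwB/B}\subset G/B$; both are toric varieties for the left action of $T$ (through a quotient torus of dimension $2d-1$). The fan of $X_w^B$ is identified with the following fan in $\mathbb{R}^{2d-1}$. Write $w_d=s_{i_1}\cdots s_{i_{2d-1}}$ for the given word, i.e. $(i_1,\dots,i_{2d-1})=(2d-1,2d-2,\dots,d+1,1,2,\dots,d)$. Put $\mathbf{v}_k=\mathbf{e}_k$ (standard basis) and $\mathbf{w}_k=-\mathbf{e}_k-\sum_{j>k}c_{i_j,i_k}\mathbf{e}_j$, where $c_{i,j}=2$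 if $i=j$, $-1$ if $|i-j|=1$, $0$ otherwise. For each $\mathscr{J}=\{j_1<\cdots<j_k\}\subseteq[2d-1]$ the maximal cone corresponding to the fixed point $uB$, $u=s_{i_{j_1}}\cdots s_{i_{j_k}}$, is $C_u^B=\mathrm{Cone}(\{\mathbf{v}_i\mid i\notin\mathscr{J}\}\cup\{\mathbf{w}_i\mid i\in\mathscr{J}\})$. The projection $\pi:G/B\to G/P$ restricts to a $T$-equivariant birational toric morphism $X_w^B\to X_w$ identifying the dense tori, and via this identification the fan $\Sigma_w$ of $X_w$ is regarded as a fan in the same space $\mathbb{R}^{2d-1}$. $C_v$ denotes the maximal cone of $\Sigma_w$ corresponding to the $T$-fixed point $vP\in X_w$.
   Formalization: The count of 2d+1 vectors is asserted only for d ≥ 2; for d = 1 one has v_1 = v_d, so the listed set of ray generators has only two elements (the set equality itself is proved for all d ≥ 1). *)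

theory Defs
  imports
    "Jordan_Normal_Form.Determinant"
    "HOL-Algebra.Coset"
    "HOL-Combinatorics.Permutations"
    "HOL-Combinatorics.Transposition"
begin

section \<open>Permutations\<close>

text \<open>
  The symmetric group on \<open>{1..n}\<close> is the set of functions that permute \<open>{1..n}\<close>; products are
  compositions of functions, so that \<open>s\<^sub>1 s\<^sub>2 \<cdots> s\<^sub>d\<close> applies \<open>s\<^sub>d\<close> first.
\<close>

definition simple_refl :: "nat \<Rightarrow> nat \<Rightarrow> nat" where
  "simple_refl i = Transposition.transpose i (Suc i)"

definition word_perm :: "nat list \<Rightarrow> nat \<Rightarrow> nat" where
  "word_perm is = foldr (\<lambda>i f. simple_refl i \<circ> f) is id"

definition coxeter_length :: "nat \<Rightarrow> (nat \<Rightarrow> nat) \<Rightarrow> nat" where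
  "coxeter_length n v = card {(i, j). i \<in> {1..n} \<and> j \<in> {1..n} \<and> i < j \<and> v j < v i}"

definition bruhat_step :: "nat \<Rightarrow> (nat \<Rightarrow> nat) \<Rightarrow> (nat \<Rightarrow> nat) \<Rightarrow> bool" where
  "bruhat_step n u v \<longleftrightarrow>
     (\<exists>a\<in>{1..n}. \<exists>b\<in>{1..n}. a \<noteq> b \<and> v = u \<circ> Transposition.transpose a b) \<and>
     coxeter_length n u < coxeter_length n v"

definition bruhat_le :: "nat \<Rightarrow> (nat \<Rightarrow> nat) \<Rightarrow> (nat \<Rightarrow> nat) \<Rightarrow> bool" where
  "bruhat_le n u v \<longleftrightarrow> u permutes {1..n} \<and> v permutes {1..n} \<and> (bruhat_step n)\<^sup>*\<^sup>* u v"

definition grassmannian_perms :: "nat \<Rightarrow> (nat \<Rightarrow> nat) set" where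
  "grassmannian_perms d =
     {v. v permutes {1..2*d} \<and> strict_mono_on {1..d} v \<and> strict_mono_on {d+1..2*d} v}"

text \<open>
  \<open>two_run_word d a b\<close> is the word \<open>2d-a-1, 2d-a-2, \<dots>, d+1, b+1, b+2, \<dots>, d\<close>; the first run is
  empty for \<open>a = d - 1\<close>.
\<close>

definition two_run_word :: "nat \<Rightarrow> nat \<Rightarrow> nat \<Rightarrow> nat list" where
  "two_run_word d a b = rev [d+1..<2*d-a] @ [b+1..<d+1]"

abbreviation w_word :: "nat \<Rightarrow> nat list" where
  "w_word d \<equiv> two_run_word d 0 0"

definition w_perm :: "nat \<Rightarrow> nat \<Rightarrow> nat" where
  "w_perm d = word_perm (w_word d)"


section \<open>The special linear group and its homogeneous spaces\<close>

text \<open>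
  Matrix entries are indexed from 0, so that row \<open>i\<close> in the usual numbering is row \<open>i - 1\<close> here.
\<close>

definition SL :: "nat \<Rightarrow> complex mat monoid" where
  "SL n = \<lparr>carrier = {A \<in> carrier_mat n n. det A = 1}, mult = (*), one = 1\<^sub>m n\<rparr>"

definition borel_SL :: "nat \<Rightarrow> complex mat set" where
  "borel_SL n = {A \<in> carrier (SL n). upper_triangular A}"

definition torus_SL :: "nat \<Rightarrow> complex mat set" where
  "torus_SL n = {A \<in> carrier (SL n). diagonal_mat A}"

definition parabolic_SL :: "nat \<Rightarrow> nat \<Rightarrow> complex mat set" where
  "parabolic_SL n d = {A \<in> carrier (SL n). \<forall>i\<in>{d..<n}. \<forall>j<d. A $$ (i, j) = 0}"

text \<open>The representatives in the normalizer of the torus of a Weyl group element.\<close>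

definition weyl_lifts :: "nat \<Rightarrow> (nat \<Rightarrow> nat) \<Rightarrow> complex mat set" where
  "weyl_lifts n v =
     {g \<in> carrier (SL n). \<forall>i\<in>{1..n}. \<forall>j\<in>{1..n}. g $$ (i - 1, j - 1) \<noteq> 0 \<longleftrightarrow> i = v j}"

text \<open>
  Below, \<open>H\<close> is the Borel or the parabolic subgroup. Points of \<open>G/H\<close> are the left cosets of \<open>H\<close>.
  The representatives of \<open>v\<close> form one coset of the torus, which \<open>H\<close> contains, so \<open>fixed_point\<close> is
  the single coset \<open>vH\<close>.
\<close>

definition hom_space :: "nat \<Rightarrow> complex mat set \<Rightarrow> complex mat set set" where
  "hom_space n H = (\<lambda>g. g <#\<^bsub>SL n\<^esub> H) ` carrier (SL n)"

definition fixed_point :: "nat \<Rightarrow> complex mat set \<Rightarrow> (nat \<Rightarrow> nat) \<Rightarrow> complex mat set" where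
  "fixed_point n H v = weyl_lifts n v <#>\<^bsub>SL n\<^esub> H"

inductive_set poly_funs :: "nat \<Rightarrow> (complex mat \<Rightarrow> complex) set" for n :: nat where
  const: "(\<lambda>A. c) \<in> poly_funs n"
| entry: "i < n \<Longrightarrow> j < n \<Longrightarrow> (\<lambda>A. A $$ (i, j)) \<in> poly_funs n"
| add: "f \<in> poly_funs n \<Longrightarrow> g \<in> poly_funs n \<Longrightarrow> (\<lambda>A. f A + g A) \<in> poly_funs n"
| mult: "f \<in> poly_funs n \<Longrightarrow> g \<in> poly_funs n \<Longrightarrow> (\<lambda>A. f A * g A) \<in> poly_funs n"

definition zariski_closure :: "nat \<Rightarrow> complex mat set \<Rightarrow> complex mat set" where
  "zariski_closure n S =
     {g \<in> carrier (SL n). \<forall>f\<in>poly_funs n. (\<forall>s\<in>S. f s = 0) \<longrightarrow> f g = 0}"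

text \<open>
  Closure in \<open>G/H\<close> with the quotient Zariski topology. The quotient map is open, so the preimage of
  the closure of \<open>Y\<close> is the closure of the preimage of \<open>Y\<close>, which is \<open>\<Union>Y\<close>.
\<close>

definition quot_closure ::
    "nat \<Rightarrow> complex mat set \<Rightarrow> complex mat set set \<Rightarrow> complex mat set set" where
  "quot_closure n H Y = {x \<in> hom_space n H. x \<subseteq> zariski_closure n (\<Union>Y)}"

definition schubert_variety ::
    "nat \<Rightarrow> complex mat set \<Rightarrow> (nat \<Rightarrow> nat) \<Rightarrow> complex mat set set" where
  "schubert_variety n H w =
     quot_closure n H ((\<lambda>b. b <#\<^bsub>SL n\<^esub> fixed_point n H w) ` borel_SL n)"


section \<open>The fan of a toric subvariety of a homogeneous space\<close>

text \<open>
  The torus acts through its quotient by the centre of \<open>SL n\<close> (on the varieties considered here the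
  action of that quotient is faithful). Its character lattice is the root lattice.
\<close>

definition root_lattice :: "nat \<Rightarrow> (nat \<Rightarrow> int) set" where
  "root_lattice n = {m. (\<forall>i. i \<notin> {1..n} \<longrightarrow> m i = 0) \<and> (\<Sum>i=1..n. m i) = 0}"

definition character :: "nat \<Rightarrow> (nat \<Rightarrow> int) \<Rightarrow> complex mat \<Rightarrow> complex" where
  "character n m t = (\<Prod>i=1..n. (t $$ (i - 1, i - 1)) powi m i)"

text \<open>
  Let \<open>X\<close> be a closed subvariety of \<open>G/H\<close> with a dense torus orbit, that of \<open>x\<^sub>0\<close>. A character
  \<open>m\<close> in the root lattice gives the rational function \<open>t x\<^sub>0 \<mapsto> character n m t\<close> on \<open>X\<close>, and
  \<open>char_regular\<close> says that it lies in the local ring of \<open>X\<close> at \<open>x\<close>. Since the quotient map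
  \<open>G \<rightarrow> G/H\<close> has local sections, this can be tested after pulling back to \<open>G\<close>, at one (equivalently
  every) point \<open>g\<close> over \<open>x\<close>; there regularity means being a quotient of polynomials in the matrix
  entries. Another choice of \<open>x\<^sub>0\<close> in the open orbit changes the function by a nonzero constant.
\<close>

definition char_regular ::
    "nat \<Rightarrow> complex mat set \<Rightarrow> complex mat set set \<Rightarrow> complex mat set \<Rightarrow> (nat \<Rightarrow> int) \<Rightarrow> bool" where
  "char_regular n H X x m \<longleftrightarrow>
     (\<exists>x\<^sub>0\<in>X. X \<subseteq> quot_closure n H ((\<lambda>t. t <#\<^bsub>SL n\<^esub> x\<^sub>0) ` torus_SL n) \<and>
        (\<exists>p\<in>poly_funs n. \<exists>q\<in>poly_funs n. (\<exists>g\<in>x. q g \<noteq> 0) \<and>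
           (\<forall>t\<in>torus_SL n. \<forall>h\<in>t <#\<^bsub>SL n\<^esub> x\<^sub>0. character n m t * q h = p h)))"

text \<open>Vectors of \<open>\<real>\<^sup>r\<close> and \<open>\<int>\<^sup>r\<close> are functions vanishing outside \<open>{1..r}\<close>.\<close>

definition supported :: "nat \<Rightarrow> (nat \<Rightarrow> 'a::zero) set" where
  "supported r = {u. \<forall>k. k \<notin> {1..r} \<longrightarrow> u k = 0}"

definition combination :: "nat \<Rightarrow> (nat \<Rightarrow> nat \<Rightarrow> int) \<Rightarrow> (nat \<Rightarrow> int) \<Rightarrow> nat \<Rightarrow> int" where
  "combination r \<beta> a = (\<lambda>i. \<Sum>k=1..r. a k * \<beta> k i)"

text \<open>
  An identification of the acting quotient torus with the standard torus of dimension \<open>n - 1\<close> is a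
  basis \<open>\<beta> 1, \<dots>, \<beta> (n - 1)\<close> of its character lattice. The dual coordinates identify the real
  cocharacter space with \<open>\<real>\<^bsup>n-1\<^esup>\<close> and the cocharacter lattice with \<open>\<int>\<^bsup>n-1\<^esup>\<close>.
\<close>

definition torus_coordinates :: "nat \<Rightarrow> (nat \<Rightarrow> nat \<Rightarrow> int) \<Rightarrow> bool" where
  "torus_coordinates n \<beta> \<longleftrightarrow>
     bij_betw (combination (n - 1) \<beta>) (supported (n - 1)) (root_lattice n)"

text \<open>
  The affine chart of the toric variety of a fan that belongs to a cone \<open>\<sigma>\<close> has as its regular
  characters those that are nonnegative on \<open>\<sigma>\<close>, and for a point \<open>x\<close> in the closed orbit of the
  chart these are exactly the characters regular at \<open>x\<close>. Hence the cone \<open>\<sigma>\<close> belonging to the orbit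
  of \<open>x\<close> is the dual of the set of characters regular at \<open>x\<close>, and the fan consists of the cones
  belonging to the points of \<open>X\<close>. The cones of maximal dimension belong to the torus-fixed points.
\<close>

definition toric_cone ::
    "nat \<Rightarrow> complex mat set \<Rightarrow> (nat \<Rightarrow> nat \<Rightarrow> int) \<Rightarrow> complex mat set set \<Rightarrow> complex mat set
       \<Rightarrow> (nat \<Rightarrow> real) set" where
  "toric_cone n H \<beta> X x =
     {u \<in> supported (n - 1). \<forall>a\<in>supported (n - 1).
        char_regular n H X x (combination (n - 1) \<beta> a) \<longrightarrow>
          (\<Sum>k=1..n-1. of_int (a k) * u k) \<ge> 0}"

definition toric_fan ::
    "nat \<Rightarrow> complex mat set \<Rightarrow> (nat \<Rightarrow> nat \<Rightarrow> int) \<Rightarrow> complex mat set set \<Rightarrow> (nat \<Rightarrow> real) set set" where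
  "toric_fan n H \<beta> X = toric_cone n H \<beta> X ` X"

definition Cone :: "(nat \<Rightarrow> real) set \<Rightarrow> (nat \<Rightarrow> real) set" where
  "Cone S = {(\<lambda>k. \<Sum>s\<in>S. c s * s k) | c. \<forall>s\<in>S. 0 \<le> c s}"

definition lattice_points :: "nat \<Rightarrow> (nat \<Rightarrow> real) set" where
  "lattice_points r = {u \<in> supported r. \<forall>k. u k \<in> \<int>}"

definition primitive :: "nat \<Rightarrow> (nat \<Rightarrow> real) \<Rightarrow> bool" where
  "primitive r u \<longleftrightarrow> u \<in> lattice_points r \<and> u \<noteq> (\<lambda>_. 0) \<and>
     (\<forall>u'\<in>lattice_points r. \<forall>c::nat. u = (\<lambda>k. real c * u' k) \<longrightarrow> c = 1)"

definition ray_generators :: "nat \<Rightarrow> (nat \<Rightarrow> real) set set \<Rightarrow> (nat \<Rightarrow> real) set" where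
  "ray_generators r \<Sigma> = {u. primitive r u \<and> Cone {u} \<in> \<Sigma>}"


section \<open>The identification of the fan of the Schubert variety in the flag variety\<close>

definition cartan :: "nat \<Rightarrow> nat \<Rightarrow> int" where
  "cartan i j = (if i = j then 2 else if i = Suc j \<or> j = Suc i then -1 else 0)"

definition vvec :: "nat \<Rightarrow> nat \<Rightarrow> real" where
  "vvec k = (\<lambda>l. if l = k then 1 else 0)"

definition wvec :: "nat \<Rightarrow> nat \<Rightarrow> nat \<Rightarrow> real" where
  "wvec d k = (\<lambda>l. - vvec k l -
     (\<Sum>j\<in>{k<..2*d-1}. of_int (cartan (w_word d ! (j - 1)) (w_word d ! (k - 1))) * vvec j l))"

definition subword_perm :: "nat \<Rightarrow> nat set \<Rightarrow> nat \<Rightarrow> nat" where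
  "subword_perm d J = word_perm (map (\<lambda>j. w_word d ! (j - 1)) (sorted_list_of_set J))"

abbreviation flag_schubert :: "nat \<Rightarrow> complex mat set set" where
  "flag_schubert d \<equiv> schubert_variety (2*d) (borel_SL (2*d)) (w_perm d)"

abbreviation grass_schubert :: "nat \<Rightarrow> complex mat set set" where
  "grass_schubert d \<equiv> schubert_variety (2*d) (parabolic_SL (2*d) d) (w_perm d)"

text \<open>
  The torus coordinates in which the fan of \<open>X\<^sub>w\<^sup>B\<close> has the maximal cones \<open>C\<^sub>u\<^sup>B\<close>. They are unique:
  \<open>\<beta> k\<close> is the negative of the simple root numbered by the \<open>k\<close>th letter of the word. The projection
  of \<open>X\<^sub>w\<^sup>B\<close> to \<open>X\<^sub>w\<close> is equivariant for the torus, so that the same coordinates describe the fan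
  of \<open>X\<^sub>w\<close> in the same space.
\<close>

definition fan_identification :: "nat \<Rightarrow> (nat \<Rightarrow> nat \<Rightarrow> int) \<Rightarrow> bool" where
  "fan_identification d \<beta> \<longleftrightarrow> torus_coordinates (2*d) \<beta> \<and>
     (\<forall>J\<subseteq>{1..2*d-1}.
        toric_cone (2*d) (borel_SL (2*d)) \<beta> (flag_schubert d)
          (fixed_point (2*d) (borel_SL (2*d)) (subword_perm d J)) =
        Cone (vvec ` ({1..2*d-1} - J) \<union> wvec d ` J))"

definition grass_fan :: "nat \<Rightarrow> (nat \<Rightarrow> nat \<Rightarrow> int) \<Rightarrow> (nat \<Rightarrow> real) set set" where
  "grass_fan d \<beta> = toric_fan (2*d) (parabolic_SL (2*d) d) \<beta> (grass_schubert d)"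

definition grass_cone :: "nat \<Rightarrow> (nat \<Rightarrow> nat \<Rightarrow> int) \<Rightarrow> (nat \<Rightarrow> nat) \<Rightarrow> (nat \<Rightarrow> real) set" where
  "grass_cone d \<beta> v =
     toric_cone (2*d) (parabolic_SL (2*d) d) \<beta> (grass_schubert d)
       (fixed_point (2*d) (parabolic_SL (2*d) d) v)"

end

theory Submission
  imports Defs
begin

text \<open>
  A subspace spanned by the first \<open>d\<close> columns of \<open>g\<close> lies in \<open>X\<^sub>w\<close> exactly if the lower left
  \<open>d \<times> d\<close> block of \<open>g\<close> has rank at most one. On such \<open>g\<close> only the Pluecker coordinates of the rows
  \<open>{1..d}\<close> and \<open>{1..d} - {j} \<union> {d + i}\<close> matter, and those of the second kind that do not vanish form
  a product set \<open>R \<times> C\<close> of indices \<open>i\<close> and \<open>j\<close>. Ratios of Pluecker coordinates are regular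
  characters; conversely every point is a limit, along a real one-parameter subgroup of weight
  \<open>\<mu>\<close>, of points in the open torus orbit, and letting the parameter tend to \<open>0\<close> in the equation
  of a regular character shows that it pairs nonnegatively with \<open>\<mu>\<close>. Hence the cone of a point
  consists of the \<open>\<mu>\<close> for which the weights of its nonvanishing Pluecker coordinates are minimal,
  and in suitable coordinates it is spanned by one ray for every \<open>i \<notin> R\<close>, every \<open>j \<notin> C\<close>, and one
  more if the coordinate of \<open>{1..d}\<close> vanishes.

  The coordinates \<open>\<beta>\<close> are pinned down by two kinds of cones of the flag variety: minus a simple root
  is regular at the identity coset, so that its coordinates are nonnegative, and the root itself
  is regular at the coset of the simple reflection, so that all but one of its coordinates vanish.
\<close>

section \<open>Minors\<close>

definition minor :: "(nat \<Rightarrow> nat) \<Rightarrow> nat \<Rightarrow> 'a::comm_ring_1 mat \<Rightarrow> 'a" where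
  "minor r k A = det (Matrix.mat k k (\<lambda>(a, c). A $$ (r a, c)))"

lemma mult_mat_index:
  "A \<in> carrier_mat n m \<Longrightarrow> B \<in> carrier_mat m l \<Longrightarrow> i < n \<Longrightarrow> j < l \<Longrightarrow>
    (A * B) $$ (i, j) = (\<Sum>k<m. A $$ (i, k) * B $$ (k, j))"
  by (auto simp: scalar_prod_def lessThan_atLeast0)

lemma det_mat_diag: "det (mat_diag n t) = (\<Prod>i<n. t i)"
  by (subst det_upper_triangular[of _ n])
    (auto simp: upper_triangular_def mat_diag_def prod_list_diag_prod lessThan_atLeast0)

lemma minor_id_eq_det: "A \<in> carrier_mat n n \<Longrightarrow> minor id n A = det A"
  unfolding minor_def by (intro arg_cong[where f = det] eq_matI) auto

lemma minor_cong:
  "(\<And>a c. a < k \<Longrightarrow> c < k \<Longrightarrow> A $$ (r a, c) = B $$ (r' a, c)) \<Longrightarrow> minor r k A = minor r' k B"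
  unfolding minor_def by (intro arg_cong[where f = det] eq_matI) auto

text \<open>The zero block of \<open>b\<close> makes the first \<open>k\<close> columns of
  \<open>A * b\<close> combinations of the first \<open>k\<close> columns of \<open>A\<close> alone.
  So right multiplication by a Borel or parabolic element multiplies all these minors by one common
  factor.\<close>

lemma minor_mult:
  assumes A: "A \<in> carrier_mat n m" and b: "b \<in> carrier_mat m l" and k: "k \<le> m" "k \<le> l"
    and z: "\<And>i j. k \<le> i \<Longrightarrow> i < m \<Longrightarrow> j < k \<Longrightarrow> b $$ (i, j) = 0"
    and r: "\<And>a. a < k \<Longrightarrow> r a < n"
  shows "minor r k (A * b) = minor r k A * minor id k b"
proof -
  have "Matrix.mat k k (\<lambda>(a, c). (A * b) $$ (r a, c)) =
      Matrix.mat k k (\<lambda>(a, c). A $$ (r a, c)) * Matrix.mat k k (\<lambda>(a, c). b $$ (id a, c))" (is "?L = ?R")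
  proof (rule eq_matI)
    fix a c assume "a < dim_row ?R" "c < dim_col ?R"
    hence ac: "a < k" "c < k" by auto
    have "?L $$ (a, c) = (\<Sum>j<m. A $$ (r a, j) * b $$ (j, c))"
      using ac k by (simp add: mult_mat_index[OF A b r] del: index_mult_mat)
    also have "\<dots> = (\<Sum>j<k. A $$ (r a, j) * b $$ (j, c))"
      using k z ac by (intro sum.mono_neutral_right) auto
    also have "\<dots> = ?R $$ (a, c)"
      using ac by (simp add: mult_mat_index[of _ k k _ k] del: index_mult_mat(1))
    finally show "?L $$ (a, c) = ?R $$ (a, c)" .
  qed auto
  thus ?thesis unfolding minor_def by (simp add: det_mult[of _ k])
qed

lemma minor_diag:
  assumes A: "A \<in> carrier_mat n m" and k: "k \<le> m" and r: "\<And>a. a < k \<Longrightarrow> r a < n"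
  shows "minor r k (mat_diag n t * A) = (\<Prod>a<k. t (r a)) * minor r k A"
proof -
  have "Matrix.mat k k (\<lambda>(a, c). (mat_diag n t * A) $$ (r a, c)) =
      mat_diag k (\<lambda>a. t (r a)) * Matrix.mat k k (\<lambda>(a, c). A $$ (r a, c))"
    using r k by (intro eq_matI) (auto simp: mat_diag_mult_left[OF A] mat_diag_mult_left[of _ k k])
  thus ?thesis unfolding minor_def by (simp add: det_mult[of _ k] det_mat_diag)
qed

text \<open>Vanishing is traded for a kernel vector, so that later nonvanishing proofs are linear
  elimination instead of the evaluation of determinants.\<close>

lemma minor_eq_0_iff:
  fixes A :: "'a::field mat"
  shows "minor r k A = 0 \<longleftrightarrow>
    (\<exists>v. (\<exists>c<k. v c \<noteq> 0) \<and> (\<forall>a<k. (\<Sum>c<k. A $$ (r a, c) * v c) = 0))"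
proof -
  let ?M = "Matrix.mat k k (\<lambda>(a, c). A $$ (r a, c))"
  have M: "?M \<in> carrier_mat k k" by simp
  have ent: "(?M *\<^sub>v v) $ a = (\<Sum>c<k. A $$ (r a, c) * v $ c)" if "v \<in> carrier_vec k" "a < k" for v a
    using that by (auto simp: scalar_prod_def lessThan_atLeast0 intro!: sum.cong)
  show ?thesis unfolding minor_def det_0_iff_vec_prod_zero[OF M]
  proof
    assume "\<exists>v. v \<in> carrier_vec k \<and> v \<noteq> 0\<^sub>v k \<and> ?M *\<^sub>v v = 0\<^sub>v k"
    then obtain v where v: "v \<in> carrier_vec k" "v \<noteq> 0\<^sub>v k" "?M *\<^sub>v v = 0\<^sub>v k" by blast
    have "\<exists>c<k. v $ c \<noteq> 0"
      using v(1,2) by (metis carrier_vecD eq_vecI index_zero_vec(1) index_zero_vec(2))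
    moreover have "(\<Sum>c<k. A $$ (r a, c) * v $ c) = 0" if "a < k" for a
      using ent[OF v(1) that] v(3) that by simp
    ultimately show "\<exists>v. (\<exists>c<k. v c \<noteq> 0) \<and> (\<forall>a<k. (\<Sum>c<k. A $$ (r a, c) * v c) = 0)"
      by (intro exI[of _ "\<lambda>c. v $ c"]) auto
  next
    assume "\<exists>v. (\<exists>c<k. v c \<noteq> 0) \<and> (\<forall>a<k. (\<Sum>c<k. A $$ (r a, c) * v c) = 0)"
    then obtain v where v: "\<exists>c<k. v c \<noteq> 0" "\<forall>a<k. (\<Sum>c<k. A $$ (r a, c) * v c) = 0" by blast
    have "vec k v \<noteq> 0\<^sub>v k" using v(1) by (metis index_vec index_zero_vec(1))
    moreover have "?M *\<^sub>v vec k v = 0\<^sub>v k"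
      using v(2) by (intro eq_vecI) (auto simp: scalar_prod_def lessThan_atLeast0 intro!: sum.cong)
    ultimately show "\<exists>v. v \<in> carrier_vec k \<and> v \<noteq> 0\<^sub>v k \<and> ?M *\<^sub>v v = 0\<^sub>v k"
      by (intro exI[of _ "vec k v"]) auto
  qed
qed

text \<open>The selected rows form a monomial matrix, and row \<open>f c\<close> isolates the entry
  \<open>c\<close> of a kernel vector.\<close>

lemma minor_monomial_neq_0:
  fixes A :: "'a::field mat"
  assumes f: "inj_on f {..<k}" "f ` {..<k} \<subseteq> {..<k}"
    and A: "\<And>a c. a < k \<Longrightarrow> c < k \<Longrightarrow> A $$ (r a, c) \<noteq> 0 \<longleftrightarrow> a = f c"
  shows "minor r k A \<noteq> 0"
proof
  assume "minor r k A = 0"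
  then obtain v c where v: "c < k" "v c \<noteq> 0" "\<And>a. a < k \<Longrightarrow> (\<Sum>c<k. A $$ (r a, c) * v c) = 0"
    unfolding minor_eq_0_iff by blast
  have fc: "f c < k" using f(2) v(1) by auto
  have "0 = (\<Sum>e<k. A $$ (r (f c), e) * v e)" using v(3)[OF fc] by simp
  also have "\<dots> = (\<Sum>e\<in>{c}. A $$ (r (f c), e) * v e)"
    using A[OF fc] f(1) v(1) by (intro sum.mono_neutral_right) (auto dest: inj_onD)
  finally have "A $$ (r (f c), c) * v c = 0" by simp
  thus False using A[OF fc v(1)] v(2) by simp
qed

text \<open>A kernel vector of the corner, extended by zeros, is annihilated by all of
  \<open>b\<close>.\<close>

lemma minor_id_corner_neq_0:
  fixes b :: "'a::field mat"
  assumes b: "b \<in> carrier_mat n n" "det b \<noteq> 0" and k: "k \<le> n"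
    and z: "\<And>i j. k \<le> i \<Longrightarrow> i < n \<Longrightarrow> j < k \<Longrightarrow> b $$ (i, j) = 0"
  shows "minor id k b \<noteq> 0"
proof
  assume "minor id k b = 0"
  then obtain v c where v: "c < k" "v c \<noteq> 0" "\<And>a. a < k \<Longrightarrow> (\<Sum>c<k. b $$ (a, c) * v c) = 0"
    unfolding minor_eq_0_iff by auto
  define u where "u c = (if c < k then v c else 0)" for c
  have "(\<Sum>c<n. b $$ (a, c) * u c) = 0" if "a < n" for a
  proof -
    have "(\<Sum>c<n. b $$ (a, c) * u c) = (\<Sum>c<k. b $$ (a, c) * v c)"
      using k by (intro sum.mono_neutral_cong_right) (auto simp: u_def)
    also have "\<dots> = 0"
    proof (cases "a < k")
      case False
      thus ?thesis using z[of a] that by (intro sum.neutral) auto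
    qed (rule v(3))
    finally show ?thesis .
  qed
  hence "minor id n b = 0"
    unfolding minor_eq_0_iff using v(1,2) k
    by (intro exI[of _ u]) (auto simp: u_def intro!: exI[of _ c])
  thus False using b(2) by (simp add: minor_id_eq_det[OF b(1)])
qed

lemma minor_permute:
  fixes A :: "'a::field mat"
  assumes p: "p permutes {..<k}"
  shows "minor (r \<circ> p) k A = 0 \<longleftrightarrow> minor r k A = 0"
proof -
  let ?M = "Matrix.mat k k (\<lambda>(a, c). A $$ (r a, c))"
  have "Matrix.mat k k (\<lambda>(i, j). ?M $$ (p i, j)) = Matrix.mat k k (\<lambda>(a, c). A $$ ((r \<circ> p) a, c))"
    using permutes_in_image[OF p] by (intro eq_matI) auto
  with det_permute_rows[of ?M k p] have "minor (r \<circ> p) k A = signof p * minor r k A"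
    unfolding minor_def using p by (simp add: lessThan_atLeast0)
  thus ?thesis by (simp add: sign_def)
qed

text \<open>The rows \<open>r\<close> form a unit matrix, so only the identity survives in the
  Leibniz sum. Consequently every entry of a normalised frame is itself a minor, which is how the
  charts below are read.\<close>

lemma minor_replace_row:
  fixes A :: "'a::field mat"
  assumes c: "c < k" and A: "\<And>a b. a < k \<Longrightarrow> b < k \<Longrightarrow> A $$ (r a, b) = (if a = b then 1 else 0)"
  shows "minor (r(c := i)) k A = A $$ (i, c)"
proof -
  let ?M = "Matrix.mat k k (\<lambda>(a, b). A $$ ((r(c := i)) a, b))"
  have "det ?M = (\<Sum>p | p permutes {0..<k}. signof p * (\<Prod>a = 0..<k. ?M $$ (a, p a)))"
    by (rule det_def') simp
  also have "\<dots> = (\<Sum>p\<in>{id}. signof p * (\<Prod>a = 0..<k. ?M $$ (a, p a)))"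
  proof (intro sum.mono_neutral_right ballI)
    fix p assume "p \<in> {p. p permutes {0..<k}} - {id}"
    hence p: "p permutes {0..<k}" "p \<noteq> id" by auto
    \<comment> \<open>A permutation that fixes everything except possibly \<open>c\<close> fixes
      \<open>c\<close> as well, so a permutation other than \<open>id\<close> moves an index whose
      row is still a unit row.\<close>
    have "\<exists>a<k. a \<noteq> c \<and> p a \<noteq> a"
    proof (rule ccontr)
      assume n: "\<not> ?thesis"
      have "p a = a" for a
      proof (cases "a = c \<or> \<not> a < k")
        case True
        show ?thesis
        proof (cases "a = c")
          case True
          have "p c = c"
          proof (rule ccontr)
            assume "p c \<noteq> c"
            moreover have "p c < k" using permutes_in_image[OF p(1), of c] c by simp
            ultimately have "p (p c) = p c" using n by blast
            thus False using permutes_inj[OF p(1)] \<open>p c \<noteq> c\<close> by (auto dest: injD)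
          qed
          thus ?thesis using True by simp
        next
          case False
          thus ?thesis using True p(1) by (simp add: permutes_def)
        qed
      qed (use n in auto)
      thus False using p(2) by auto
    qed
    then obtain a where a: "a < k" "a \<noteq> c" "p a \<noteq> a" by blast
    moreover have "p a < k" using permutes_in_image[OF p(1), of a] a by simp
    ultimately have "?M $$ (a, p a) = 0" using A[of a "p a"] by simp
    hence "(\<Prod>a = 0..<k. ?M $$ (a, p a)) = 0" using a by (intro prod_zero) auto
    thus "signof p * (\<Prod>a = 0..<k. ?M $$ (a, p a)) = 0" by simp
  qed (auto simp: finite_permutations permutes_id)
  also have "\<dots> = (\<Prod>a = 0..<k. ?M $$ (a, a))" by simp
  also have "\<dots> = (\<Prod>a\<in>{c}. ?M $$ (a, a))"
    using c A by (intro prod.mono_neutral_right) auto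
  also have "\<dots> = A $$ (i, c)" using c by simp
  finally show ?thesis unfolding minor_def .
qed

lemma minor_scale_row:
  fixes A :: "'a::field mat"
  assumes j: "j < k" and A: "\<And>c. c < k \<Longrightarrow> A $$ (i, c) = x * A $$ (i', c)"
  shows "minor (r(j := i)) k A = x * minor (r(j := i')) k A"
proof -
  let ?M = "Matrix.mat k k (\<lambda>(a, c). A $$ ((r(j := i')) a, c))"
  have "Matrix.mat k k (\<lambda>(a, c). A $$ ((r(j := i)) a, c)) = mat_diag k (\<lambda>a. if a = j then x else 1) * ?M"
    using j A by (subst mat_diag_mult_left[of _ k k]) (auto intro!: eq_matI)
  thus ?thesis unfolding minor_def using j by (simp add: det_mult[of _ k] det_mat_diag)
qed

section \<open>Polynomial functions\<close>

lemma poly_funs_sum: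
  "(\<And>i. i \<in> I \<Longrightarrow> f i \<in> poly_funs n) \<Longrightarrow> (\<lambda>A. \<Sum>i\<in>I. f i A) \<in> poly_funs n"
  by (induction I rule: infinite_finite_induct) (auto intro: poly_funs.intros)

lemma poly_funs_prod:
  "(\<And>i. i \<in> I \<Longrightarrow> f i \<in> poly_funs n) \<Longrightarrow> (\<lambda>A. \<Prod>i\<in>I. f i A) \<in> poly_funs n"
  by (induction I rule: infinite_finite_induct) (auto intro: poly_funs.intros)

lemma poly_funs_diff:
  "f \<in> poly_funs n \<Longrightarrow> g \<in> poly_funs n \<Longrightarrow> (\<lambda>A. f A - g A) \<in> poly_funs n"
  using poly_funs.add[of f n "\<lambda>A. (-1) * g A"] poly_funs.mult[of "\<lambda>_. -1" n g] poly_funs.const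
  by simp

lemma minor_poly_funs:
  assumes "k \<le> n" "\<And>a. a < k \<Longrightarrow> r a < n"
  shows "minor r k \<in> poly_funs n"
proof -
  have "minor r k = (\<lambda>A :: complex mat. \<Sum>p | p permutes {0..<k}. signof p * (\<Prod>a = 0..<k. A $$ (r a, p a)))"
    (is "_ = ?f")
  proof
    fix A :: "complex mat"
    have "(\<Prod>a = 0..<k. Matrix.mat k k (\<lambda>(a, c). A $$ (r a, c)) $$ (a, p a)) = (\<Prod>a = 0..<k. A $$ (r a, p a))"
      if "p permutes {0..<k}" for p
      using permutes_in_image[OF that] by (intro prod.cong) auto
    thus "minor r k A = ?f A" unfolding minor_def by (subst det_def'[of _ k]) auto
  qed
  moreover have "?f \<in> poly_funs n"
  proof (intro poly_funs_sum poly_funs.mult poly_funs.const poly_funs_prod poly_funs.entry)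
    fix p a assume "p \<in> {p. p permutes {0..<k}}" "a \<in> {0..<k}"
    hence "p a < k" using permutes_in_image[of p "{0..<k}" a] by simp
    thus "p a < n" using assms(1) by simp
  qed (use assms in auto)
  ultimately show ?thesis by simp
qed

lemma poly_funs_tendsto:
  assumes "f \<in> poly_funs n"
    and "\<And>i j. i < n \<Longrightarrow> j < n \<Longrightarrow> ((\<lambda>s. h s $$ (i, j)) \<longlongrightarrow> g $$ (i, j)) F"
  shows "((\<lambda>s. f (h s)) \<longlongrightarrow> f g) F"
  using assms(1) by induction (auto intro: tendsto_intros assms(2))

section \<open>The special linear group\<close>

abbreviation mat_coset :: "complex mat \<Rightarrow> complex mat set \<Rightarrow> complex mat set" where
  "mat_coset g H \<equiv> (\<lambda>h. g * h) ` H"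

abbreviation torus_orbit :: "nat \<Rightarrow> complex mat set \<Rightarrow> complex mat set set" where
  "torus_orbit n x \<equiv> (\<lambda>t. t <#\<^bsub>SL n\<^esub> x) ` torus_SL n"

abbreviation grass_parabolic :: "nat \<Rightarrow> complex mat set" where
  "grass_parabolic d \<equiv> parabolic_SL (2 * d) d"

lemma SL_iff: "A \<in> carrier (SL n) \<longleftrightarrow> A \<in> carrier_mat n n \<and> det A = 1"
  by (simp add: SL_def)

lemma SL_mult: "A \<in> carrier (SL n) \<Longrightarrow> B \<in> carrier (SL n) \<Longrightarrow> A * B \<in> carrier (SL n)"
  by (auto simp: SL_iff det_mult)

lemma SL_inverse:
  assumes "A \<in> carrier (SL n)"
  obtains B where "B \<in> carrier (SL n)" "A * B = 1\<^sub>m n" "B * A = 1\<^sub>m n"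
proof -
  have A: "A \<in> carrier_mat n n" "det A = 1" using assms by (auto simp: SL_iff)
  have "1 \<cdot>\<^sub>m 1\<^sub>m n = (1\<^sub>m n :: complex mat)" by (intro eq_matI) auto
  note ad = adj_mat[OF A(1), unfolded A(2) this]
  have "det (A * adj_mat A) = det A * det (adj_mat A)" using A(1) ad(1) by (rule det_mult)
  hence "det (adj_mat A) = 1" unfolding ad(2) A(2) by simp
  thus ?thesis using that[of "adj_mat A"] ad A by (simp add: SL_iff)
qed

lemma l_coset_SL: "g <#\<^bsub>SL n\<^esub> H = mat_coset g H"
  by (auto simp: l_coset_def SL_def)

lemma set_mult_SL: "K <#>\<^bsub>SL n\<^esub> H = (\<Union>g\<in>K. mat_coset g H)"
  by (auto simp: set_mult_def SL_def)

lemma mem_hom_space: "x \<in> hom_space n H \<longleftrightarrow> (\<exists>g\<in>carrier (SL n). x = mat_coset g H)"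
  by (auto simp: hom_space_def l_coset_SL)

text \<open>Used with a column outside the first \<open>d\<close> to restore determinant one without
  moving the coset, and with the first column to correct a permutation matrix.\<close>

lemma scale_column_SL:
  assumes A: "A \<in> carrier_mat n n" "det A \<noteq> 0" and k: "k < n"
  shows "Matrix.mat n n (\<lambda>(i, j). if j = k then A $$ (i, j) / det A else A $$ (i, j)) \<in> carrier (SL n)"
proof -
  let ?D = "mat_diag n (\<lambda>j. if j = k then 1 / det A else 1)"
  have "Matrix.mat n n (\<lambda>(i, j). if j = k then A $$ (i, j) / det A else A $$ (i, j)) = A * ?D"
    by (subst mat_diag_mult_right[OF A(1)]) (auto intro!: eq_matI)
  thus ?thesis using A k by (simp add: SL_iff det_mult[of _ n] det_mat_diag)
qed

text \<open>Multiplying by the inverse of \<open>g\<close> turns the condition on spans into a zero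
  block. A coset of the parabolic is thus determined by the span of the first \<open>d\<close>
  columns.\<close>

lemma mem_parabolic_coset:
  assumes g: "g \<in> carrier (SL n)" and h: "h \<in> carrier (SL n)" and d: "d \<le> n"
    and K: "\<And>i c. i < n \<Longrightarrow> c < d \<Longrightarrow> h $$ (i, c) = (\<Sum>k<d. g $$ (i, k) * K k c)"
  shows "h \<in> mat_coset g (parabolic_SL n d)"
proof -
  obtain B where B: "B \<in> carrier (SL n)" "g * B = 1\<^sub>m n" "B * g = 1\<^sub>m n" using SL_inverse[OF g] .
  have cm: "g \<in> carrier_mat n n" "h \<in> carrier_mat n n" "B \<in> carrier_mat n n"
    using g h B by (auto simp: SL_iff)
  have "(B * h) $$ (i, c) = 0" if i: "i \<in> {d..<n}" and c: "c < d" for i c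
  proof -
    have "(B * h) $$ (i, c) = (\<Sum>l<n. B $$ (i, l) * (\<Sum>k<d. g $$ (l, k) * K k c))"
      using i c d K by (subst mult_mat_index[OF cm(3,2)]) auto
    also have "\<dots> = (\<Sum>l<n. \<Sum>k<d. B $$ (i, l) * g $$ (l, k) * K k c)"
      by (simp add: sum_distrib_left mult.assoc)
    also have "\<dots> = (\<Sum>k<d. \<Sum>l<n. B $$ (i, l) * g $$ (l, k) * K k c)" by (rule sum.swap)
    also have "\<dots> = (\<Sum>k<d. (B * g) $$ (i, k) * K k c)"
      using i d by (intro sum.cong refl) (auto simp: mult_mat_index[OF cm(3,1)] sum_distrib_right simp del: index_mult_mat)
    also have "\<dots> = 0" unfolding B(3) using i d by (intro sum.neutral) auto
    finally show ?thesis .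
  qed
  hence "B * h \<in> parabolic_SL n d" using SL_mult[OF B(1) h] by (auto simp: parabolic_SL_def)
  moreover have "h = g * (B * h)" using B cm by (simp flip: assoc_mult_mat[OF cm(1,3,2)])
  ultimately show ?thesis by blast
qed

lemma torus_iff: "t \<in> torus_SL n \<longleftrightarrow> (\<exists>f. (\<Prod>i<n. f i) = 1 \<and> t = mat_diag n f)"
proof
  assume t: "t \<in> torus_SL n"
  hence tc: "t \<in> carrier_mat n n" by (auto simp: torus_SL_def SL_iff)
  have "t = mat_diag n (\<lambda>i. t $$ (i, i))"
    using t by (intro eq_matI) (auto simp: torus_SL_def SL_iff diagonal_mat_def mat_diag_def)
  moreover from this have "det t = (\<Prod>i<n. t $$ (i, i))" using det_mat_diag by metis
  ultimately show "\<exists>f. (\<Prod>i<n. f i) = 1 \<and> t = mat_diag n f"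
    using t by (auto simp: torus_SL_def SL_iff)
next
  assume "\<exists>f. (\<Prod>i<n. f i) = 1 \<and> t = mat_diag n f"
  thus "t \<in> torus_SL n"
    by (auto simp: torus_SL_def SL_iff det_mat_diag diagonal_mat_def) (simp add: mat_diag_def)
qed

section \<open>Torus orbits\<close>

text \<open>The factor \<open>y\<close> is the corner minor of the element of \<open>H\<close> and
  is common to all \<open>r\<close>, so quotients of minors are functions on cosets. The zero block
  is available for the Borel subgroup with every \<open>k\<close> and for the parabolic one with
  \<open>k = d\<close>.\<close>

lemma corner_coset_minor:
  assumes g0: "g0 \<in> carrier (SL n)" and H: "H \<subseteq> carrier (SL n)"
    and z: "\<forall>b\<in>H. \<forall>i\<in>{k..<n}. \<forall>j<k. b $$ (i, j) = 0"
    and k: "k \<le> n" and h: "h \<in> mat_diag n f <#\<^bsub>SL n\<^esub> (mat_coset g0 H)"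
  obtains y where "y \<noteq> 0"
    "\<And>r. \<forall>a<k. r a < n \<Longrightarrow> minor r k h = y * (\<Prod>a<k. f (r a)) * minor r k g0"
proof -
  obtain b where b: "b \<in> H" "h = mat_diag n f * (g0 * b)" using h by (auto simp: l_coset_SL)
  have cm: "g0 \<in> carrier_mat n n" "b \<in> carrier_mat n n" "det b = 1" using g0 b H by (auto simp: SL_iff)
  show ?thesis
  proof (rule that)
    show "minor id k b \<noteq> 0" using cm k z b(1) by (intro minor_id_corner_neq_0[of _ n]) auto
    show "minor r k h = minor id k b * (\<Prod>a<k. f (r a)) * minor r k g0" if "\<forall>a<k. r a < n" for r
      unfolding b(2) using that cm k z b(1)
      by (subst minor_diag[of _ _ n], simp_all) (subst minor_mult[of _ n n _ n], simp_all)
  qed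
qed

text \<open>By homogeneity a minor that vanishes at the base point vanishes on its orbit, and hence
  on the closure. This shows that an unknown base point of a dense orbit is generic.\<close>

lemma minor_closure:
  assumes g0: "g0 \<in> carrier (SL n)" and H: "H \<subseteq> carrier (SL n)"
    and z: "\<forall>b\<in>H. \<forall>i\<in>{k..<n}. \<forall>j<k. b $$ (i, j) = 0"
    and k: "k \<le> n" and r: "\<forall>a<k. r a < n"
    and X: "X \<subseteq> quot_closure n H (torus_orbit n (mat_coset g0 H))"
    and g: "x \<in> X" "g \<in> x" "minor r k g \<noteq> 0"
  shows "minor r k g0 \<noteq> 0"
proof
  assume 0: "minor r k g0 = 0"
  have "minor r k s = 0" if s: "s \<in> \<Union>(torus_orbit n (mat_coset g0 H))" for s
  proof -
    obtain f where "s \<in> mat_diag n f <#\<^bsub>SL n\<^esub> (mat_coset g0 H)" using s by (auto simp: torus_iff)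
    from corner_coset_minor[OF g0 H z k this] obtain y where
      "minor r k s = y * (\<Prod>a<k. f (r a)) * minor r k g0" using r by metis
    thus ?thesis using 0 by simp
  qed
  moreover have "g \<in> zariski_closure n (\<Union>(torus_orbit n (mat_coset g0 H)))"
    using X g by (auto simp: quot_closure_def)
  ultimately have "minor r k g = 0"
    using minor_poly_funs[OF k, of r] r unfolding zariski_closure_def by blast
  with g show False by simp
qed

text \<open>The character of the quotient of the minors for \<open>r\<close> and \<open>r'\<close>.
  Matrix rows start at 0 and characters at 1, hence \<open>Suc\<close>.\<close>

definition minor_weight :: "(nat \<Rightarrow> nat) \<Rightarrow> (nat \<Rightarrow> nat) \<Rightarrow> nat \<Rightarrow> nat \<Rightarrow> int" where
  "minor_weight r r' k i = (\<Sum>a<k. of_bool (i = Suc (r a)) - of_bool (i = Suc (r' a)))"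

lemma minor_weight_pairing:
  fixes \<mu> :: "nat \<Rightarrow> 'a::comm_ring_1"
  assumes r: "\<forall>a<k. r a < n" "\<forall>a<k. r' a < n"
  shows "(\<Sum>i=1..n. of_int (minor_weight r r' k i) * \<mu> (i - 1)) = (\<Sum>a<k. \<mu> (r a)) - (\<Sum>a<k. \<mu> (r' a))"
proof -
  have 1: "(\<Sum>i=1..n. of_bool (i = Suc b) * \<mu> (i - 1)) = \<mu> b" if "b < n" for b
  proof -
    have "(\<Sum>i=1..n. of_bool (i = Suc b) * \<mu> (i - 1)) = (\<Sum>i\<in>{Suc b}. of_bool (i = Suc b) * \<mu> (i - 1))"
      using that by (intro sum.mono_neutral_right) auto
    thus ?thesis by simp
  qed
  have "(\<Sum>i=1..n. of_int (minor_weight r r' k i) * \<mu> (i - 1)) =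
      (\<Sum>i=1..n. \<Sum>a<k. of_bool (i = Suc (r a)) * \<mu> (i - 1) - of_bool (i = Suc (r' a)) * \<mu> (i - 1))"
    by (simp add: minor_weight_def sum_distrib_right left_diff_distrib)
  also have "\<dots> = (\<Sum>a<k. \<Sum>i=1..n. of_bool (i = Suc (r a)) * \<mu> (i - 1) - of_bool (i = Suc (r' a)) * \<mu> (i - 1))"
    by (rule sum.swap)
  also have "\<dots> = (\<Sum>a<k. \<mu> (r a) - \<mu> (r' a))"
  proof (intro sum.cong refl)
    fix a assume "a \<in> {..<k}"
    thus "(\<Sum>i=1..n. of_bool (i = Suc (r a)) * \<mu> (i - 1) - of_bool (i = Suc (r' a)) * \<mu> (i - 1))
        = \<mu> (r a) - \<mu> (r' a)"
      using r[rule_format] 1[of "r a"] 1[of "r' a"] by (simp only: sum_subtractf lessThan_iff)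
  qed
  finally show ?thesis by (simp add: sum_subtractf)
qed

lemma minor_weight_root_lattice:
  assumes r: "\<forall>a<k. r a < n" "\<forall>a<k. r' a < n"
  shows "minor_weight r r' k \<in> root_lattice n"
proof -
  have "minor_weight r r' k i = 0" if "i \<notin> {1..n}" for i
    unfolding minor_weight_def using that r by (intro sum.neutral) fastforce
  moreover have "(\<Sum>i=1..n. minor_weight r r' k i) = 0"
    using minor_weight_pairing[of k r n r' "\<lambda>_. 1 :: int"] r by simp
  ultimately show ?thesis by (auto simp: root_lattice_def)
qed

lemma power_int_sum:
  fixes x :: "'a::field"
  assumes "x \<noteq> 0"
  shows "x powi (\<Sum>i\<in>I. f i) = (\<Prod>i\<in>I. x powi f i)"
  using assms by (induction I rule: infinite_finite_induct) (auto simp: power_int_add)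

lemma character_minor_weight:
  assumes r: "\<forall>a<k. r a < n" "\<forall>a<k. r' a < n" and f: "\<forall>i<n. f i \<noteq> 0"
  shows "character n (minor_weight r r' k) (mat_diag n f) = (\<Prod>a<k. f (r a)) / (\<Prod>a<k. f (r' a))"
proof -
  have 1: "(\<Prod>i=1..n. f (i - 1) powi of_bool (i = Suc b)) = f b" if "b < n" for b
  proof -
    have "(\<Prod>i=1..n. f (i - 1) powi of_bool (i = Suc b)) = (\<Prod>i\<in>{Suc b}. f (i - 1) powi of_bool (i = Suc b))"
      using that by (intro prod.mono_neutral_right) auto
    thus ?thesis by simp
  qed
  have "character n (minor_weight r r' k) (mat_diag n f) =
      (\<Prod>i=1..n. \<Prod>a<k. f (i - 1) powi of_bool (i = Suc (r a)) / f (i - 1) powi of_bool (i = Suc (r' a)))"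
    unfolding character_def minor_weight_def
  proof (intro prod.cong refl)
    fix i assume i: "i \<in> {1..n}"
    hence "i - 1 < n" by auto
    with i have fi: "f (i - 1) \<noteq> 0" "mat_diag n f $$ (i - 1, i - 1) = f (i - 1)"
      using f by (auto simp: mat_diag_def)
    show "mat_diag n f $$ (i - 1, i - 1) powi (\<Sum>a<k. of_bool (i = Suc (r a)) - of_bool (i = Suc (r' a))) =
      (\<Prod>a<k. f (i - 1) powi of_bool (i = Suc (r a)) / f (i - 1) powi of_bool (i = Suc (r' a)))"
      unfolding fi power_int_sum[OF fi(1)] using fi(1) by (intro prod.cong refl power_int_diff) auto
  qed
  also have "\<dots> = (\<Prod>a<k. \<Prod>i=1..n. f (i - 1) powi of_bool (i = Suc (r a)) / f (i - 1) powi of_bool (i = Suc (r' a)))"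
    by (rule prod.swap)
  also have "\<dots> = (\<Prod>a<k. f (r a) / f (r' a))"
  proof (intro prod.cong refl)
    fix a assume "a \<in> {..<k}"
    thus "(\<Prod>i=1..n. f (i - 1) powi of_bool (i = Suc (r a)) / f (i - 1) powi of_bool (i = Suc (r' a)))
        = f (r a) / f (r' a)"
      using r[rule_format] 1[of "r a"] 1[of "r' a"] by (simp only: prod_dividef lessThan_iff)
  qed
  finally show ?thesis by (simp add: prod_dividef)
qed

text \<open>The torus scales a minor by the product of its entries in the selected rows, so the
  character is a quotient of minors up to a constant, and the denominator is nonzero at
  \<open>g\<close>.\<close>

lemma char_regular_minor_weight:
  assumes g0: "g0 \<in> carrier (SL n)" and H: "H \<subseteq> carrier (SL n)"
    and z: "\<forall>b\<in>H. \<forall>i\<in>{k..<n}. \<forall>j<k. b $$ (i, j) = 0"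
    and k: "k \<le> n" and r: "\<forall>a<k. r a < n" "\<forall>a<k. r' a < n"
    and x0: "mat_coset g0 H \<in> X"
    and X: "X \<subseteq> quot_closure n H (torus_orbit n (mat_coset g0 H))"
    and nz: "minor r k g0 \<noteq> 0" "minor r' k g0 \<noteq> 0"
    and g: "g \<in> x" "minor r' k g \<noteq> 0"
  shows "char_regular n H X x (minor_weight r r' k)"
  unfolding char_regular_def
proof (intro bexI[OF _ x0] conjI X)
  have q: "minor r' k \<in> poly_funs n" using k r by (intro minor_poly_funs) auto
  \<comment> \<open>The constant normalises the quotient to 1 at the base point
    \<open>g0\<close>.\<close>
  have p: "(\<lambda>A. minor r' k g0 / minor r k g0 * minor r k A) \<in> poly_funs n"
    using k r by (intro poly_funs.mult poly_funs.const minor_poly_funs) auto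
  have "character n (minor_weight r r' k) t * minor r' k h = minor r' k g0 / minor r k g0 * minor r k h"
    if "t \<in> torus_SL n" and h: "h \<in> t <#\<^bsub>SL n\<^esub> (mat_coset g0 H)" for t h
  proof -
    obtain f where f: "(\<Prod>i<n. f i) = 1" "t = mat_diag n f" using \<open>t \<in> _\<close> by (auto simp: torus_iff)
    have f0: "\<forall>i<n. f i \<noteq> 0" using f(1) by (metis finite_lessThan lessThan_iff prod_zero zero_neq_one)
    obtain y where y: "y \<noteq> 0"
      "\<And>r. \<forall>a<k. r a < n \<Longrightarrow> minor r k h = y * (\<Prod>a<k. f (r a)) * minor r k g0"
      using corner_coset_minor[OF g0 H z k h[unfolded f(2)]] by blast
    have p: "(\<Prod>a<k. f (r' a)) \<noteq> 0" using f0 r by (simp add: prod_zero_iff)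
    show ?thesis
      unfolding f(2) character_minor_weight[OF r f0] y(2)[OF r(1)] y(2)[OF r(2)]
      using nz p by (simp add: field_simps)
  qed
  thus "\<exists>p\<in>poly_funs n. \<exists>q\<in>poly_funs n. (\<exists>g\<in>x. q g \<noteq> 0) \<and>
      (\<forall>t\<in>torus_SL n. \<forall>h\<in>t <#\<^bsub>SL n\<^esub> (mat_coset g0 H). character n (minor_weight r r' k) t * q h = p h)"
    by (intro bexI[OF _ p] bexI[OF _ q] conjI bexI[OF _ g(1)] g(2) ballI)
qed

section \<open>Limits along real one-parameter subgroups\<close>

abbreviation weight_curve :: "nat \<Rightarrow> (nat \<Rightarrow> complex) \<Rightarrow> (nat \<Rightarrow> real) \<Rightarrow> real \<Rightarrow> real \<Rightarrow> complex mat" where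
  "weight_curve n \<tau> \<mu> c s \<equiv> mat_diag n (\<lambda>r. \<tau> r * of_real (s powr (\<mu> r - c)))"

text \<open>
  The factors \<open>\<tau>\<close> move the limit within its torus orbit, and the shift \<open>c\<close>, which characters in the
  root lattice do not see, gives the torus element determinant one.
\<close>

definition degenerates :: "nat \<Rightarrow> complex mat set \<Rightarrow> (nat \<Rightarrow> real) \<Rightarrow> complex mat \<Rightarrow> bool" where
  "degenerates n x\<^sub>0 \<mu> g \<longleftrightarrow> (\<exists>\<tau> c h. (\<forall>r<n. \<tau> r \<noteq> 0) \<and>
     (\<forall>\<^sub>F s in at_right 0. weight_curve n \<tau> \<mu> c s \<in> torus_SL n \<and>
        h s \<in> weight_curve n \<tau> \<mu> c s <#\<^bsub>SL n\<^esub> x\<^sub>0) \<and>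
     (\<forall>i<n. \<forall>j<n. ((\<lambda>s. h s $$ (i, j)) \<longlongrightarrow> g $$ (i, j)) (at_right (0::real))))"

lemma degenerates_closure:
  assumes "degenerates n x\<^sub>0 \<mu> g" and g: "g \<in> carrier (SL n)"
  shows "g \<in> zariski_closure n (\<Union>(torus_orbit n x\<^sub>0))"
  unfolding zariski_closure_def
proof (intro CollectI conjI g ballI impI)
  fix f assume f: "f \<in> poly_funs n"
    and v: "\<forall>s\<in>\<Union>(torus_orbit n x\<^sub>0). f s = 0"
  obtain \<tau> c h where
    ev: "\<forall>\<^sub>F s in at_right 0. weight_curve n \<tau> \<mu> c s \<in> torus_SL n \<and>
        h s \<in> weight_curve n \<tau> \<mu> c s <#\<^bsub>SL n\<^esub> x\<^sub>0"
    and lim: "\<And>i j. i < n \<Longrightarrow> j < n \<Longrightarrow> ((\<lambda>s. h s $$ (i, j)) \<longlongrightarrow> g $$ (i, j)) (at_right (0::real))"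
    using assms unfolding degenerates_def by blast
  have "((\<lambda>s. f (h s)) \<longlongrightarrow> f g) (at_right 0)" using f lim by (rule poly_funs_tendsto)
  moreover have "\<forall>\<^sub>F s in at_right 0. f (h s) = 0" using ev by eventually_elim (use v in blast)
  hence "((\<lambda>s. f (h s)) \<longlongrightarrow> 0) (at_right 0)" by (rule tendsto_eventually)
  ultimately show "f g = 0" by (rule tendsto_unique[OF trivial_limit_at_right_real])
qed

lemma powr_tendsto_0_at_right: "a > 0 \<Longrightarrow> ((\<lambda>s. s powr a) \<longlongrightarrow> 0) (at_right (0::real))"
  by (rule tendsto_eq_rhs[OF tendsto_powr'[where b = a]])
    (auto intro!: tendsto_intros eventually_at_right_less simp: eventually_at_filter)

lemma character_curve:
  fixes \<tau> :: "nat \<Rightarrow> complex" and \<mu> :: "nat \<Rightarrow> real"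
  assumes s: "s > 0" and m: "m \<in> root_lattice n"
  shows "character n m (weight_curve n \<tau> \<mu> c s) =
    (\<Prod>i=1..n. \<tau> (i - 1) powi m i) * of_real (s powr (\<Sum>i=1..n. of_int (m i) * \<mu> (i - 1)))"
proof -
  have "character n m (weight_curve n \<tau> \<mu> c s) =
      (\<Prod>i=1..n. \<tau> (i - 1) powi m i * of_real (s powr (of_int (m i) * (\<mu> (i - 1) - c))))"
    unfolding character_def
  proof (intro prod.cong refl)
    fix i assume "i \<in> {1..n}"
    hence "weight_curve n \<tau> \<mu> c s $$ (i - 1, i - 1) =
        \<tau> (i - 1) * of_real (s powr (\<mu> (i - 1) - c))"
      by (auto simp: mat_diag_def)
    moreover have "(s powr (\<mu> (i - 1) - c)) powi m i = s powr (of_int (m i) * (\<mu> (i - 1) - c))"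
      using s by (subst powr_real_of_int'[symmetric]) (auto simp: powr_powr mult.commute)
    ultimately show "weight_curve n \<tau> \<mu> c s $$ (i - 1, i - 1) powi m i =
        \<tau> (i - 1) powi m i * of_real (s powr (of_int (m i) * (\<mu> (i - 1) - c)))"
      by (simp add: power_int_mult_distrib flip: of_real_power_int)
  qed
  also have "\<dots> = (\<Prod>i=1..n. \<tau> (i - 1) powi m i) * of_real (\<Prod>i=1..n. s powr (of_int (m i) * (\<mu> (i - 1) - c)))"
    by (simp add: prod.distrib)
  also have "(\<Prod>i=1..n. s powr (of_int (m i) * (\<mu> (i - 1) - c))) = s powr (\<Sum>i=1..n. of_int (m i) * (\<mu> (i - 1) - c))"
    using s by (simp add: powr_sum)
  also have "(\<Sum>i=1..n. of_int (m i) * (\<mu> (i - 1) - c)) =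
      (\<Sum>i=1..n. of_int (m i) * \<mu> (i - 1)) - of_int (\<Sum>i=1..n. m i) * c"
    by (simp add: right_diff_distrib sum_subtractf sum_distrib_right)
  also have "(\<Sum>i=1..n. m i) = 0" using m by (simp add: root_lattice_def)
  finally show ?thesis by simp
qed

text \<open>Along the curve the character is a nonzero constant times a power of \<open>s\<close>. A
  negative exponent, moved to the side of \<open>p\<close>, would force \<open>q\<close> to vanish
  at the limit.\<close>

lemma degenerates_pairing:
  assumes "degenerates n x\<^sub>0 \<mu> g" and m: "m \<in> root_lattice n"
    and pq: "p \<in> poly_funs n" "q \<in> poly_funs n" "q g \<noteq> 0"
    and eq: "\<forall>t\<in>torus_SL n. \<forall>h\<in>t <#\<^bsub>SL n\<^esub> x\<^sub>0. character n m t * q h = p h"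
  shows "(\<Sum>i=1..n. of_int (m i) * \<mu> (i - 1)) \<ge> 0"
proof (rule ccontr)
  let ?\<sigma> = "\<Sum>i=1..n. of_int (m i) * \<mu> (i - 1)"
  assume neg: "\<not> ?\<sigma> \<ge> 0"
  obtain \<tau> c h where \<tau>: "\<And>r. r < n \<Longrightarrow> \<tau> r \<noteq> 0" and
    ev: "\<forall>\<^sub>F s in at_right 0. weight_curve n \<tau> \<mu> c s \<in> torus_SL n \<and>
        h s \<in> weight_curve n \<tau> \<mu> c s <#\<^bsub>SL n\<^esub> x\<^sub>0"
    and lim: "\<And>i j. i < n \<Longrightarrow> j < n \<Longrightarrow> ((\<lambda>s. h s $$ (i, j)) \<longlongrightarrow> g $$ (i, j)) (at_right (0::real))"
    using assms(1) unfolding degenerates_def by blast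
  define C where "C = (\<Prod>i=1..n. \<tau> (i - 1) powi m i)"
  have C: "C \<noteq> 0" unfolding C_def using \<tau> by (auto simp: prod_zero_iff)
  have "\<forall>\<^sub>F s::real in at_right 0. s > 0" by (rule eventually_at_right_less)
  with ev have "\<forall>\<^sub>F s in at_right 0. C * q (h s) = of_real (s powr (- ?\<sigma>)) * p (h s)"
  proof eventually_elim
    case (elim s)
    let ?A = "complex_of_real (s powr ?\<sigma>)" and ?B = "complex_of_real (s powr (- ?\<sigma>))"
    have "C * ?A * q (h s) = p (h s)"
      using eq elim(1) character_curve[OF elim(2) m, of \<tau> \<mu> c] unfolding C_def by auto
    hence "?B * p (h s) = ?B * (C * ?A * q (h s))" by (simp only:)
    also have "\<dots> = (?B * ?A) * (C * q (h s))" by (simp only: ac_simps)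
    also have "?B * ?A = 1" using elim(2) by (simp flip: of_real_mult powr_add)
    finally show ?case by simp
  qed
  hence e: "((\<lambda>s. C * q (h s)) \<longlongrightarrow> l) (at_right 0) \<longleftrightarrow>
      ((\<lambda>s. of_real (s powr (- ?\<sigma>)) * p (h s)) \<longlongrightarrow> l) (at_right 0)" for l
    by (rule tendsto_cong)
  have "((\<lambda>s. of_real (s powr (- ?\<sigma>)) * p (h s)) \<longlongrightarrow> of_real 0 * p g) (at_right 0)"
    using neg by (intro tendsto_mult tendsto_of_real powr_tendsto_0_at_right poly_funs_tendsto[OF pq(1) lim]) auto
  hence "((\<lambda>s. C * q (h s)) \<longlongrightarrow> 0) (at_right 0)" unfolding e by simp
  moreover have "((\<lambda>s. C * q (h s)) \<longlongrightarrow> C * q g) (at_right 0)"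
    by (intro tendsto_intros poly_funs_tendsto[OF pq(2) lim])
  ultimately have "C * q g = 0" by (rule tendsto_unique[OF trivial_limit_at_right_real, rotated])
  thus False using C pq(3) by simp
qed

section \<open>Matrices with lower left block of rank at most one\<close>

lemma less_double_cases:
  assumes "i < 2 * (d::nat)"
  obtains "i < d" | i' where "i = d + i'" "i' < d"
  using assms by (metis add_less_cancel_left le_Suc_ex mult_2 not_less)

text \<open>Rank at most one is expressed by two by two minors, so that it is a polynomial condition
  and passes to Zariski closures.\<close>

definition lower_rank1 :: "nat \<Rightarrow> complex mat \<Rightarrow> bool" where
  "lower_rank1 d A \<longleftrightarrow> (\<forall>i<d. \<forall>i'<d. \<forall>j<d. \<forall>j'<d.
     A $$ (d + i, j) * A $$ (d + i', j') = A $$ (d + i, j') * A $$ (d + i', j))"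

definition frame :: "nat \<Rightarrow> nat \<Rightarrow> complex mat \<Rightarrow> complex mat" where
  "frame n d g = Matrix.mat n d (\<lambda>(i, c). g $$ (i, c))"

text \<open>
  The rows of the Pluecker coordinates that do not all vanish on \<open>X\<^sub>w\<close>. They are not sorted, so that
  the minors are Pluecker coordinates only up to sign.
\<close>

definition adm_rows :: "nat \<Rightarrow> (nat \<Rightarrow> nat) set" where
  "adm_rows d = insert id {id(j := d + i) | i j. i < d \<and> j < d}"

definition row_sum :: "nat \<Rightarrow> (nat \<Rightarrow> real) \<Rightarrow> (nat \<Rightarrow> nat) \<Rightarrow> real" where
  "row_sum d \<mu> r = (\<Sum>a<d. \<mu> (r a))"

text \<open>The weights in the relative interior of the cone to be computed: strictness at the
  vanishing minors is what sends these minors to 0 in the limit.\<close>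

definition adapted :: "nat \<Rightarrow> complex mat \<Rightarrow> (nat \<Rightarrow> real) \<Rightarrow> bool" where
  "adapted d g \<mu> \<longleftrightarrow> (\<forall>r\<in>adm_rows d. \<forall>r'\<in>adm_rows d. minor r' d g \<noteq> 0 \<longrightarrow>
     row_sum d \<mu> r' \<le> row_sum d \<mu> r \<and> (minor r d g = 0 \<longrightarrow> row_sum d \<mu> r' < row_sum d \<mu> r))"

lemma adm_rows_less: "r \<in> adm_rows d \<Longrightarrow> a < d \<Longrightarrow> r a < 2 * d"
  by (auto simp: adm_rows_def)

lemma row_sum_update: "j < d \<Longrightarrow> row_sum d \<mu> (id(j := d + i)) = row_sum d \<mu> id + \<mu> (d + i) - \<mu> j"
  unfolding row_sum_def by (subst (1 2) sum.remove[of _ j]) (auto intro!: sum.cong)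

lemma lower_rank1_mult:
  assumes A: "A \<in> carrier_mat (2 * d) m" and b: "b \<in> carrier_mat m l" and "d \<le> m" "d \<le> l"
    and z: "\<forall>i\<in>{d..<m}. \<forall>j<d. b $$ (i, j) = 0" and r1: "lower_rank1 d A"
  shows "lower_rank1 d (A * b)"
proof -
  have e: "(A * b) $$ (d + i, j) = (\<Sum>k<d. A $$ (d + i, k) * b $$ (k, j))" if "i < d" "j < d" for i j
  proof -
    have "(A * b) $$ (d + i, j) = (\<Sum>k<m. A $$ (d + i, k) * b $$ (k, j))"
      using that assms by (intro mult_mat_index[OF A b]) auto
    also have "\<dots> = (\<Sum>k<d. A $$ (d + i, k) * b $$ (k, j))"
      using that assms by (intro sum.mono_neutral_right) auto
    finally show ?thesis .
  qed
  show ?thesis unfolding lower_rank1_def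
  proof (intro allI impI)
    fix i i' j j' assume l: "i < d" "i' < d" "j < d" "j' < d"
    have "(A * b) $$ (d + i, j) * (A * b) $$ (d + i', j') =
        (\<Sum>k<d. \<Sum>k'<d. (A $$ (d + i, k) * A $$ (d + i', k')) * (b $$ (k, j) * b $$ (k', j')))"
      using l by (simp add: e sum_product mult.assoc mult.left_commute)
    \<comment> \<open>Rank one exchanges the columns \<open>k\<close> and \<open>k'\<close> in the
      first factor; swapping the two sums then moves the exchange to \<open>j\<close> and
      \<open>j'\<close>.\<close>
    also have "\<dots> = (\<Sum>k<d. \<Sum>k'<d. (A $$ (d + i, k') * A $$ (d + i', k)) * (b $$ (k, j) * b $$ (k', j')))"
    proof (intro sum.cong refl)
      fix k k' assume "k \<in> {..<d}" "k' \<in> {..<d}"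
      hence "A $$ (d + i, k) * A $$ (d + i', k') = A $$ (d + i, k') * A $$ (d + i', k)"
        using r1 l unfolding lower_rank1_def by blast
      thus "(A $$ (d + i, k) * A $$ (d + i', k')) * (b $$ (k, j) * b $$ (k', j')) =
        (A $$ (d + i, k') * A $$ (d + i', k)) * (b $$ (k, j) * b $$ (k', j'))" by simp
    qed
    also have "\<dots> = (\<Sum>k'<d. \<Sum>k<d. (A $$ (d + i, k') * A $$ (d + i', k)) * (b $$ (k, j) * b $$ (k', j')))"
      by (rule sum.swap)
    also have "\<dots> = (A * b) $$ (d + i, j') * (A * b) $$ (d + i', j)"
      using l by (simp add: e sum_product ac_simps)
    finally show "(A * b) $$ (d + i, j) * (A * b) $$ (d + i', j') = (A * b) $$ (d + i, j') * (A * b) $$ (d + i', j)" .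
  qed
qed

text \<open>This is the affine chart of the Grassmannian where the minor of \<open>r\<close> is
  nonzero. \<open>K\<close> is the submatrix of the rows \<open>r\<close> and \<open>L\<close> its
  inverse; all minors change by the common factor \<open>det K\<close>.\<close>

lemma normal_frame:
  fixes F :: "complex mat"
  assumes F: "F \<in> carrier_mat n d" and r: "\<forall>a<d. r a < n" and nz: "minor r d F \<noteq> 0"
  obtains G K L where "G \<in> carrier_mat n d" "K \<in> carrier_mat d d" "L \<in> carrier_mat d d"
    "F = G * K" "G = F * L" "\<forall>a<d. \<forall>c<d. G $$ (r a, c) = (if a = c then 1 else 0)"
    "\<forall>r'. (\<forall>a<d. r' a < n) \<longrightarrow> (minor r' d G = 0 \<longleftrightarrow> minor r' d F = 0)"
proof -
  define K where "K = Matrix.mat d d (\<lambda>(a, c). F $$ (r a, c))"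
  have K: "K \<in> carrier_mat d d" "det K \<noteq> 0" using nz by (auto simp: K_def minor_def)
  obtain L where L: "L \<in> carrier_mat d d" "L * K = 1\<^sub>m d" "K * L = 1\<^sub>m d"
    using det_non_zero_imp_unit[OF K] by (auto simp: Units_def ring_mat_def)
  define G where "G = F * L"
  have G: "G \<in> carrier_mat n d" using F L by (simp add: G_def)
  have FK: "F = G * K" unfolding G_def using F L K by (simp add: assoc_mult_mat[OF F L(1) K(1)])
  have m: "minor r' d F = minor r' d G * minor id d K" if "\<forall>a<d. r' a < n" for r'
    unfolding FK using that by (intro minor_mult[OF G K(1)]) auto
  have "G $$ (r a, c) = (if a = c then 1 else 0)" if ac: "a < d" "c < d" for a c
  proof -
    have "G $$ (r a, c) = (\<Sum>k<d. F $$ (r a, k) * L $$ (k, c))"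
      unfolding G_def using r ac by (intro mult_mat_index[OF F L(1)]) auto
    also have "\<dots> = (K * L) $$ (a, c)"
      using ac by (subst mult_mat_index[OF K(1) L(1)]) (auto simp: K_def)
    finally show ?thesis using ac L by simp
  qed
  moreover have "minor r' d G = 0 \<longleftrightarrow> minor r' d F = 0" if "\<forall>a<d. r' a < n" for r'
    using m[OF that] K(2) minor_id_eq_det[OF K(1)] by simp
  ultimately show ?thesis by (intro that[OF G K(1) L(1) FK G_def]) blast+
qed

section \<open>Degenerations in an affine chart\<close>

lemma complex_root_exists:
  assumes "n > 0"
  obtains z where "z ^ n = (w :: complex)"
proof -
  obtain r a where w: "w = rcis r a" "r \<ge> 0" by (metis rcis_cmod_Arg norm_ge_zero)
  have "rcis (root n r) (a / n) ^ n = w"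
    unfolding DeMoivre2 w(1) using assms w(2) by simp
  thus ?thesis by (rule that)
qed

text \<open>A torus element \<open>t\<close>, followed by the column operations that restore the
  unit rows, multiplies the entry \<open>(i, c)\<close> of a frame by \<open>t i / t (r c)\<close>.
  A degeneration can thus be checked entry by entry in the chart, with determinants and the
  remaining columns handled once and for all.\<close>

lemma degenerates_frame:
  assumes d: "d < n" and g: "g0 \<in> carrier (SL n)" "g \<in> carrier (SL n)"
    and cm: "G0 \<in> carrier_mat n d" "G \<in> carrier_mat n d" "L \<in> carrier_mat d d" "K \<in> carrier_mat d d"
    and F: "G0 = frame n d g0 * L" "frame n d g = G * K"
    and r: "\<forall>a<d. r a < n" and \<tau>: "\<forall>i<n. \<tau> i \<noteq> 0"
    and lim: "\<And>i c. i < n \<Longrightarrow> c < d \<Longrightarrow>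
       ((\<lambda>s. \<tau> i / \<tau> (r c) * of_real (s powr (\<mu> i - \<mu> (r c))) * G0 $$ (i, c)) \<longlongrightarrow> G $$ (i, c)) (at_right (0::real))"
  shows "degenerates n (mat_coset g0 (parabolic_SL n d)) \<mu> g"
proof -
  have n: "n > 0" using d by simp
  \<comment> \<open>The mean of the weights makes the exponents add up to 0, and the root
    \<open>\<zeta>\<close> cancels the product of the \<open>\<tau> i\<close>; together they give
    determinant one.\<close>
  define c where "c = (\<Sum>i<n. \<mu> i) / n"
  obtain \<zeta> where \<zeta>: "\<zeta> ^ n = 1 / (\<Prod>i<n. \<tau> i)" using complex_root_exists[OF n] .
  have p0: "(\<Prod>i<n. \<tau> i) \<noteq> 0" using \<tau> by simp
  have \<zeta>0: "\<zeta> \<noteq> 0" using \<zeta> p0 n by (metis divide_eq_0_iff power_eq_0_iff zero_neq_one)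
  define T where "T s i = \<zeta> * \<tau> i * complex_of_real (s powr (\<mu> i - c))" for s i
  have T0: "T s i \<noteq> 0" if "s > 0" "i < n" for s i using that \<tau> \<zeta>0 by (simp add: T_def)
  have Tprod: "(\<Prod>i<n. T s i) = 1" if "s > 0" for s
  proof -
    have "(\<Prod>i<n. T s i) = \<zeta> ^ n * (\<Prod>i<n. \<tau> i) * of_real (\<Prod>i<n. s powr (\<mu> i - c))"
      by (simp add: T_def prod.distrib)
    also have "(\<Prod>i<n. s powr (\<mu> i - c)) = s powr (\<Sum>i<n. \<mu> i - c)" using that by (simp add: powr_sum)
    also have "(\<Sum>i<n. \<mu> i - c) = 0" using n by (simp add: sum_subtractf c_def)
    finally show ?thesis using that \<zeta> p0 by simp
  qed
  have Tq: "T s i / T s k = \<tau> i / \<tau> k * of_real (s powr (\<mu> i - \<mu> k))" if "s > 0" "k < n" for s i k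
  proof -
    have "s powr (\<mu> i - c) / s powr (\<mu> k - c) = s powr (\<mu> i - \<mu> k)"
      using that by (simp flip: powr_diff)
    thus ?thesis unfolding T_def using \<zeta>0 \<tau> that
      by (metis (no_types, lifting) mult.assoc mult_divide_mult_cancel_left of_real_divide times_divide_times_eq)
  qed
  \<comment> \<open>Only the first \<open>d\<close> columns matter for the coset; the others are those of \<open>g\<close>, one of them
    rescaled to restore the determinant.\<close>
  define U where "U s = Matrix.mat n n (\<lambda>(i, j). if j < d
      then (\<Sum>k<d. T s i / T s (r k) * G0 $$ (i, k) * K $$ (k, j)) else g $$ (i, j))" for s
  define h where "h s = Matrix.mat n n (\<lambda>(i, j). if j = d then U s $$ (i, j) / det (U s) else U s $$ (i, j))" for s
  have gc: "g \<in> carrier_mat n n" "det g = 1" "g0 \<in> carrier_mat n n" using g by (auto simp: SL_iff)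
  have Uc: "U s \<in> carrier_mat n n" for s by (simp add: U_def)
  have pos: "\<forall>\<^sub>F s in at_right 0. s > (0::real)" by (rule eventually_at_right_less)
  have Ulim: "((\<lambda>s. U s $$ (i, j)) \<longlongrightarrow> g $$ (i, j)) (at_right 0)" if ij: "i < n" "j < n" for i j
  proof (cases "j < d")
    case True
    have "((\<lambda>s. T s i / T s (r k) * G0 $$ (i, k)) \<longlongrightarrow> G $$ (i, k)) (at_right 0)" if "k < d" for k
    proof -
      have "\<forall>\<^sub>F s in at_right 0. \<tau> i / \<tau> (r k) * of_real (s powr (\<mu> i - \<mu> (r k))) * G0 $$ (i, k)
          = T s i / T s (r k) * G0 $$ (i, k)"
        using pos by eventually_elim (use r that Tq in auto)
      from tendsto_cong[OF this] show ?thesis using lim[OF ij(1) that] by blast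
    qed
    hence "((\<lambda>s. \<Sum>k<d. T s i / T s (r k) * G0 $$ (i, k) * K $$ (k, j)) \<longlongrightarrow> (\<Sum>k<d. G $$ (i, k) * K $$ (k, j))) (at_right 0)"
      by (intro tendsto_sum tendsto_mult tendsto_const) auto
    moreover have "(\<Sum>k<d. G $$ (i, k) * K $$ (k, j)) = g $$ (i, j)"
      using ij True by (simp add: frame_def flip: mult_mat_index[OF cm(2,4)] F(2))
    ultimately show ?thesis using ij True by (simp add: U_def)
  qed (use ij in \<open>simp add: U_def\<close>)
  have "((\<lambda>s. minor id n (U s)) \<longlongrightarrow> minor id n g) (at_right 0)"
    by (intro poly_funs_tendsto[OF minor_poly_funs Ulim]) auto
  hence detlim: "((\<lambda>s. det (U s)) \<longlongrightarrow> 1) (at_right 0)" using gc by (simp add: minor_id_eq_det[OF Uc] minor_id_eq_det)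
  hence det0: "\<forall>\<^sub>F s in at_right 0. det (U s) \<noteq> 0" by (rule tendsto_imp_eventually_ne) simp
  have hlim: "((\<lambda>s. h s $$ (i, j)) \<longlongrightarrow> g $$ (i, j)) (at_right 0)" if "i < n" "j < n" for i j
  proof (cases "j = d")
    case True
    have "((\<lambda>s. U s $$ (i, j) / det (U s)) \<longlongrightarrow> g $$ (i, j) / 1) (at_right 0)"
      by (intro tendsto_divide Ulim detlim that) simp
    thus ?thesis using that True by (simp add: h_def)
  qed (use that Ulim in \<open>simp add: h_def\<close>)
  have mem: "mat_diag n (T s) \<in> torus_SL n \<and>
      h s \<in> mat_diag n (T s) <#\<^bsub>SL n\<^esub> (mat_coset g0 (parabolic_SL n d))"
    if s: "s > 0" and ne: "det (U s) \<noteq> 0" for s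
  proof
    show t: "mat_diag n (T s) \<in> torus_SL n" using Tprod[OF s] by (auto simp: torus_iff)
    hence tc: "mat_diag n (T s) \<in> carrier (SL n)" by (simp add: torus_SL_def)
    have hS: "h s \<in> carrier (SL n)" unfolding h_def by (rule scale_column_SL[OF Uc ne d])
    \<comment> \<open>Substituting \<open>G0 = frame n d g0 * L\<close> writes the first
      \<open>d\<close> columns of \<open>h s\<close> as those of the translated base point times
      \<open>L\<close>, a diagonal matrix and \<open>K\<close>.\<close>
    have "h s \<in> (\<lambda>p. (mat_diag n (T s) * g0) * p) ` parabolic_SL n d"
    proof (rule mem_parabolic_coset[OF SL_mult[OF tc g(1)] hS])
      fix i j assume ij: "i < n" "j < d"
      have G0: "G0 $$ (i, k) = (\<Sum>l<d. g0 $$ (i, l) * L $$ (l, k))" if "k < d" for k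
        unfolding F(1) using ij that by (subst mult_mat_index[OF _ cm(3)]) (auto simp: frame_def)
      have "h s $$ (i, j) = (\<Sum>k<d. T s i / T s (r k) * (\<Sum>l<d. g0 $$ (i, l) * L $$ (l, k)) * K $$ (k, j))"
        using ij d by (simp add: h_def U_def G0)
      also have "\<dots> = (\<Sum>k<d. \<Sum>l<d. (T s i * g0 $$ (i, l)) * (L $$ (l, k) * K $$ (k, j) / T s (r k)))"
        by (simp add: sum_distrib_left sum_distrib_right field_simps)
      also have "\<dots> = (\<Sum>l<d. \<Sum>k<d. (T s i * g0 $$ (i, l)) * (L $$ (l, k) * K $$ (k, j) / T s (r k)))"
        by (rule sum.swap)
      also have "\<dots> = (\<Sum>l<d. (mat_diag n (T s) * g0) $$ (i, l) * (\<Sum>k<d. L $$ (l, k) * K $$ (k, j) / T s (r k)))"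
        using ij d by (simp add: mat_diag_mult_left[OF gc(3)] sum_distrib_left)
      finally show "h s $$ (i, j) = (\<Sum>l<d. (mat_diag n (T s) * g0) $$ (i, l) * (\<Sum>k<d. L $$ (l, k) * K $$ (k, j) / T s (r k)))" .
    qed (use d in simp)
    then obtain p where p: "p \<in> parabolic_SL n d" "h s = (mat_diag n (T s) * g0) * p" by blast
    have "p \<in> carrier_mat n n" using p by (simp add: parabolic_SL_def SL_iff)
    hence "h s = mat_diag n (T s) * (g0 * p)"
      unfolding p(2) using gc by (intro assoc_mult_mat[of _ n n _ n _ n]) auto
    thus "h s \<in> mat_diag n (T s) <#\<^bsub>SL n\<^esub> (mat_coset g0 (parabolic_SL n d))"
      using p(1) by (auto simp: l_coset_SL)
  qed
  show ?thesis unfolding degenerates_def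
  proof (intro exI[of _ "\<lambda>i. \<zeta> * \<tau> i"] exI[of _ c] exI[of _ h] conjI allI impI hlim)
    show "\<forall>\<^sub>F s in at_right 0. mat_diag n (\<lambda>i. \<zeta> * \<tau> i * of_real (s powr (\<mu> i - c))) \<in> torus_SL n \<and>
        h s \<in> mat_diag n (\<lambda>i. \<zeta> * \<tau> i * of_real (s powr (\<mu> i - c))) <#\<^bsub>SL n\<^esub> (mat_coset g0 (parabolic_SL n d))"
      using pos det0 by eventually_elim (use mem in \<open>simp add: T_def[abs_def]\<close>)
  qed (use \<tau> \<zeta>0 in auto)
qed

lemma tendsto_scaled_powr:
  assumes "x = 0 \<Longrightarrow> e > 0" "x \<noteq> 0 \<Longrightarrow> e = 0 \<and> \<rho> * x0 = x"
  shows "((\<lambda>s. \<rho> * of_real (s powr e) * x0) \<longlongrightarrow> (x::complex)) (at_right (0::real))"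
proof (cases "x = 0")
  case True
  have "((\<lambda>s. \<rho> * of_real (s powr e) * x0) \<longlongrightarrow> \<rho> * of_real 0 * x0) (at_right (0::real))"
    using assms(1)[OF True] by (intro tendsto_intros powr_tendsto_0_at_right)
  thus ?thesis using True by simp
next
  case False
  have "\<forall>\<^sub>F s in at_right (0::real). \<rho> * of_real (s powr e) * x0 = x"
    using eventually_at_right_less[of "0::real"] by eventually_elim (use assms(2)[OF False] in simp)
  thus ?thesis by (rule tendsto_eventually)
qed

text \<open>The chart is taken around a nonvanishing minor, one with a lower row if possible. There
  rank one leaves as free entries only the row \<open>j0\<close> and the lower part of the column
  \<open>j0\<close>. Each is a minor up to sign, so its exponent is a difference of two values of
  \<open>row_sum\<close>: positive where the limit entry vanishes and 0 elsewhere. The nonzero limit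
  entries are then matched by the factors \<open>\<tau>\<close>.\<close>

lemma degenerates_rank1:
  assumes d: "d \<ge> 1" and g0: "g0 \<in> carrier (SL (2 * d))" "lower_rank1 d g0"
    and g: "g \<in> carrier (SL (2 * d))" "lower_rank1 d g"
    and full: "\<forall>r\<in>adm_rows d. minor r d g0 \<noteq> 0"
    and S: "\<exists>r\<in>adm_rows d. minor r d g \<noteq> 0"
    and \<mu>: "adapted d g \<mu>"
  shows "degenerates (2 * d) (mat_coset g0 (grass_parabolic d)) \<mu> g"
proof -
  let ?n = "2 * d"
  have le: "row_sum d \<mu> r' \<le> row_sum d \<mu> r" and less: "minor r d g = 0 \<Longrightarrow> row_sum d \<mu> r' < row_sum d \<mu> r"
    if "r \<in> adm_rows d" "r' \<in> adm_rows d" "minor r' d g \<noteq> 0" for r r'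
    using \<mu> that unfolding adapted_def by blast+
  have dn: "d < ?n" using d by simp
  have fr: "frame ?n d A \<in> carrier_mat ?n d" for A by (simp add: frame_def)
  have frm: "minor r d (frame ?n d A) = minor r d A" if "r \<in> adm_rows d" for r A
    using adm_rows_less[OF that] by (intro minor_cong) (auto simp: frame_def)
  have frr: "lower_rank1 d (frame ?n d A) = lower_rank1 d A" for A
    by (auto simp: lower_rank1_def frame_def)
  have norm: "\<exists>G K L. G \<in> carrier_mat ?n d \<and> K \<in> carrier_mat d d \<and> L \<in> carrier_mat d d \<and>
       frame ?n d A = G * K \<and> G = frame ?n d A * L \<and>
       (\<forall>a<d. \<forall>c<d. G $$ (r a, c) = (if a = c then 1 else 0)) \<and>
       (\<forall>r'\<in>adm_rows d. minor r' d G = 0 \<longleftrightarrow> minor r' d A = 0) \<and> lower_rank1 d G"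
    if r: "r \<in> adm_rows d" and A: "lower_rank1 d A" "minor r d A \<noteq> 0" for r A
  proof -
    have h: "\<forall>a<d. r a < ?n" "minor r d (frame ?n d A) \<noteq> 0"
      using adm_rows_less[OF r] A(2) frm[OF r, of A] by auto
    obtain G K L where N: "G \<in> carrier_mat ?n d" "K \<in> carrier_mat d d" "L \<in> carrier_mat d d"
      "frame ?n d A = G * K" "G = frame ?n d A * L"
      "\<forall>a<d. \<forall>c<d. G $$ (r a, c) = (if a = c then 1 else 0)"
      "\<forall>r'. (\<forall>a<d. r' a < ?n) \<longrightarrow> (minor r' d G = 0 \<longleftrightarrow> minor r' d (frame ?n d A) = 0)"
      by (rule normal_frame[OF fr[of A] h])
    have "lower_rank1 d G" unfolding N(5) using N(3) A(1) frr fr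
      by (intro lower_rank1_mult[of _ d d _ d]) auto
    moreover have "minor r' d G = 0 \<longleftrightarrow> minor r' d A = 0" if "r' \<in> adm_rows d" for r'
      using N(7) adm_rows_less[OF that] frm[OF that, of A] by auto
    ultimately show ?thesis using N(1-6) by blast
  qed
  show ?thesis
  proof (cases "\<exists>i<d. \<exists>j<d. minor (id(j := d + i)) d g \<noteq> 0")
    case True
    then obtain i0 j0 where ij: "i0 < d" "j0 < d" "minor (id(j0 := d + i0)) d g \<noteq> 0" by blast
    let ?r = "id(j0 := d + i0)"
    have r: "?r \<in> adm_rows d" using ij by (auto simp: adm_rows_def)
    have rr: "id(j := d + i) \<in> adm_rows d" "id \<in> adm_rows d" if "i < d" "j < d" for i j
      using that by (auto simp: adm_rows_def)
    have ent: "G $$ (j, c) = (if j = c then 1 else 0)" if "j < d" "j \<noteq> j0" "c < d"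
      "\<forall>a<d. \<forall>c<d. G $$ (?r a, c) = (if a = c then 1 else 0)" for G :: "complex mat" and j c
      using that by (auto dest: spec[of _ j] spec[of _ c])
    have ent0: "G $$ (d + i0, c) = (if c = j0 then 1 else 0)" if "c < d"
      "\<forall>a<d. \<forall>c<d. G $$ (?r a, c) = (if a = c then 1 else 0)" for G :: "complex mat" and c
      using that ij by (auto dest: spec[of _ j0] spec[of _ c])
    \<comment> \<open>Row \<open>d + i0\<close> is a unit row with its 1 in column
      \<open>j0\<close>, and rank one makes all lower rows multiples of it.\<close>
    have low: "G $$ (d + i, c) = 0" if "i < d" "c < d" "c \<noteq> j0" "lower_rank1 d G"
      "\<forall>a<d. \<forall>c<d. G $$ (?r a, c) = (if a = c then 1 else 0)" for G :: "complex mat" and i c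
    proof -
      have "G $$ (d + i, c) * G $$ (d + i0, j0) = G $$ (d + i, j0) * G $$ (d + i0, c)"
        using that(4) that(1-3) ij unfolding lower_rank1_def by blast
      thus ?thesis using ent0[of j0 G] ent0[of c G] that(2,3,5) ij by simp
    qed
    have m1: "minor id d G = G $$ (j0, j0)" and m2: "minor (id(j0 := d + i)) d G = G $$ (d + i, j0)"
      and m3: "c < d \<Longrightarrow> c \<noteq> j0 \<Longrightarrow> minor (id(c := d + i0)) d G = 0 \<longleftrightarrow> G $$ (j0, c) = 0"
      if G: "\<forall>a<d. \<forall>c<d. G $$ (?r a, c) = (if a = c then 1 else 0)" for G :: "complex mat" and i c
    proof -
      show "minor id d G = G $$ (j0, j0)" using minor_replace_row[of j0 d G ?r j0] G ij(2) by (simp add: fun_upd_idem)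
      show "minor (id(j0 := d + i)) d G = G $$ (d + i, j0)"
        using minor_replace_row[of j0 d G ?r "d + i"] G ij(2) by simp
      assume c: "c < d" "c \<noteq> j0"
      \<comment> \<open>Position \<open>j0\<close> of \<open>?r\<close> already holds
        \<open>d + i0\<close>, so putting \<open>j0\<close> at position \<open>c\<close> gives the
        rows of \<open>id(c := d + i0)\<close> with two positions exchanged.\<close>
      have "?r(c := j0) = id(c := d + i0) \<circ> Transposition.transpose c j0"
        using c by (auto simp: fun_eq_iff Transposition.transpose_def)
      hence "minor (?r(c := j0)) d G = 0 \<longleftrightarrow> minor (id(c := d + i0)) d G = 0"
        using minor_permute[of "Transposition.transpose c j0" d "id(c := d + i0)" G] c ij(2)
        by (simp add: permutes_swap_id)
      thus "minor (id(c := d + i0)) d G = 0 \<longleftrightarrow> G $$ (j0, c) = 0"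
        using minor_replace_row[of c d G ?r j0] G c(1) by simp
    qed
    obtain G0 K0 L0 where N0: "G0 \<in> carrier_mat ?n d" "K0 \<in> carrier_mat d d" "L0 \<in> carrier_mat d d"
      "frame ?n d g0 = G0 * K0" "G0 = frame ?n d g0 * L0"
      "\<forall>a<d. \<forall>c<d. G0 $$ (?r a, c) = (if a = c then 1 else 0)"
      "\<forall>r'\<in>adm_rows d. minor r' d G0 = 0 \<longleftrightarrow> minor r' d g0 = 0" "lower_rank1 d G0"
      using norm[OF r g0(2)] full r by blast
    obtain G K L where N: "G \<in> carrier_mat ?n d" "K \<in> carrier_mat d d" "L \<in> carrier_mat d d"
      "frame ?n d g = G * K" "G = frame ?n d g * L"
      "\<forall>a<d. \<forall>c<d. G $$ (?r a, c) = (if a = c then 1 else 0)"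
      "\<forall>r'\<in>adm_rows d. minor r' d G = 0 \<longleftrightarrow> minor r' d g = 0" "lower_rank1 d G"
      using norm[OF r g(2) ij(3)] by blast
    \<comment> \<open>Target entry over base entry, with 1 where the target vanishes and the power
      of \<open>s\<close> does the work. The \<open>\<tau>\<close> solve
      \<open>\<tau> i / \<tau> (?r c) = q i c\<close> on the free entries, normalised by
      \<open>\<tau> j0 = 1\<close>; this is consistent because
      \<open>q (d + i0) j0 = 1\<close>.\<close>
    define q where "q i c = (if G $$ (i, c) = 0 then 1 else G $$ (i, c) / G0 $$ (i, c))" for i c
    define \<tau> where "\<tau> i = (if i = j0 then 1 else if i < d then 1 / q j0 i
        else q i j0 / q j0 j0)" for i
    have nz0: "G0 $$ (j0, j0) \<noteq> 0" "\<And>i. i < d \<Longrightarrow> G0 $$ (d + i, j0) \<noteq> 0"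
      "\<And>c. c < d \<Longrightarrow> c \<noteq> j0 \<Longrightarrow> G0 $$ (j0, c) \<noteq> 0"
      using m1[OF N0(6)] m2[OF N0(6)] m3[OF N0(6)] N0(7) full rr ij by metis+
    have nzc: "G0 $$ (j0, c) \<noteq> 0" if "c < d" for c using nz0 that by (cases "c = j0") auto
    have q0: "q j0 c \<noteq> 0" "q (d + i) j0 \<noteq> 0" if "c < d" "i < d" for c i
      using nzc nz0 that by (auto simp: q_def)
    have qr: "q (d + i0) j0 = 1" using ent0[OF ij(2) N(6)] ent0[OF ij(2) N0(6)] by (simp add: q_def)
    show ?thesis
    proof (rule degenerates_frame[OF dn g0(1) g(1) N0(1) N(1) N0(3) N(2) N0(5) N(4), where r = ?r and \<tau> = \<tau>])
      show "\<forall>a<d. ?r a < ?n" using adm_rows_less[OF r] by blast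
      show "\<forall>i<?n. \<tau> i \<noteq> 0"
      proof (intro allI impI)
        fix i assume i: "i < ?n"
        show "\<tau> i \<noteq> 0"
        proof (cases "i < d")
          case False
          then obtain i' where "i = d + i'" "i' < d" using i by (metis less_double_cases)
          thus ?thesis using q0 ij by (auto simp: \<tau>_def)
        qed (use q0 ij in \<open>auto simp: \<tau>_def\<close>)
      qed
    next
      fix i c assume i: "i < ?n" and c: "c < d"
      have ws: "row_sum d \<mu> ?r \<le> row_sum d \<mu> r'" "minor r' d g = 0 \<Longrightarrow> row_sum d \<mu> ?r < row_sum d \<mu> r'"
        "minor r' d g \<noteq> 0 \<Longrightarrow> row_sum d \<mu> ?r = row_sum d \<mu> r'" if "r' \<in> adm_rows d" for r'
        using le[OF that r ij(3)] less[OF that r ij(3)] le[OF r that] by auto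
      show "((\<lambda>s. \<tau> i / \<tau> (?r c) * of_real (s powr (\<mu> i - \<mu> (?r c))) * G0 $$ (i, c)) \<longlongrightarrow> G $$ (i, c)) (at_right (0::real))"
      proof (cases "i < d \<and> i \<noteq> j0")
        case True
        hence G: "G $$ (i, c) = (if i = c then 1 else 0)" "G0 $$ (i, c) = (if i = c then 1 else 0)"
          using ent[OF _ _ c N(6)] ent[OF _ _ c N0(6)] by auto
        show ?thesis
        proof (cases "i = c")
          case ic: True
          have "\<tau> c \<noteq> 0" using q0 c ij by (auto simp: \<tau>_def)
          thus ?thesis using G ic True by (intro tendsto_scaled_powr) auto
        qed (use G in simp)
      next
        case False
        show ?thesis
        proof (cases "i = j0")
          case i: True
          show ?thesis
          proof (cases "c = j0")
            case True
            have "row_sum d \<mu> id - row_sum d \<mu> ?r = \<mu> j0 - \<mu> (d + i0)" using row_sum_update[OF ij(2)] by simp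
            moreover have "minor id d g = 0 \<longleftrightarrow> G $$ (j0, j0) = 0" using N(7) rr(2)[OF ij(1,2)] m1[OF N(6)] by metis
            ultimately show ?thesis unfolding i True using ws[OF rr(2)[OF ij(1,2)]] nz0(1) qr ij
              by (intro tendsto_scaled_powr) (auto simp: \<tau>_def q_def)
          next
            case False
            have "row_sum d \<mu> (id(c := d + i0)) - row_sum d \<mu> ?r = \<mu> j0 - \<mu> c"
              using row_sum_update[OF ij(2)] row_sum_update[OF c] by simp
            moreover have "minor (id(c := d + i0)) d g = 0 \<longleftrightarrow> G $$ (j0, c) = 0"
              using bspec[OF N(7) rr(1)[OF ij(1) c]] m3[OF N(6) c False] by blast
            ultimately show ?thesis unfolding i using ws[OF rr(1)[OF ij(1) c]] nzc[OF c] c False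
              by (intro tendsto_scaled_powr) (auto simp: \<tau>_def q_def)
          qed
        next
          case False': False
          then obtain i' where i': "i = d + i'" "i' < d"
            using i False by (metis less_double_cases)
          show ?thesis
          proof (cases "c = j0")
            case True
            have "row_sum d \<mu> (id(j0 := d + i')) - row_sum d \<mu> ?r = \<mu> (d + i') - \<mu> (d + i0)"
              using row_sum_update[OF ij(2)] by simp
            moreover have "minor (id(j0 := d + i')) d g = 0 \<longleftrightarrow> G $$ (d + i', j0) = 0"
              using bspec[OF N(7) rr(1)[OF i'(2) ij(2)]] m2[OF N(6)] by metis
            ultimately show ?thesis unfolding i'(1) True
              using ws[OF rr(1)[OF i'(2) ij(2)]] nz0(2)[OF i'(2)] qr q0(1)[OF ij(2) ij(2)] ij
              by (intro tendsto_scaled_powr) (auto simp: \<tau>_def, auto simp: q_def)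
          next
            case False
            have "G $$ (i, c) = 0" "G0 $$ (i, c) = 0"
              unfolding i'(1) by (rule low[OF i'(2) c False N(8,6)] low[OF i'(2) c False N0(8,6)])+
            thus ?thesis by simp
          qed
        qed
      qed
    qed
  next
    case False
    \<comment> \<open>Only the leading minor survives, so the limit coset is torus-fixed and its
      normalised frame has zero lower block. The strict inequalities suffice, and
      \<open>\<tau>\<close> can be constantly 1.\<close>
    hence id: "minor id d g \<noteq> 0" using S by (auto simp: adm_rows_def)
    have r: "id \<in> adm_rows d" by (auto simp: adm_rows_def)
    obtain G0 K0 L0 where N0: "G0 \<in> carrier_mat ?n d" "K0 \<in> carrier_mat d d" "L0 \<in> carrier_mat d d"
      "frame ?n d g0 = G0 * K0" "G0 = frame ?n d g0 * L0"
      "\<forall>a<d. \<forall>c<d. G0 $$ (id a, c) = (if a = c then 1 else 0)"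
      "\<forall>r'\<in>adm_rows d. minor r' d G0 = 0 \<longleftrightarrow> minor r' d g0 = 0" "lower_rank1 d G0"
      using norm[OF r g0(2)] full r by blast
    obtain G K L where N: "G \<in> carrier_mat ?n d" "K \<in> carrier_mat d d" "L \<in> carrier_mat d d"
      "frame ?n d g = G * K" "G = frame ?n d g * L"
      "\<forall>a<d. \<forall>c<d. G $$ (id a, c) = (if a = c then 1 else 0)"
      "\<forall>r'\<in>adm_rows d. minor r' d G = 0 \<longleftrightarrow> minor r' d g = 0" "lower_rank1 d G"
      using norm[OF r g(2) id] by blast
    show ?thesis
    proof (rule degenerates_frame[OF dn g0(1) g(1) N0(1) N(1) N0(3) N(2) N0(5) N(4), where r = id and \<tau> = "\<lambda>_. 1"])
      fix i c assume i: "i < ?n" and c: "c < d"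
      show "((\<lambda>s. 1 / 1 * of_real (s powr (\<mu> i - \<mu> (id c))) * G0 $$ (i, c)) \<longlongrightarrow> G $$ (i, c)) (at_right (0::real))"
      proof (cases "i < d")
        case True
        with N(6) N0(6) c have "G $$ (i, c) = (if i = c then 1 else 0)" "G0 $$ (i, c) = (if i = c then 1 else 0)"
          by auto
        moreover have ?thesis if "i = c"
          using calculation that by (intro tendsto_scaled_powr) auto
        ultimately show ?thesis by (cases "i = c") auto
      next
        case False': False
        then obtain i' where i': "i = d + i'" "i' < d"
          using i by (metis less_double_cases)
        have rr: "id(c := d + i') \<in> adm_rows d" using i' c by (auto simp: adm_rows_def)
        have m: "minor (id(c := d + i')) d g = 0" using False i' c by blast
        have "G $$ (i, c) = 0"
          using minor_replace_row[of c d G id i] N(6) c bspec[OF N(7) rr] m i' by simp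
        moreover have "\<mu> i - \<mu> c > 0" using less[OF rr r id m] row_sum_update[OF c] i' by simp
        ultimately show ?thesis by (intro tendsto_scaled_powr) auto
      qed
    qed auto
  qed
qed

text \<open>The last clause makes \<open>R\<close> and \<open>C\<close> unique, by taking both empty
  as soon as their product is, and records that some minor must survive.\<close>

definition has_support :: "nat \<Rightarrow> complex mat \<Rightarrow> nat set \<Rightarrow> nat set \<Rightarrow> bool \<Rightarrow> bool" where
  "has_support d g R C z \<longleftrightarrow> R \<subseteq> {..<d} \<and> C \<subseteq> {..<d} \<and> (z \<longleftrightarrow> minor id d g \<noteq> 0) \<and>
     (\<forall>i<d. \<forall>j<d. minor (id(j := d + i)) d g \<noteq> 0 \<longleftrightarrow> i \<in> R \<and> j \<in> C) \<and>
     (R \<noteq> {} \<and> C \<noteq> {} \<or> R = {} \<and> C = {} \<and> z)"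

lemma minor_zero_row:
  fixes A :: "'a::field mat"
  assumes j: "j < k" and A: "\<And>c. c < k \<Longrightarrow> A $$ (i, c) = 0"
  shows "minor (r(j := i)) k A = 0"
  using minor_scale_row[OF j, of A i 0 i r] A by simp

lemma frame_kernel:
  assumes g: "g \<in> carrier (SL n)" and d: "d \<le> n"
    and v: "\<And>i. i < n \<Longrightarrow> (\<Sum>c<d. g $$ (i, c) * v c) = 0" and c: "c < d"
  shows "v c = 0"
proof (rule ccontr)
  assume nz: "v c \<noteq> 0"
  define u where "u c = (if c < d then v c else 0)" for c
  have "(\<Sum>c<n. g $$ (i, c) * u c) = 0" if "i < n" for i
  proof -
    have "(\<Sum>c<n. g $$ (i, c) * u c) = (\<Sum>c<d. g $$ (i, c) * v c)"
      using d by (intro sum.mono_neutral_cong_right) (auto simp: u_def)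
    thus ?thesis using v[OF that] by simp
  qed
  moreover have "u c \<noteq> 0" "c < n" using nz c d by (auto simp: u_def)
  ultimately have "minor id n g = 0" unfolding minor_eq_0_iff by auto
  thus False using g by (simp add: SL_iff minor_id_eq_det)
qed

lemma row_relation:
  fixes A :: "'a::field mat"
  assumes "minor r k A = 0"
  obtains w j where "j < k" "w j \<noteq> 0" "\<forall>c<k. (\<Sum>a<k. w a * A $$ (r a, c)) = 0"
proof -
  let ?M = "Matrix.mat k k (\<lambda>(a, c). A $$ (r a, c))"
  have "minor id k (transpose_mat ?M) = det (transpose_mat ?M)"
    unfolding minor_def by (intro arg_cong[where f = det] eq_matI) auto
  also have "\<dots> = 0" using assms by (simp add: det_transpose[of _ k] minor_def)
  finally obtain w j where w: "j < k" "w j \<noteq> 0"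
    "\<And>c. c < k \<Longrightarrow> (\<Sum>a<k. transpose_mat ?M $$ (c, a) * w a) = 0"
    unfolding minor_eq_0_iff by auto
  have "(\<Sum>a<k. w a * A $$ (r a, c)) = 0" if c: "c < k" for c
  proof -
    have "(\<Sum>a<k. w a * A $$ (r a, c)) = (\<Sum>a<k. transpose_mat ?M $$ (c, a) * w a)"
      using c by (intro sum.cong) auto
    thus ?thesis using w(3)[OF c] by simp
  qed
  with w(1,2) show ?thesis by (intro that) auto
qed

text \<open>All lower rows are multiples of one row \<open>d + i0\<close>, so the minor for
  \<open>(i, j)\<close> is a factor depending on \<open>i\<close> times a factor depending on
  \<open>j\<close>. This is the source of the product structure.\<close>

lemma has_support_exists:
  assumes g: "g \<in> carrier (SL (2 * d))" "lower_rank1 d g"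
  obtains R C z where "has_support d g R C z"
proof (cases "\<forall>i<d. \<forall>c<d. g $$ (d + i, c) = 0")
  case M0: True
  have "minor id d g \<noteq> 0"
  proof
    assume "minor id d g = 0"
    then obtain v c where v: "c < d" "v c \<noteq> 0" "\<And>a. a < d \<Longrightarrow> (\<Sum>c<d. g $$ (a, c) * v c) = 0"
      unfolding minor_eq_0_iff by auto
    have "(\<Sum>c<d. g $$ (i, c) * v c) = 0" if "i < 2 * d" for i
      using that by (cases rule: less_double_cases) (use v(3) M0 in auto)
    from frame_kernel[OF g(1) _ this v(1)] v(2) show False by simp
  qed
  thus ?thesis using M0 by (intro that[of "{}" "{}" True]) (auto simp: has_support_def minor_zero_row)
next
  case False
  then obtain i0 k0 where ik: "i0 < d" "k0 < d" "g $$ (d + i0, k0) \<noteq> 0" by blast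
  let ?t = "\<lambda>i. g $$ (d + i, k0) / g $$ (d + i0, k0)"
  have row: "g $$ (d + i, c) = ?t i * g $$ (d + i0, c)" if "i < d" "c < d" for i c
  proof -
    have "g $$ (d + i, c) * g $$ (d + i0, k0) = g $$ (d + i, k0) * g $$ (d + i0, c)"
      using g(2) that ik unfolding lower_rank1_def by blast
    thus ?thesis using ik(3) by (simp add: field_simps)
  qed
  have sc: "minor (id(j := d + i)) d g = ?t i * minor (id(j := d + i0)) d g" if "i < d" "j < d" for i j
    using that row by (intro minor_scale_row) auto
  have sc0: "minor (id(j := d + i)) d g \<noteq> 0 \<longleftrightarrow> g $$ (d + i, k0) \<noteq> 0 \<and> minor (id(j := d + i0)) d g \<noteq> 0"
    if "i < d" "j < d" for i j
    unfolding sc[OF that] using ik(3) by simp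
  define R C where RC: "R = {i. i < d \<and> g $$ (d + i, k0) \<noteq> 0}" "C = {j. j < d \<and> minor (id(j := d + i0)) d g \<noteq> 0}"
  have m: "minor (id(j := d + i)) d g \<noteq> 0 \<longleftrightarrow> i \<in> R \<and> j \<in> C" if "i < d" "j < d" for i j
    using sc0[OF that] that unfolding RC by blast
  have sub: "R \<subseteq> {..<d}" "C \<subseteq> {..<d}" "i0 \<in> R" unfolding RC using ik by auto
  show ?thesis
  proof (cases "C = {}")
    case False
    thus ?thesis using m sub by (intro that[of R C "minor id d g \<noteq> 0"]) (auto simp: has_support_def)
  next
    case True
    \<comment> \<open>If the leading minor vanished too, a relation \<open>w\<close> with
      \<open>w j \<noteq> 0\<close> would put row \<open>j\<close> into the span of the other upper
      rows. A vector killing these and row \<open>d + i0\<close> would then kill every row, against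
      the independence of the first \<open>d\<close> columns.\<close>
    have "minor id d g \<noteq> 0"
    proof
      assume "minor id d g = 0"
      then obtain w j where w: "j < d" "w j \<noteq> 0" "\<forall>c<d. (\<Sum>a<d. w a * g $$ (id a, c)) = 0"
        by (rule row_relation)
      have "minor (id(j := d + i0)) d g = 0" using True m[OF ik(1) w(1)] by blast
      then obtain v c where v: "c < d" "v c \<noteq> 0"
        "\<And>a. a < d \<Longrightarrow> (\<Sum>c<d. g $$ ((id(j := d + i0)) a, c) * v c) = 0"
        unfolding minor_eq_0_iff by auto
      have v0: "(\<Sum>c<d. g $$ (a, c) * v c) = 0" if "a < d" "a \<noteq> j" for a using v(3)[of a] that by simp
      have vi: "(\<Sum>c<d. g $$ (d + i0, c) * v c) = 0" using v(3)[of j] w(1) by simp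
      have "0 = (\<Sum>c<d. (\<Sum>a<d. w a * g $$ (a, c)) * v c)" using w(3) by simp
      also have "\<dots> = (\<Sum>c<d. \<Sum>a<d. w a * (g $$ (a, c) * v c))"
        by (simp add: sum_distrib_right mult.assoc)
      also have "\<dots> = (\<Sum>a<d. w a * (\<Sum>c<d. g $$ (a, c) * v c))"
        by (subst sum.swap) (simp add: sum_distrib_left)
      also have "\<dots> = (\<Sum>a\<in>{j}. w a * (\<Sum>c<d. g $$ (a, c) * v c))"
        using v0 w(1) by (intro sum.mono_neutral_right) auto
      finally have vj: "(\<Sum>c<d. g $$ (j, c) * v c) = 0" using w(2) by simp
      have "(\<Sum>c<d. g $$ (i, c) * v c) = 0" if "i < 2 * d" for i
        using that
      proof (cases rule: less_double_cases)
        case 1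
        thus ?thesis using v0 vj by (cases "i = j") auto
      next
        case (2 i')
        have "(\<Sum>c<d. g $$ (i, c) * v c) = (\<Sum>c<d. ?t i' * (g $$ (d + i0, c) * v c))"
          using row[OF 2(2)] by (intro sum.cong refl) (simp add: 2(1))
        also have "\<dots> = ?t i' * (\<Sum>c<d. g $$ (d + i0, c) * v c)" by (rule sum_distrib_left[symmetric])
        finally show ?thesis using vi by simp
      qed
      from frame_kernel[OF g(1) _ this v(1)] v(2) show False by simp
    qed
    thus ?thesis using m True by (intro that[of "{}" "{}" True]) (auto simp: has_support_def)
  qed
qed

text \<open>The row sum of \<open>id(j := d + i)\<close> exceeds that of \<open>id\<close> by
  \<open>\<mu> (d + i) - \<mu> j\<close>; the inequalities compare these excesses with each other
  and with 0.\<close>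

definition support_cone :: "nat \<Rightarrow> nat set \<Rightarrow> nat set \<Rightarrow> bool \<Rightarrow> (nat \<Rightarrow> real) set" where
  "support_cone d R C z = {\<mu>. (z \<longrightarrow> (\<forall>i<d. \<forall>j<d. \<mu> j \<le> \<mu> (d + i))) \<and>
     (\<forall>i\<in>R. \<forall>j\<in>C. \<mu> (d + i) \<le> \<mu> j \<and> (\<forall>i'<d. \<forall>j'<d. \<mu> (d + i) - \<mu> j \<le> \<mu> (d + i') - \<mu> j'))}"

lemma adm_rows_cases:
  assumes "r \<in> adm_rows d"
  obtains "r = id" | i j where "i < d" "j < d" "r = id(j := d + i)"
  using assms by (auto simp: adm_rows_def)

lemma support_cone_iff:
  assumes "has_support d g R C z"
  shows "\<mu> \<in> support_cone d R C z \<longleftrightarrow>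
    (\<forall>r\<in>adm_rows d. \<forall>r'\<in>adm_rows d. minor r' d g \<noteq> 0 \<longrightarrow> row_sum d \<mu> r' \<le> row_sum d \<mu> r)" (is "_ \<longleftrightarrow> ?A")
proof
  assume \<mu>: "\<mu> \<in> support_cone d R C z"
  show ?A
  proof (intro ballI impI)
    fix r r' assume r: "r \<in> adm_rows d" "r' \<in> adm_rows d" "minor r' d g \<noteq> 0"
    show "row_sum d \<mu> r' \<le> row_sum d \<mu> r"
      using r(1) r(2)
    proof (cases rule: adm_rows_cases[case_product adm_rows_cases])
      case ("1_2" i j)
      thus ?thesis using \<mu> r(3) assms by (auto simp: support_cone_def has_support_def row_sum_update)
    next
      case ("2_1" i j)
      thus ?thesis using \<mu> r(3) assms by (auto simp: support_cone_def has_support_def row_sum_update)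
    next
      case ("2_2" i j i' j')
      hence "\<mu> (d + i') - \<mu> j' \<le> \<mu> (d + i) - \<mu> j"
        using \<mu> r(3) assms unfolding support_cone_def has_support_def by auto
      thus ?thesis using "2_2" by (simp add: row_sum_update)
    qed simp
  qed
next
  assume A: ?A
  have "id \<in> adm_rows d" "\<And>i j. i < d \<Longrightarrow> j < d \<Longrightarrow> id(j := d + i) \<in> adm_rows d"
    by (auto simp: adm_rows_def)
  note AA = A[rule_format, OF this(1) this(2)] A[rule_format, OF this(2) this(1)] A[rule_format, OF this(2) this(2)]
  show "\<mu> \<in> support_cone d R C z"
    unfolding support_cone_def
  proof (intro CollectI conjI impI allI ballI)
    fix i j assume "z" "i < d" "j < d"
    thus "\<mu> j \<le> \<mu> (d + i)" using AA(2)[of i j] assms by (auto simp: has_support_def row_sum_update)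
  next
    fix i j assume "i \<in> R" "j \<in> C"
    hence ij: "i < d" "j < d" "minor (id(j := d + i)) d g \<noteq> 0" using assms by (auto simp: has_support_def)
    show "\<mu> (d + i) \<le> \<mu> j" using AA(1)[OF ij] ij by (simp add: row_sum_update)
    fix i' j' assume "i' < d" "j' < d"
    thus "\<mu> (d + i) - \<mu> j \<le> \<mu> (d + i') - \<mu> j'" using AA(3)[OF _ _ ij, of i' j'] ij by (simp add: row_sum_update)
  qed
qed

lemma adapted_exists:
  assumes "has_support d g R C z"
  obtains \<mu> where "adapted d g \<mu>"
proof -
  \<comment> \<open>The sum of all generators of the cone, one for each index outside
    \<open>C\<close>, one for each index outside \<open>R\<close>, and one if the leading minor
    vanishes; an interior weight.\<close>
  define \<mu> :: "nat \<Rightarrow> real" where "\<mu> k = (if k < d then - of_bool (k \<notin> C)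
    else of_bool (k - d \<notin> R) - of_bool (\<not> z))" for k
  have up: "row_sum d \<mu> (id(j := d + i)) = row_sum d \<mu> id + of_bool (i \<notin> R) - of_bool (\<not> z) + of_bool (j \<notin> C)"
    if "i < d" "j < d" for i j
    using that by (simp add: row_sum_update \<mu>_def)
  have S: "minor (id(j := d + i)) d g = 0 \<longleftrightarrow> \<not> (i \<in> R \<and> j \<in> C)" if "i < d" "j < d" for i j
    using assms that by (auto simp: has_support_def)
  have Z: "minor id d g = 0 \<longleftrightarrow> \<not> z" using assms by (auto simp: has_support_def)
  have "row_sum d \<mu> r' \<le> row_sum d \<mu> r \<and> (minor r d g = 0 \<longrightarrow> row_sum d \<mu> r' < row_sum d \<mu> r)"
    if r: "r \<in> adm_rows d" "r' \<in> adm_rows d" "minor r' d g \<noteq> 0" for r r'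
    using r(1) r(2)
  proof (cases rule: adm_rows_cases[case_product adm_rows_cases])
    case "1_1"
    thus ?thesis using r(3) by simp
  next
    case ("1_2" i j)
    thus ?thesis using r(3) Z S[of i j] by (auto simp: up)
  next
    case ("2_1" i j)
    thus ?thesis using r(3) Z S[of i j] by (auto simp: up)
  next
    case ("2_2" i j i' j')
    thus ?thesis using r(3) Z S[of i j] S[of i' j'] by (auto simp: up)
  qed
  thus ?thesis using that unfolding adapted_def by blast
qed

lemma has_support_row:
  assumes "has_support d g R C z"
  shows "\<exists>r\<in>adm_rows d. minor r d g \<noteq> 0"
  using assms unfolding has_support_def adm_rows_def by blast

lemma rank1_degenerates_closure:
  assumes d: "d \<ge> 1" and g0: "g0 \<in> carrier (SL (2 * d))" "lower_rank1 d g0"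
    and full: "\<forall>r\<in>adm_rows d. minor r d g0 \<noteq> 0"
    and g: "g \<in> carrier (SL (2 * d))" "lower_rank1 d g"
  shows "g \<in> zariski_closure (2 * d)
    (\<Union>(torus_orbit (2 * d) (mat_coset g0 (grass_parabolic d))))"
proof -
  obtain R C z where S: "has_support d g R C z" using has_support_exists[OF g] .
  obtain \<mu> where \<mu>: "adapted d g \<mu>" using adapted_exists[OF S] .
  show ?thesis
    by (rule degenerates_closure[OF degenerates_rank1[OF d g0 g full has_support_row[OF S] \<mu>] g(1)])
qed

text \<open>Only adapted weights come with a curve to \<open>g\<close>. Adding a small positive
  multiple of an adapted weight makes any weight of the closed cone adapted.\<close>

lemma rank1_regular_pairing:
  assumes d: "d \<ge> 1" and g0: "g0 \<in> carrier (SL (2 * d))" "lower_rank1 d g0"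
    and full: "\<forall>r\<in>adm_rows d. minor r d g0 \<noteq> 0"
    and g: "g \<in> carrier (SL (2 * d))" "lower_rank1 d g" and S: "has_support d g R C z"
    and \<mu>: "\<mu> \<in> support_cone d R C z" and m: "m \<in> root_lattice (2 * d)"
    and pq: "p \<in> poly_funs (2 * d)" "q \<in> poly_funs (2 * d)" "q g \<noteq> 0"
    and eq: "\<forall>t\<in>torus_SL (2 * d). \<forall>h\<in>t <#\<^bsub>SL (2 * d)\<^esub> (mat_coset g0 (grass_parabolic d)).
       character (2 * d) m t * q h = p h"
  shows "(\<Sum>i=1..2*d. of_int (m i) * \<mu> (i - 1)) \<ge> 0"
proof -
  obtain \<mu>0 where \<mu>0: "adapted d g \<mu>0" using adapted_exists[OF S] .
  note \<mu>w = \<mu>[unfolded support_cone_iff[OF S], rule_format]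
  let ?P = "\<lambda>\<mu>. \<Sum>i=1..2*d. of_int (m i) * \<mu> (i - 1) :: real"
  have pos: "?P \<mu> + e * ?P \<mu>0 \<ge> 0" if e: "e > 0" for e :: real
  proof -
    have rs: "row_sum d (\<lambda>i. \<mu> i + e * \<mu>0 i) r = row_sum d \<mu> r + e * row_sum d \<mu>0 r" for r
      by (simp add: row_sum_def sum.distrib sum_distrib_left)
    have "adapted d g (\<lambda>i. \<mu> i + e * \<mu>0 i)"
      unfolding adapted_def rs
    proof (intro ballI impI conjI)
      fix r r' assume r: "r \<in> adm_rows d" "r' \<in> adm_rows d" "minor r' d g \<noteq> 0"
      have 0: "row_sum d \<mu> r' \<le> row_sum d \<mu> r" using \<mu>w r by blast
      show "row_sum d \<mu> r' + e * row_sum d \<mu>0 r' \<le> row_sum d \<mu> r + e * row_sum d \<mu>0 r"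
        using 0 \<mu>0 e r unfolding adapted_def by (intro add_mono mult_left_mono) auto
      assume "minor r d g = 0"
      thus "row_sum d \<mu> r' + e * row_sum d \<mu>0 r' < row_sum d \<mu> r + e * row_sum d \<mu>0 r"
        using 0 \<mu>0 e r unfolding adapted_def by (intro add_le_less_mono mult_strict_left_mono) auto
    qed
    note degenerates_rank1[OF d g0 g full has_support_row[OF S] this]
    from degenerates_pairing[OF this m pq eq] show ?thesis
      by (simp add: distrib_left sum.distrib sum_distrib_left mult.left_commute)
  qed
  show ?thesis
  proof (rule ccontr)
    assume n: "\<not> ?P \<mu> \<ge> 0"
    show False
    proof (cases "?P \<mu>0 \<le> 0")
      case True
      thus False using pos[of 1] n by simp
    next
      case False
      \<comment> \<open>This multiple of \<open>\<mu>0\<close> cancels only half of the negative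
        pairing with \<open>\<mu>\<close>.\<close>
      have "?P \<mu> + (- ?P \<mu> / (2 * ?P \<mu>0)) * ?P \<mu>0 = ?P \<mu> / 2" using False by simp
      thus False using pos[of "- ?P \<mu> / (2 * ?P \<mu>0)"] n False by (simp add: divide_neg_pos)
    qed
  qed
qed

section \<open>Words and Bruhat order\<close>

lemma word_perm_append: "word_perm (xs @ ys) = word_perm xs \<circ> word_perm ys"
  by (induction xs) (auto simp: word_perm_def)

lemma word_perm_Cons: "word_perm (x # xs) = simple_refl x \<circ> word_perm xs"
  by (simp add: word_perm_def)

lemma word_perm_upt:
  "p \<le> q \<Longrightarrow> word_perm [p..<q] j = (if p \<le> j \<and> j < q then Suc j else if j = q then p else j)"
proof (induction q arbitrary: j)
  case 0
  thus ?case by (simp add: word_perm_def)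
next
  case (Suc q)
  show ?case
  proof (cases "p = Suc q")
    case False
    hence "p \<le> q" using Suc.prems by simp
    thus ?thesis using Suc.IH
      by (auto simp: word_perm_append word_perm_Cons simple_refl_def Transposition.transpose_def word_perm_def[of "[]"])
  qed (simp add: word_perm_def)
qed

lemma word_perm_rev_upt:
  "p \<le> q \<Longrightarrow> word_perm (rev [p..<q]) j = (if j = p then q else if p < j \<and> j \<le> q then j - 1 else j)"
proof (induction q arbitrary: j)
  case 0
  thus ?case by (simp add: word_perm_def)
next
  case (Suc q)
  show ?case
  proof (cases "p = Suc q")
    case False
    hence "p \<le> q" using Suc.prems by simp
    thus ?thesis using Suc.IH
      by (auto simp: word_perm_Cons simple_refl_def Transposition.transpose_def)
  qed (simp add: word_perm_def)
qed

lemma two_run_perm: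
  assumes "a < d" "b < d"
  shows "word_perm (two_run_word d a b) j = (if j \<le> b then j else if j < d then Suc j else if j = d then 2 * d - a
     else if j = Suc d then Suc b else if j \<le> 2 * d - a then j - 1 else j)"
proof -
  have up: "word_perm [b+1..<d+1] j = (if b < j \<and> j \<le> d then Suc j else if j = Suc d then Suc b else j)"
    using assms by (subst word_perm_upt) auto
  have down: "word_perm (rev [d+1..<2*d-a]) k = (if k = Suc d then 2 * d - a
      else if Suc d < k \<and> k \<le> 2 * d - a then k - 1 else k)" for k
    using assms by (subst word_perm_rev_upt) auto
  have "j \<le> b \<or> (b < j \<and> j < d) \<or> j = d \<or> j = Suc d \<or> Suc d < j" by linarith
  thus ?thesis unfolding two_run_word_def word_perm_append comp_apply up down using assms
    by (elim disjE) simp_all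
qed

lemma w_perm_eq:
  assumes "d \<ge> 1"
  shows "w_perm d j = (if j = 0 then 0 else if j < d then Suc j else if j = d then 2 * d
     else if j = Suc d then 1 else if j \<le> 2 * d then j - 1 else j)"
  using assms unfolding w_perm_def by (subst two_run_perm) auto

lemma word_perm_permutes:
  "set xs \<subseteq> {1..<n} \<Longrightarrow> word_perm xs permutes {1..n}"
proof (induction xs)
  case Nil
  show ?case by (simp add: word_perm_def permutes_id[unfolded id_def] permutes_id)
next
  case (Cons x xs)
  have "simple_refl x permutes {1..n}" unfolding simple_refl_def
    using Cons.prems by (intro permutes_swap_id) auto
  thus ?case unfolding word_perm_Cons using Cons by (intro permutes_compose) auto
qed

lemma two_run_permutes: "word_perm (two_run_word d a b) permutes {1..2 * d}"
  by (rule word_perm_permutes) (auto simp: two_run_word_def)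

lemma two_run_grassmannian:
  assumes "a < d" "b < d"
  shows "word_perm (two_run_word d a b) \<in> grassmannian_perms d"
  using assms two_run_permutes unfolding grassmannian_perms_def
  by (auto simp: strict_mono_on_def two_run_perm)

text \<open>Inversions of \<open>u\<close> are carried injectively to inversions of the product: a
  pair is moved by the transposition if that keeps its order and left alone otherwise. The new
  inversion \<open>(a, b)\<close> is missed.\<close>

lemma coxeter_length_transpose:
  assumes u: "inj u" and ab: "a \<in> {1..n}" "b \<in> {1..n}" "a < b" "u a < u b"
  shows "coxeter_length n u < coxeter_length n (u \<circ> Transposition.transpose a b)"
proof -
  let ?\<tau> = "Transposition.transpose a b"
  define I where "I v = {(i, j). i \<in> {1..n} \<and> j \<in> {1..n} \<and> i < j \<and> v j < v i}" for v :: "nat \<Rightarrow> nat"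
  define \<phi> where "\<phi> = (\<lambda>(i, j). if ?\<tau> i < ?\<tau> j then (?\<tau> i, ?\<tau> j) else (i, j))"
  have fin: "finite (I v)" for v
    by (rule finite_subset[of _ "{1..n} \<times> {1..n}"]) (auto simp: I_def)
  have "inj_on \<phi> (I u)"
  proof (rule inj_onI)
    fix x y assume "x \<in> I u" "y \<in> I u" "\<phi> x = \<phi> y"
    thus "x = y"
      by (cases x; cases y) (auto simp: \<phi>_def I_def dest: transpose_eq_imp_eq split: if_splits)
  qed
  moreover have "\<phi> ` I u \<subseteq> I (u \<circ> ?\<tau>) - {(a, b)}"
  proof
    fix y assume "y \<in> \<phi> ` I u"
    then obtain i j where ij: "i \<in> {1..n}" "j \<in> {1..n}" "i < j" "u j < u i" "y = \<phi> (i, j)"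
      by (auto simp: I_def)
    show "y \<in> I (u \<circ> ?\<tau>) - {(a, b)}"
      using ij ab by (cases "?\<tau> i < ?\<tau> j")
        (auto simp: \<phi>_def I_def Transposition.transpose_def split: if_splits)
  qed
  ultimately have "card (I u) \<le> card (I (u \<circ> ?\<tau>) - {(a, b)})"
    using fin by (intro card_inj_on_le[of \<phi>]) auto
  also have "\<dots> < card (I (u \<circ> ?\<tau>))"
    using ab fin by (intro card_Diff1_less) (auto simp: I_def)
  finally show ?thesis unfolding coxeter_length_def I_def .
qed

lemma bruhat_stepI:
  assumes u: "inj u" and ab: "a \<in> {1..n}" "b \<in> {1..n}" "a < b" "u a < u b"
  shows "bruhat_step n u (u \<circ> Transposition.transpose a b)"
  unfolding bruhat_step_def using ab
  by (intro conjI coxeter_length_transpose[OF assms] bexI[of _ a] bexI[of _ b] refl) auto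

text \<open>The increase of length decides the orientation: if \<open>u a > u b\<close>, the reverse
  step would be the lengthening one.\<close>

lemma bruhat_stepE:
  assumes "bruhat_step n u v" and u: "inj u"
  obtains a b where "a \<in> {1..n}" "b \<in> {1..n}" "a < b" "u a < u b" "v = u \<circ> Transposition.transpose a b"
proof -
  obtain a0 b0 where 0: "a0 \<in> {1..n}" "b0 \<in> {1..n}" "a0 \<noteq> b0" "v = u \<circ> Transposition.transpose a0 b0"
    and len: "coxeter_length n u < coxeter_length n v"
    using assms(1) unfolding bruhat_step_def by blast
  obtain a b where ab: "a \<in> {1..n}" "b \<in> {1..n}" "a < b" "v = u \<circ> Transposition.transpose a b"
    using 0 by (cases "a0 < b0") (auto simp: transpose_commute)
  have "u a < u b"
  proof (rule ccontr)
    assume n: "\<not> u a < u b"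
    have "u a \<noteq> u b" using u ab(3) by (auto dest: injD)
    hence "v a < v b" using n ab(4) by auto
    moreover have "inj v" unfolding ab(4) using u by (intro inj_compose) auto
    ultimately have "coxeter_length n v < coxeter_length n (v \<circ> Transposition.transpose a b)"
      using ab by (intro coxeter_length_transpose)
    moreover have "v \<circ> Transposition.transpose a b = u" unfolding ab(4) by (simp add: comp_assoc)
    ultimately show False using len by simp
  qed
  with ab show ?thesis by (intro that)
qed

text \<open>The necessary half of the rank criterion for the Bruhat order. If both positions are
  among the first \<open>k\<close>, the values there are only rearranged; otherwise at most position
  \<open>a\<close> changes, and its value grows.\<close>

lemma bruhat_step_count:
  assumes "bruhat_step n u v" and u: "inj u"
  shows "card {i \<in> {1..k}. m < u i} \<le> card {i \<in> {1..k}. m < v i}"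
proof -
  obtain a b where ab: "a \<in> {1..n}" "b \<in> {1..n}" "a < b" "u a < u b" "v = u \<circ> Transposition.transpose a b"
    using bruhat_stepE[OF assms] .
  show ?thesis
  proof (cases "b \<le> k")
    case True
    thus ?thesis using ab
      by (intro card_inj_on_le[of "Transposition.transpose a b"])
        (auto simp: Transposition.transpose_def split: if_splits intro!: inj_onI)
  next
    case False
    have "{i \<in> {1..k}. m < u i} \<subseteq> {i \<in> {1..k}. m < v i}"
      using ab False by (auto simp: Transposition.transpose_def)
    thus ?thesis by (intro card_mono) auto
  qed
qed

lemma bruhat_le_count:
  assumes "bruhat_le n u v"
  shows "card {i \<in> {1..k}. m < u i} \<le> card {i \<in> {1..k}. m < v i}"
proof -
  have u: "inj u" and s: "(bruhat_step n)\<^sup>*\<^sup>* u v"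
    using assms permutes_inj by (auto simp: bruhat_le_def)
  from s have "inj v \<and> card {i \<in> {1..k}. m < u i} \<le> card {i \<in> {1..k}. m < v i}"
  proof induction
    case base
    show ?case using u by simp
  next
    case (step y z)
    have "inj z" using step.IH step.hyps(2) by (auto simp: bruhat_step_def intro!: inj_compose)
    thus ?case using bruhat_step_count[OF step.hyps(2), of k m] step.IH by auto
  qed
  thus ?thesis by simp
qed

section \<open>Grassmannian permutations below \<open>w_perm\<close>\<close>

lemma strict_mono_on_image_eq:
  fixes f g :: "nat \<Rightarrow> nat"
  assumes f: "strict_mono_on {m..<n} f" and g: "strict_mono_on {m..<n} g"
    and im: "f ` {m..<n} = g ` {m..<n}" and i: "i \<in> {m..<n}"
  shows "f i = g i"
proof -
  have s: "sorted_wrt (<) (map h [m..<n])" if "strict_mono_on {m..<n} h" for h :: "nat \<Rightarrow> nat"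
    unfolding sorted_wrt_map
    by (rule sorted_wrt_mono_rel[OF _ sorted_wrt_upt]) (use that in \<open>auto simp: strict_mono_on_def\<close>)
  have "map f [m..<n] = map g [m..<n]"
    using strict_sorted_equal[OF s[OF f] s[OF g]] im by simp
  thus ?thesis using i by (auto simp: map_eq_conv)
qed

text \<open>The image of the first block fixes that of the second as its complement, and
  monotonicity fixes the order within both.\<close>

lemma grassmannian_eqI:
  assumes u: "u \<in> grassmannian_perms d" and v: "v \<in> grassmannian_perms d"
    and im: "u ` {1..d} = v ` {1..d}"
  shows "u = v"
proof
  fix j
  have p: "u permutes {1..2*d}" "v permutes {1..2*d}" using u v by (auto simp: grassmannian_perms_def)
  have "{d+1..2*d} = {1..2*d} - {1..d}" by auto
  hence "h ` {d+1..2*d} = {1..2*d} - h ` {1..d}" if "h permutes {1..2*d}" for h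
    using image_set_diff[OF permutes_inj[OF that], of "{1..2*d}" "{1..d}"] permutes_image[OF that] by simp
  hence im2: "u ` {d+1..2*d} = v ` {d+1..2*d}" using p im by simp
  consider "j \<in> {1..d}" | "j \<in> {d+1..2*d}" | "j \<notin> {1..2*d}" by force
  thus "u j = v j"
  proof cases
    case 1
    thus ?thesis using strict_mono_on_image_eq[of 1 "Suc d" u v j] u v im
      by (simp add: grassmannian_perms_def atLeastLessThanSuc_atLeastAtMost)
  next
    case 2
    thus ?thesis using strict_mono_on_image_eq[of "d+1" "Suc (2*d)" u v j] u v im2
      by (simp add: grassmannian_perms_def atLeastLessThanSuc_atLeastAtMost)
  next
    case 3
    thus ?thesis using p by (simp add: permutes_def)
  qed
qed

text \<open>A chain of single transpositions: first the value at position \<open>d\<close> is raised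
  from \<open>2 * d - a\<close> to \<open>2 * d\<close> in unit steps, then the value missing from
  the first block is lowered from \<open>b + 1\<close> to 1.\<close>

lemma two_run_bruhat:
  assumes d: "d \<ge> 1" and ab: "a < d" "b < d"
  shows "bruhat_le (2 * d) (word_perm (two_run_word d a b)) (w_perm d)"
proof -
  let ?v = "\<lambda>a b. word_perm (two_run_word d a b)"
  have inj: "inj (?v a b)" for a b using two_run_permutes by (rule permutes_inj)
  have "(bruhat_step (2 * d))\<^sup>*\<^sup>* (?v a b) (?v 0 b)" if "a < d" for a
    using that
  proof (induction a)
    case (Suc a)
    have "?v a b = ?v (Suc a) b \<circ> Transposition.transpose d (2 * d - a)"
    proof
      fix j
      define N where "N = 2 * d - a"
      have N: "2 * d - a = N" "2 * d - Suc a = N - 1" "Suc d < N" using Suc.prems by (auto simp: N_def)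
      have "j \<le> b \<or> (b < j \<and> j < d) \<or> j = d \<or> j = Suc d \<or> (Suc d < j \<and> j < N) \<or> j = N \<or> N < j"
        by linarith
      thus "?v a b j = (?v (Suc a) b \<circ> Transposition.transpose d (2 * d - a)) j"
        using Suc.prems ab(2) N(3)
        unfolding comp_apply Transposition.transpose_def two_run_perm[OF Suc.prems ab(2)]
          two_run_perm[OF Suc_lessD[OF Suc.prems] ab(2)] N
        by (elim disjE) (simp_all, arith?)
    qed
    moreover have "?v (Suc a) b d < ?v (Suc a) b (2 * d - a)"
      using Suc.prems ab by (auto simp: two_run_perm)
    ultimately have "bruhat_step (2 * d) (?v (Suc a) b) (?v a b)"
      using Suc.prems bruhat_stepI[OF inj, of d "2 * d" "2 * d - a" "Suc a" b] by simp
    thus ?case using Suc by (meson Suc_lessD converse_rtranclp_into_rtranclp)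
  qed simp
  moreover have "(bruhat_step (2 * d))\<^sup>*\<^sup>* (?v 0 b) (?v 0 0)" if "b < d" for b
    using that
  proof (induction b)
    case (Suc b)
    have "?v 0 b = ?v 0 (Suc b) \<circ> Transposition.transpose (Suc b) (Suc d)"
    proof
      fix j
      have "j \<le> b \<or> j = Suc b \<or> (Suc b < j \<and> j < d) \<or> j = d \<or> j = Suc d \<or> Suc d < j" by linarith
      thus "?v 0 b j = (?v 0 (Suc b) \<circ> Transposition.transpose (Suc b) (Suc d)) j"
        using Suc.prems
        unfolding comp_apply Transposition.transpose_def
        by (elim disjE) (simp_all add: two_run_perm)
    qed
    moreover have "?v 0 (Suc b) (Suc b) < ?v 0 (Suc b) (Suc d)"
      using Suc.prems by (auto simp: two_run_perm)
    ultimately have "bruhat_step (2 * d) (?v 0 (Suc b)) (?v 0 b)"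
      using Suc.prems bruhat_stepI[OF inj, of "Suc b" "2 * d" "Suc d" 0 "Suc b"] by simp
    thus ?case using Suc by (meson Suc_lessD converse_rtranclp_into_rtranclp)
  qed simp
  ultimately have "(bruhat_step (2 * d))\<^sup>*\<^sup>* (?v a b) (?v 0 0)" using ab by (meson rtranclp_trans)
  thus ?thesis using two_run_permutes by (simp add: bruhat_le_def w_perm_def)
qed

lemma id_bruhat:
  assumes d: "d \<ge> 1"
  shows "bruhat_le (2 * d) id (w_perm d)"
proof -
  let ?v = "word_perm (two_run_word d (d - 1) (d - 1))"
  have "?v = id \<circ> Transposition.transpose d (Suc d)"
  proof
    fix j
    have "j < d \<or> j = d \<or> j = Suc d \<or> Suc d < j" by linarith
    thus "?v j = (id \<circ> Transposition.transpose d (Suc d)) j"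
      using d unfolding comp_apply Transposition.transpose_def
      by (elim disjE) (simp_all add: two_run_perm)
  qed
  hence "bruhat_step (2 * d) id ?v" using d bruhat_stepI[of id d "2 * d" "Suc d"] by simp
  moreover have "bruhat_le (2 * d) ?v (w_perm d)" using d by (intro two_run_bruhat) auto
  ultimately show ?thesis
    by (auto simp: bruhat_le_def permutes_id intro: converse_rtranclp_into_rtranclp)
qed

lemma id_grassmannian: "id \<in> grassmannian_perms d"
  by (simp add: grassmannian_perms_def permutes_id strict_mono_on_def)

lemma two_run_image:
  assumes "a < d" "b < d"
  shows "word_perm (two_run_word d a b) ` {1..d} = insert (2 * d - a) ({1..d} - {Suc b})"
proof
  show "word_perm (two_run_word d a b) ` {1..d} \<subseteq> insert (2 * d - a) ({1..d} - {Suc b})"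
    using assms by (auto simp: two_run_perm)
  show "insert (2 * d - a) ({1..d} - {Suc b}) \<subseteq> word_perm (two_run_word d a b) ` {1..d}"
  proof
    fix y assume y: "y \<in> insert (2 * d - a) ({1..d} - {Suc b})"
    let ?x = "if y > d then d else if y \<le> b then y else y - 1"
    have "word_perm (two_run_word d a b) ?x = y" "?x \<in> {1..d}"
      using y assms by (auto simp: two_run_perm)
    thus "y \<in> word_perm (two_run_word d a b) ` {1..d}" by force
  qed
qed

text \<open>Among its first \<open>d\<close> values \<open>w_perm d\<close> has exactly one above
  \<open>d\<close>, so an element below it has at most one. This leaves \<open>id\<close> or one
  exchanged value, and the exchanged pair determines \<open>a\<close> and \<open>b\<close>.\<close>

lemma grassmannian_interval:
  assumes d: "d \<ge> 1"
  shows "{v \<in> grassmannian_perms d. bruhat_le (2 * d) v (w_perm d)} =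
     insert id {word_perm (two_run_word d a b) | a b. a < d \<and> b < d}" (is "?L = ?R")
proof
  show "?R \<subseteq> ?L"
    using two_run_bruhat[OF d] two_run_grassmannian id_bruhat[OF d] id_grassmannian by auto
  show "?L \<subseteq> ?R"
  proof
    fix v assume "v \<in> ?L"
    hence v: "v \<in> grassmannian_perms d" "bruhat_le (2 * d) v (w_perm d)" by auto
    have p: "v permutes {1..2*d}" using v by (simp add: grassmannian_perms_def)
    let ?B = "{i \<in> {1..d}. d < v i}"
    have "{i \<in> {1..d}. d < w_perm d i} = {d}" using d by (auto simp: w_perm_eq split: if_splits)
    hence B: "card ?B \<le> 1" using bruhat_le_count[OF v(2), of d d] by simp
    have inr: "v i \<in> {1..2*d}" if "i \<in> {1..d}" for i using that permutes_in_image[OF p] by simp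
    have inj: "inj v" by (rule permutes_inj[OF p])
    show "v \<in> ?R"
    proof (cases "?B = {}")
      case True
      hence "v ` {1..d} \<subseteq> {1..d}" using inr by force
      hence "v ` {1..d} = {1..d}"
        using card_image[OF inj_on_subset[OF inj], of "{1..d}"] by (intro card_subset_eq) auto
      hence "v = id" using grassmannian_eqI[OF v(1) id_grassmannian] by simp
      thus ?thesis by simp
    next
      case False
      then obtain x where x: "x \<in> ?B" by blast
      have "\<forall>i\<in>?B. \<forall>j\<in>?B. i = j" using B by (subst (asm) One_nat_def, subst (asm) card_le_Suc0_iff_eq) auto
      hence Bx: "?B = {x}" using x by blast
      have sub: "v ` ({1..d} - {x}) \<subseteq> {1..d}"
      proof
        fix y assume "y \<in> v ` ({1..d} - {x})"
        then obtain i where i: "i \<in> {1..d}" "i \<noteq> x" "y = v i" by blast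
        hence "i \<notin> ?B" using Bx by blast
        thus "y \<in> {1..d}" using i inr[OF i(1)] by auto
      qed
      have "card (v ` ({1..d} - {x})) = d - 1"
        using card_image[OF inj_on_subset[OF inj], of "{1..d} - {x}"] x by simp
      hence "card ({1..d} - v ` ({1..d} - {x})) = 1" using sub d by (subst card_Diff_subset) auto
      then obtain y where y: "{1..d} - v ` ({1..d} - {x}) = {y}" by (auto simp: card_1_singleton_iff)
      hence im: "v ` ({1..d} - {x}) = {1..d} - {y}" "y \<in> {1..d}" using sub by blast+
      have vx: "d < v x" "v x \<le> 2 * d" using x inr by auto
      define a where "a = 2 * d - v x"
      define b where "b = y - 1"
      have ab: "a < d" "b < d" "2 * d - a = v x" "Suc b = y" using vx im(2) by (auto simp: a_def b_def)
      have "v ` {1..d} = insert (v x) (v ` ({1..d} - {x}))" using x by blast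
      hence "v ` {1..d} = word_perm (two_run_word d a b) ` {1..d}"
        unfolding two_run_image[OF ab(1,2)] im(1) ab(3,4) .
      hence "v = word_perm (two_run_word d a b)"
        by (rule grassmannian_eqI[OF v(1) two_run_grassmannian[OF ab(1,2)]])
      thus ?thesis using ab(1,2) by auto
    qed
  qed
qed

section \<open>Representatives of Weyl group elements\<close>

lemma weyl_lifts_exists:
  assumes v: "v permutes {1..n}" and n: "n \<ge> 1"
  obtains g where "g \<in> weyl_lifts n v"
proof -
  define A where "A = Matrix.mat n n (\<lambda>(i, j). of_bool (Suc i = v (Suc j)) :: complex)"
  have A: "A \<in> carrier_mat n n" by (simp add: A_def)
  have r: "v (Suc c) \<in> {1..n}" if "c < n" for c using that permutes_in_image[OF v] by simp
  have inj: "inj_on (\<lambda>c. v (Suc c) - 1) {..<n}"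
  proof (rule inj_onI)
    fix c c' assume "c \<in> {..<n}" "c' \<in> {..<n}" "v (Suc c) - 1 = v (Suc c') - 1"
    hence "v (Suc c) = v (Suc c')" using r[of c] r[of c'] by auto
    thus "c = c'" using permutes_inj[OF v] by (auto dest: injD)
  qed
  have "minor id n A \<noteq> 0"
  proof (rule minor_monomial_neq_0[OF inj])
    show "(\<lambda>c. v (Suc c) - 1) ` {..<n} \<subseteq> {..<n}" using r n by fastforce
    fix a c assume ac: "a < n" "c < n"
    show "A $$ (id a, c) \<noteq> 0 \<longleftrightarrow> a = v (Suc c) - 1" using ac r[of c] by (auto simp: A_def)
  qed
  hence dA: "det A \<noteq> 0" by (simp add: minor_id_eq_det[OF A])
  \<comment> \<open>Dividing one column by the determinant gives determinant one and keeps the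
    pattern of zeros.\<close>
  let ?B = "Matrix.mat n n (\<lambda>(i, j). if j = 0 then A $$ (i, j) / det A else A $$ (i, j))"
  have "?B \<in> carrier (SL n)" using scale_column_SL[OF A dA, of 0] n by simp
  moreover have "?B $$ (i - 1, j - 1) \<noteq> 0 \<longleftrightarrow> i = v j" if "i \<in> {1..n}" "j \<in> {1..n}" for i j
  proof -
    have "i = Suc (i - 1)" "j = Suc (j - 1)" "i - 1 < n" "j - 1 < n" using that by auto
    then obtain i' j' where ij: "i = Suc i'" "j = Suc j'" "i' < n" "j' < n" by blast
    hence "A $$ (i', j') = of_bool (i = v j)" by (simp add: A_def)
    thus ?thesis using dA ij by (cases "j' = 0") auto
  qed
  ultimately show ?thesis by (intro that[of ?B]) (auto simp: weyl_lifts_def)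
qed

lemma weyl_liftsD:
  assumes "g \<in> weyl_lifts n v" "i < n" "j < n"
  shows "g $$ (i, j) \<noteq> 0 \<longleftrightarrow> Suc i = v (Suc j)"
proof -
  have "\<forall>i\<in>{1..n}. \<forall>j\<in>{1..n}. g $$ (i - 1, j - 1) \<noteq> 0 \<longleftrightarrow> i = v j"
    using assms(1) by (simp add: weyl_lifts_def)
  moreover have "Suc i \<in> {1..n}" "Suc j \<in> {1..n}" using assms by auto
  ultimately have "g $$ (Suc i - 1, Suc j - 1) \<noteq> 0 \<longleftrightarrow> Suc i = v (Suc j)" by blast
  thus ?thesis by simp
qed

section \<open>The Schubert variety in the Grassmannian\<close>

lemma parabolic_SL_subset: "parabolic_SL n d \<subseteq> carrier (SL n)"
  by (auto simp: parabolic_SL_def)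

lemma one_parabolic_SL: "d \<le> n \<Longrightarrow> 1\<^sub>m n \<in> parabolic_SL n d"
  by (auto simp: parabolic_SL_def SL_iff)

lemma borel_SL_subset: "borel_SL n \<subseteq> carrier (SL n)"
  by (auto simp: borel_SL_def)

lemma SL_mult_one: "g \<in> carrier (SL n) \<Longrightarrow> g * 1\<^sub>m n = g"
  by (auto simp: SL_iff intro: right_mult_one_mat)

lemma one_borel_SL: "1\<^sub>m n \<in> borel_SL n"
  by (auto simp: borel_SL_def SL_iff)

lemma borel_SL_corner: "\<forall>b\<in>borel_SL n. \<forall>i\<in>{k..<n}. \<forall>j<k. b $$ (i, j) = 0"
  by (auto simp: borel_SL_def SL_iff upper_triangular_def)

lemma parabolic_SL_corner: "\<forall>b\<in>parabolic_SL n d. \<forall>i\<in>{d..<n}. \<forall>j<d. b $$ (i, j) = 0"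
  by (auto simp: parabolic_SL_def)

lemma torus_mult_borel:
  assumes "t \<in> torus_SL n" "b \<in> borel_SL n"
  shows "t * b \<in> borel_SL n"
proof -
  obtain f where t: "t = mat_diag n f" using assms(1) by (auto simp: torus_iff)
  have b: "b \<in> carrier_mat n n" using assms(2) by (auto simp: borel_SL_def SL_iff)
  have "t * b \<in> carrier (SL n)" using assms by (intro SL_mult) (auto simp: torus_SL_def borel_SL_def)
  moreover have "upper_triangular (t * b)" unfolding t mat_diag_mult_left[OF b]
    using assms(2) b by (auto simp: borel_SL_def upper_triangular_def)
  ultimately show ?thesis by (simp add: borel_SL_def)
qed

lemma weyl_lifts_SL: "N \<in> weyl_lifts n v \<Longrightarrow> N \<in> carrier (SL n)"
  by (simp add: weyl_lifts_def)

lemma cell_coset_subset: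
  assumes y: "y \<in> borel_SL n" and N: "N \<in> weyl_lifts n w" and H: "H \<subseteq> carrier (SL n)"
  shows "mat_coset (y * N) H \<subseteq> \<Union>((\<lambda>b. b <#\<^bsub>SL n\<^esub> fixed_point n H w) ` borel_SL n)"
proof
  fix x assume "x \<in> mat_coset (y * N) H"
  then obtain h where h: "h \<in> H" "x = (y * N) * h" by blast
  have "y \<in> carrier_mat n n" "N \<in> carrier_mat n n" "h \<in> carrier_mat n n"
    using y weyl_lifts_SL[OF N] h(1) H by (auto simp: borel_SL_def SL_iff)
  hence "x = y * (N * h)" unfolding h(2) by (rule assoc_mult_mat)
  thus "x \<in> \<Union>((\<lambda>b. b <#\<^bsub>SL n\<^esub> fixed_point n H w) ` borel_SL n)"
    using y N h(1) by (auto simp: l_coset_SL fixed_point_def set_mult_SL)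
qed

lemma zariski_closure_mono: "S \<subseteq> S' \<Longrightarrow> zariski_closure n S \<subseteq> zariski_closure n S'"
  unfolding zariski_closure_def by blast

lemma subset_zariski_closure: "S \<subseteq> carrier (SL n) \<Longrightarrow> S \<subseteq> zariski_closure n S"
  unfolding zariski_closure_def by blast

lemma cell_in_schubert:
  assumes y: "y \<in> borel_SL n" and N: "N \<in> weyl_lifts n w" and H: "H \<subseteq> carrier (SL n)"
  shows "mat_coset (y * N) H \<in> schubert_variety n H w"
proof -
  let ?x = "mat_coset (y * N) H"
  have g: "y * N \<in> carrier (SL n)"
    using y weyl_lifts_SL[OF N] by (intro SL_mult) (auto simp: borel_SL_def)
  have "?x \<subseteq> carrier (SL n)" using SL_mult[OF g] H by blast
  hence "?x \<subseteq> zariski_closure n ?x" by (rule subset_zariski_closure)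
  also have "\<dots> \<subseteq> zariski_closure n (\<Union>((\<lambda>b. b <#\<^bsub>SL n\<^esub> fixed_point n H w) ` borel_SL n))"
    by (rule zariski_closure_mono[OF cell_coset_subset[OF assms]])
  finally show ?thesis using g by (auto simp: schubert_variety_def quot_closure_def mem_hom_space)
qed

text \<open>Right multiplication by a lift only permutes and rescales columns: column
  \<open>c\<close> becomes a multiple of column \<open>v (Suc c) - 1\<close>.\<close>

lemma mult_weyl_lift_index:
  assumes A: "A \<in> carrier_mat n n" and N: "N \<in> weyl_lifts n v" and v: "v permutes {1..n}"
    and ic: "i < n" "c < n"
  shows "(A * N) $$ (i, c) = A $$ (i, v (Suc c) - 1) * N $$ (v (Suc c) - 1, c)"
    "N $$ (v (Suc c) - 1, c) \<noteq> 0"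
proof -
  have vc: "v (Suc c) \<in> {1..n}" using permutes_in_image[OF v] ic by simp
  hence vn: "v (Suc c) - 1 < n" by auto
  show "N $$ (v (Suc c) - 1, c) \<noteq> 0" using weyl_liftsD[OF N vn ic(2)] vc by simp
  have Nc: "N \<in> carrier_mat n n" using weyl_lifts_SL[OF N] by (simp add: SL_iff)
  have "(A * N) $$ (i, c) = (\<Sum>k<n. A $$ (i, k) * N $$ (k, c))"
    by (rule mult_mat_index[OF A Nc ic])
  also have "\<dots> = (\<Sum>k\<in>{v (Suc c) - 1}. A $$ (i, k) * N $$ (k, c))"
  proof (intro sum.mono_neutral_right ballI)
    fix k assume "k \<in> {..<n} - {v (Suc c) - 1}"
    hence "k < n" "Suc k \<noteq> v (Suc c)" by auto
    thus "A $$ (i, k) * N $$ (k, c) = 0" using weyl_liftsD[OF N _ ic(2), of k] by auto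
  qed (use vn in auto)
  finally show "(A * N) $$ (i, c) = A $$ (i, v (Suc c) - 1) * N $$ (v (Suc c) - 1, c)" by simp
qed

lemma w_perm_permutes: "w_perm d permutes {1..2 * d}"
  unfolding w_perm_def by (rule two_run_permutes)

lemma lower_rank1_one_column:
  assumes "\<And>i c. i < d \<Longrightarrow> c < d \<Longrightarrow> c \<noteq> c0 \<Longrightarrow> g $$ (d + i, c) = 0"
  shows "lower_rank1 d g"
  unfolding lower_rank1_def
proof (intro allI impI)
  fix i i' j j' assume l: "i < d" "i' < d" "j < d" "j' < d"
  show "g $$ (d + i, j) * g $$ (d + i', j') = g $$ (d + i, j') * g $$ (d + i', j)"
    using assms[OF l(1,3)] assms[OF l(1,4)] assms[OF l(2,3)] assms[OF l(2,4)]
    by (cases "j = c0"; cases "j' = c0") auto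
qed

text \<open>Since \<open>w_perm d\<close> sends \<open>1, ..., d - 1\<close> into
  \<open>{2..d}\<close>, the first \<open>d - 1\<close> columns of \<open>y * N\<close> are
  multiples of columns of the triangular \<open>y\<close> that end above the lower block. Only
  column \<open>d - 1\<close> reaches it.\<close>

lemma cell_lower_rank1:
  assumes d: "d \<ge> 1" and y: "y \<in> borel_SL (2 * d)" and N: "N \<in> weyl_lifts (2 * d) (w_perm d)"
  shows "lower_rank1 d (y * N)"
proof (rule lower_rank1_one_column)
  fix i c assume ic: "i < d" "c < d" "c \<noteq> d - 1"
  have yc: "y \<in> carrier_mat (2 * d) (2 * d)" "upper_triangular y" using y by (auto simp: borel_SL_def SL_iff)
  have "w_perm d (Suc c) - 1 = Suc c" using ic d by (simp add: w_perm_eq)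
  moreover have "y $$ (d + i, Suc c) = 0" using yc ic by (auto simp: upper_triangular_def)
  ultimately show "(y * N) $$ (d + i, c) = 0"
    using mult_weyl_lift_index(1)[OF yc(1) N w_perm_permutes, of "d + i" c] ic by simp
qed

lemma zariski_closureD:
  assumes "g \<in> zariski_closure n S" "f \<in> poly_funs n" "\<forall>s\<in>S. f s = 0"
  shows "f g = 0"
  using assms unfolding zariski_closure_def by simp

text \<open>The two by two minors vanish on the cell and therefore on its closure.\<close>

lemma schubert_lower_rank1:
  assumes d: "d \<ge> 1" and x: "x \<in> grass_schubert d" "g \<in> x"
  shows "g \<in> carrier (SL (2 * d))" "lower_rank1 d g"
proof -
  let ?n = "2 * d"
  let ?S = "\<Union>((\<lambda>b. b <#\<^bsub>SL ?n\<^esub> fixed_point ?n (parabolic_SL ?n d) (w_perm d)) ` borel_SL ?n)"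
  have g: "g \<in> zariski_closure ?n ?S" using x by (auto simp: schubert_variety_def quot_closure_def)
  thus "g \<in> carrier (SL ?n)" by (simp add: zariski_closure_def)
  have S: "lower_rank1 d s" if "s \<in> ?S" for s
  proof -
    obtain b N p where s: "b \<in> borel_SL ?n" "N \<in> weyl_lifts ?n (w_perm d)" "p \<in> parabolic_SL ?n d" "s = b * (N * p)"
      using \<open>s \<in> ?S\<close> by (auto simp: l_coset_SL fixed_point_def set_mult_SL)
    have c: "b \<in> carrier_mat ?n ?n" "N \<in> carrier_mat ?n ?n" "p \<in> carrier_mat ?n ?n"
      using s weyl_lifts_SL by (auto simp: borel_SL_def SL_iff parabolic_SL_def)
    have "s = (b * N) * p" unfolding s(4) using c by simp
    moreover have "lower_rank1 d ((b * N) * p)"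
      using cell_lower_rank1[OF d s(1,2)] c s(3)
      by (intro lower_rank1_mult[of "b * N" d ?n p ?n]) (auto simp: parabolic_SL_def)
    ultimately show ?thesis by simp
  qed
  show "lower_rank1 d g" unfolding lower_rank1_def
  proof (intro allI impI)
    fix i i' j j' assume l: "i < d" "i' < d" "j < d" "j' < d"
    let ?f = "\<lambda>A. A $$ (d + i, j) * A $$ (d + i', j') - A $$ (d + i, j') * A $$ (d + i', j) :: complex"
    have "?f \<in> poly_funs ?n" using l by (intro poly_funs_diff poly_funs.mult poly_funs.entry) auto
    moreover have "?f s = 0" if "s \<in> ?S" for s using S[OF that] l unfolding lower_rank1_def by simp
    ultimately have "?f g = 0" by (intro zariski_closureD[OF g, of ?f]) auto
    thus "g $$ (d + i, j) * g $$ (d + i', j') = g $$ (d + i, j') * g $$ (d + i', j)" by simp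
  qed
qed

section \<open>Explicit points of the open cell\<close>

definition unip :: "nat \<Rightarrow> (nat \<Rightarrow> nat \<Rightarrow> complex) \<Rightarrow> complex mat" where
  "unip n e = Matrix.mat n n (\<lambda>(i, j). if i = j then 1 else if i < j then e i j else 0)"

lemma unip_borel: "unip n e \<in> borel_SL n"
proof -
  have "upper_triangular (unip n e)" by (auto simp: unip_def upper_triangular_def)
  moreover from this have "det (unip n e) = 1"
    by (subst det_upper_triangular[of _ n]) (auto simp: unip_def prod_list_diag_prod)
  ultimately show ?thesis by (auto simp: borel_SL_def SL_iff unip_def)
qed

text \<open>Up to scaling, the first \<open>d\<close> columns of \<open>y * N\<close> are
  \<open>e_0 + e_j\<close> for \<open>0 < j < d\<close>, and
  \<open>z e_0 + e_d + ... + e_(2d-1)\<close>. The parameter \<open>z\<close> switches the leading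
  minor on and off, while all other admissible minors stay nonzero: a generic point for
  \<open>z = 1\<close>, and for \<open>z = 0\<close> the point that produces the ray of the leading
  minor.\<close>

lemma base_point_minors:
  assumes d: "d \<ge> 1" and N: "N \<in> weyl_lifts (2 * d) (w_perm d)"
    and y: "y = unip (2 * d) (\<lambda>i j. if j = 2 * d - 1 then (if i = 0 then z else of_bool (d \<le> i)) else of_bool (i = 0 \<and> j < d))"
  shows "minor id d (y * N) \<noteq> 0 \<longleftrightarrow> z \<noteq> 0"
    and "i < d \<Longrightarrow> j < d \<Longrightarrow> minor (id(j := d + i)) d (y * N) \<noteq> 0"
proof -
  let ?n = "2 * d"
  have yc: "y \<in> carrier_mat ?n ?n" by (simp add: y unip_def)
  \<comment> \<open>The unknown nonzero entries of \<open>N\<close> are absorbed into the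
    vector.\<close>
  define u where "u v c = N $$ (w_perm d (Suc c) - 1, c) * v c" for v :: "nat \<Rightarrow> complex" and c
  have u0: "u v c = 0 \<longleftrightarrow> v c = 0" if "c < d" for v c
    using mult_weyl_lift_index(2)[OF yc N w_perm_permutes, of 0 c] that by (simp add: u_def)
  have W: "w_perm d (Suc c) - 1 = (if c = d - 1 then 2 * d - 1 else Suc c)" if "c < d" for c
    using that d by (auto simp: w_perm_eq)
  have row: "(\<Sum>c<d. (y * N) $$ (i, c) * v c) =
      (\<Sum>c<d. y $$ (i, if c = d - 1 then 2 * d - 1 else Suc c) * u v c)" if "i < ?n" for i v
  proof (intro sum.cong refl)
    fix c assume "c \<in> {..<d}"
    hence "c < d" by simp
    moreover from this have "c < ?n" by simp
    ultimately show "(y * N) $$ (i, c) * v c = y $$ (i, if c = d - 1 then 2 * d - 1 else Suc c) * u v c"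
      unfolding mult_weyl_lift_index(1)[OF yc N w_perm_permutes that \<open>c < ?n\<close>] u_def W[OF \<open>c < d\<close>]
      by (simp only: mult.assoc)
  qed
  have low: "(\<Sum>c<d. (y * N) $$ (d + i, c) * v c) = u v (d - 1)" if i: "i < d" for i v
  proof -
    have "(\<Sum>c<d. y $$ (d + i, if c = d - 1 then 2 * d - 1 else Suc c) * u v c) =
        (\<Sum>c\<in>{d - 1}. y $$ (d + i, if c = d - 1 then 2 * d - 1 else Suc c) * u v c)"
      using d i by (intro sum.mono_neutral_right) (auto simp: y unip_def)
    also have "\<dots> = u v (d - 1)" using d i by (auto simp: y unip_def)
    finally show ?thesis using row[of "d + i" v] i by simp
  qed
  have mid: "(\<Sum>c<d. (y * N) $$ (i, c) * v c) = u v (i - 1)" if i: "i < d" "i > 0" for i v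
  proof -
    have "(\<Sum>c<d. y $$ (i, if c = d - 1 then 2 * d - 1 else Suc c) * u v c) =
        (\<Sum>c\<in>{i - 1}. y $$ (i, if c = d - 1 then 2 * d - 1 else Suc c) * u v c)"
      using d i by (intro sum.mono_neutral_right) (auto simp: y unip_def split: if_splits)
    also have "\<dots> = u v (i - 1)" using d i by (auto simp: y unip_def)
    finally show ?thesis using row[of i v] i by simp
  qed
  have top: "(\<Sum>c<d. (y * N) $$ (0, c) * v c) = (\<Sum>c<d - 1. u v c) + z * u v (d - 1)" for v
  proof -
    have "(\<Sum>c<d. y $$ (0, if c = d - 1 then 2 * d - 1 else Suc c) * u v c) =
        (\<Sum>c<Suc (d - 1). y $$ (0, if c = d - 1 then 2 * d - 1 else Suc c) * u v c)" using d by simp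
    also have "\<dots> = (\<Sum>c<d - 1. y $$ (0, Suc c) * u v c) + y $$ (0, 2 * d - 1) * u v (d - 1)"
      unfolding sum.lessThan_Suc by simp
    also have "\<dots> = (\<Sum>c<d - 1. u v c) + z * u v (d - 1)"
      using d by (intro arg_cong2[where f = "(+)"] sum.cong) (auto simp: y unip_def)
    finally show ?thesis using row[of 0 v] d by simp
  qed
  \<comment> \<open>Rows \<open>1, ..., d - 1\<close> each give one coordinate. If row
    \<open>j > 0\<close> has been replaced, its coordinate \<open>j - 1\<close> is recovered from
    row 0.\<close>
  have *: False
    if v: "\<forall>a\<in>{1..<d} - {j}. (\<Sum>c<d. (y * N) $$ (a, c) * v c) = 0"
      "j > 0 \<Longrightarrow> (\<Sum>c<d. (y * N) $$ (0, c) * v c) = 0" "u v (d - 1) = 0" "c < d" "v c \<noteq> 0" for v c j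
  proof -
    have 1: "u v e = 0" if "e < d" "Suc e \<noteq> j" for e
    proof (cases "e = d - 1")
      case False
      hence "Suc e \<in> {1..<d} - {j}" using that by auto
      thus ?thesis using v(1) mid[of "Suc e" v] by simp
    qed (use v(3) in simp)
    have "u v e = 0" if e: "e < d" for e
    proof (cases "Suc e = j")
      case True
      show ?thesis
      proof (cases "e = d - 1")
        case False
        hence "0 = (\<Sum>c<d - 1. u v c) + z * u v (d - 1)" using v(2) top[of v] True by simp
        also have "(\<Sum>c<d - 1. u v c) = (\<Sum>c\<in>{e}. u v c)"
          using e True False by (intro sum.mono_neutral_right ballI) (auto intro!: 1)
        finally show ?thesis using v(3) by simp
      qed (use v(3) in simp)
    qed (use 1 e in auto)
    thus False using u0 v(4,5) by simp
  qed
  show "minor (id(j := d + i)) d (y * N) \<noteq> 0" if ij: "i < d" "j < d"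
  proof
    assume "minor (id(j := d + i)) d (y * N) = 0"
    then obtain v c where v: "c < d" "v c \<noteq> 0"
      "\<And>a. a < d \<Longrightarrow> (\<Sum>c<d. (y * N) $$ ((id(j := d + i)) a, c) * v c) = 0"
      unfolding minor_eq_0_iff by blast
    have a: "(\<Sum>c<d. (y * N) $$ (a, c) * v c) = 0" if "a < d" "a \<noteq> j" for a using v(3)[of a] that by simp
    have "u v (d - 1) = 0" using v(3)[of j] low[OF ij(1), of v] ij by simp
    thus False using *[of j v c] a v(1,2) ij d by auto
  qed
  show "minor id d (y * N) \<noteq> 0 \<longleftrightarrow> z \<noteq> 0"
  proof
    assume nz: "minor id d (y * N) \<noteq> 0"
    show "z \<noteq> 0"
    proof
      assume z: "z = 0"
      \<comment> \<open>For \<open>z = 0\<close> the column \<open>d - 1\<close> of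
        \<open>y * N\<close> is zero in all upper rows.\<close>
      define v :: "nat \<Rightarrow> complex" where "v c = of_bool (c = d - 1)" for c
      have "(\<Sum>c<d. (y * N) $$ (a, c) * v c) = 0" if "a < d" for a
      proof (cases "a = 0")
        case True
        thus ?thesis using z by (simp add: top) (simp add: u_def v_def)
      next
        case False
        thus ?thesis using mid[of a v] that by (simp add: u_def v_def)
      qed
      hence "minor id d (y * N) = 0" unfolding minor_eq_0_iff
        using d by (intro exI[of _ v]) (auto simp: v_def intro!: exI[of _ "d - 1"])
      with nz show False by simp
    qed
  next
    assume z: "z \<noteq> 0"
    show "minor id d (y * N) \<noteq> 0"
    proof
      assume "minor id d (y * N) = 0"
      then obtain v c where v: "c < d" "v c \<noteq> 0" "\<And>a. a < d \<Longrightarrow> (\<Sum>c<d. (y * N) $$ (a, c) * v c) = 0"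
        unfolding minor_eq_0_iff by auto
      have "u v e = 0" if "e < d - 1" for e using mid[of "Suc e" v] v(3)[of "Suc e"] that by simp
      hence "z * u v (d - 1) = 0" using top[of v] v(3)[of 0] d by simp
      thus False using *[of 0 v c] z v by auto
    qed
  qed
qed

lemma base_point:
  fixes z :: complex
  assumes d: "d \<ge> 1"
  obtains y N where "y \<in> borel_SL (2 * d)" "N \<in> weyl_lifts (2 * d) (w_perm d)"
    "minor id d (y * N) \<noteq> 0 \<longleftrightarrow> z \<noteq> 0" "\<forall>i<d. \<forall>j<d. minor (id(j := d + i)) d (y * N) \<noteq> 0"
proof -
  obtain N where N: "N \<in> weyl_lifts (2 * d) (w_perm d)"
    using weyl_lifts_exists[OF w_perm_permutes, of d] d by auto
  show ?thesis using base_point_minors[OF d N refl, where z = z] by (intro that[OF unip_borel N]) blast+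
qed

lemma full_base_point:
  assumes d: "d \<ge> 1"
  obtains y N where "y \<in> borel_SL (2 * d)" "N \<in> weyl_lifts (2 * d) (w_perm d)"
    "y * N \<in> carrier (SL (2 * d))" "lower_rank1 d (y * N)" "\<forall>r\<in>adm_rows d. minor r d (y * N) \<noteq> 0"
proof -
  obtain y N where b: "y \<in> borel_SL (2 * d)" "N \<in> weyl_lifts (2 * d) (w_perm d)"
    "minor id d (y * N) \<noteq> 0 \<longleftrightarrow> 1 \<noteq> (0::complex)" "\<forall>i<d. \<forall>j<d. minor (id(j := d + i)) d (y * N) \<noteq> 0"
    by (rule base_point[OF d])
  show ?thesis
  proof (rule that[OF b(1,2)])
    show "y * N \<in> carrier (SL (2 * d))"
      using b(1) weyl_lifts_SL[OF b(2)] by (intro SL_mult) (auto simp: borel_SL_def)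
    show "lower_rank1 d (y * N)" by (rule cell_lower_rank1[OF d b(1,2)])
    show "\<forall>r\<in>adm_rows d. minor r d (y * N) \<noteq> 0"
      using b(3,4) by (auto elim!: adm_rows_cases)
  qed
qed

section \<open>From matrices to points of the Schubert variety\<close>

lemma parabolic_coset_lower_rank1:
  assumes "g \<in> carrier (SL (2 * d))" "lower_rank1 d g" "p \<in> grass_parabolic d"
  shows "g * p \<in> carrier (SL (2 * d))" "lower_rank1 d (g * p)"
  using assms SL_mult lower_rank1_mult[of g d "2 * d" p "2 * d"] by (auto simp: parabolic_SL_def SL_iff)

lemma parabolic_coset_minor:
  assumes "g \<in> carrier (SL (2 * d))" "p \<in> grass_parabolic d" "\<forall>a<d. r a < 2 * d"
  shows "minor r d (g * p) = 0 \<longleftrightarrow> minor r d g = 0"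
proof -
  have c: "g \<in> carrier_mat (2 * d) (2 * d)" "p \<in> carrier_mat (2 * d) (2 * d)" "det p = 1"
    using assms by (auto simp: parabolic_SL_def SL_iff)
  have z: "\<And>i j. d \<le> i \<Longrightarrow> i < 2 * d \<Longrightarrow> j < d \<Longrightarrow> p $$ (i, j) = 0"
    using assms(2) by (auto simp: parabolic_SL_def)
  have "minor r d (g * p) = minor r d g * minor id d p"
    using assms(3) by (intro minor_mult[OF c(1,2) _ _ z]) auto
  moreover have "minor id d p \<noteq> 0" using c(3) by (intro minor_id_corner_neq_0[OF c(2) _ _ z]) auto
  ultimately show ?thesis by simp
qed

lemma parabolic_coset_support:
  assumes "g \<in> carrier (SL (2 * d))" "p \<in> grass_parabolic d"
  shows "has_support d (g * p) R C z \<longleftrightarrow> has_support d g R C z"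
proof -
  have "minor r d (g * p) = 0 \<longleftrightarrow> minor r d g = 0" if "r \<in> adm_rows d" for r
    using parabolic_coset_minor[OF assms, of r] adm_rows_less[OF that] by blast
  hence "minor id d (g * p) = 0 \<longleftrightarrow> minor id d g = 0"
    "\<And>i j. i < d \<Longrightarrow> j < d \<Longrightarrow> minor (id(j := d + i)) d (g * p) = 0 \<longleftrightarrow> minor (id(j := d + i)) d g = 0"
    by (auto simp: adm_rows_def)
  thus ?thesis unfolding has_support_def by auto
qed

text \<open>The converse inclusion needs no further equations: every such matrix is a limit of the
  torus orbit of one generic point of the cell.\<close>

lemma lower_rank1_in_schubert:
  assumes d: "d \<ge> 1" and g: "g \<in> carrier (SL (2 * d))" "lower_rank1 d g"
  shows "mat_coset g (grass_parabolic d) \<in> grass_schubert d"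
proof -
  let ?n = "2 * d" and ?P = "grass_parabolic d"
  obtain y N where b: "y \<in> borel_SL ?n" "N \<in> weyl_lifts ?n (w_perm d)"
    "y * N \<in> carrier (SL ?n)" "lower_rank1 d (y * N)" "\<forall>r\<in>adm_rows d. minor r d (y * N) \<noteq> 0"
    by (rule full_base_point[OF d])
  \<comment> \<open>The torus lies in the Borel subgroup, so the orbit of a point of the cell stays
    in the cell.\<close>
  have sub: "\<Union>(torus_orbit ?n (mat_coset (y * N) ?P)) \<subseteq>
      \<Union>((\<lambda>b. b <#\<^bsub>SL ?n\<^esub> fixed_point ?n ?P (w_perm d)) ` borel_SL ?n)"
  proof
    fix s assume "s \<in> \<Union>(torus_orbit ?n (mat_coset (y * N) ?P))"
    then obtain t p where t: "t \<in> torus_SL ?n" "p \<in> ?P" "s = t * ((y * N) * p)"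
      by (auto simp: l_coset_SL)
    have c: "t \<in> carrier_mat ?n ?n" "y \<in> carrier_mat ?n ?n" "N \<in> carrier_mat ?n ?n" "p \<in> carrier_mat ?n ?n"
      using t b weyl_lifts_SL by (auto simp: torus_SL_def borel_SL_def parabolic_SL_def SL_iff)
    have "s = ((t * y) * N) * p"
      unfolding t(3) using c by (simp add: assoc_mult_mat[of _ ?n ?n _ ?n _ ?n])
    thus "s \<in> \<Union>((\<lambda>b. b <#\<^bsub>SL ?n\<^esub> fixed_point ?n ?P (w_perm d)) ` borel_SL ?n)"
      using cell_coset_subset[OF torus_mult_borel[OF t(1) b(1)] b(2) parabolic_SL_subset[of ?n d]] t(2) by blast
  qed
  have "h \<in> zariski_closure ?n (\<Union>((\<lambda>b. b <#\<^bsub>SL ?n\<^esub> fixed_point ?n ?P (w_perm d)) ` borel_SL ?n))"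
    if "h \<in> mat_coset g ?P" for h
  proof -
    have "h \<in> carrier (SL ?n)" "lower_rank1 d h" using that parabolic_coset_lower_rank1[OF g] by auto
    from rank1_degenerates_closure[OF d b(3-5) this] show ?thesis using zariski_closure_mono[OF sub] by blast
  qed
  thus ?thesis using g(1) by (auto simp: schubert_variety_def quot_closure_def mem_hom_space)
qed

lemma schubert_dense_orbit:
  assumes d: "d \<ge> 1" and g0: "g0 \<in> carrier (SL (2 * d))" "lower_rank1 d g0"
    and full: "\<forall>r\<in>adm_rows d. minor r d g0 \<noteq> 0"
  shows "grass_schubert d \<subseteq> quot_closure (2 * d) (grass_parabolic d)
    (torus_orbit (2 * d) (mat_coset g0 (grass_parabolic d)))"
proof
  fix x assume x: "x \<in> grass_schubert d"
  hence "x \<in> hom_space (2 * d) (grass_parabolic d)"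
    by (simp add: schubert_variety_def quot_closure_def)
  moreover have "g \<in> zariski_closure (2 * d)
      (\<Union>(torus_orbit (2 * d) (mat_coset g0 (grass_parabolic d))))" if "g \<in> x" for g
    by (rule rank1_degenerates_closure[OF d g0 full schubert_lower_rank1[OF d x that]])
  ultimately show "x \<in> quot_closure (2 * d) (grass_parabolic d)
    (torus_orbit (2 * d) (mat_coset g0 (grass_parabolic d)))"
    by (auto simp: quot_closure_def)
qed

section \<open>The cone of a point\<close>

lemma schubert_char_regular:
  assumes d: "d \<ge> 1" and r: "r \<in> adm_rows d" "r' \<in> adm_rows d" and g: "g \<in> x" "minor r' d g \<noteq> 0"
  shows "char_regular (2 * d) (grass_parabolic d) (grass_schubert d) x (minor_weight r r' d)"
proof -
  obtain y N where b: "y \<in> borel_SL (2 * d)" "N \<in> weyl_lifts (2 * d) (w_perm d)"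
    "y * N \<in> carrier (SL (2 * d))" "lower_rank1 d (y * N)" "\<forall>r\<in>adm_rows d. minor r d (y * N) \<noteq> 0"
    by (rule full_base_point[OF d])
  show ?thesis
    using r b(5) adm_rows_less
    by (intro char_regular_minor_weight[OF b(3) parabolic_SL_subset parabolic_SL_corner _ _ _
          lower_rank1_in_schubert[OF d b(3,4)] schubert_dense_orbit[OF d b(3-5)] _ _ g]) auto
qed

lemma schubert_regular_pairing:
  assumes d: "d \<ge> 1" and x: "\<forall>g\<in>x. g \<in> carrier (SL (2 * d)) \<and> lower_rank1 d g \<and> has_support d g R C z"
    and \<mu>: "\<mu> \<in> support_cone d R C z" and m: "m \<in> root_lattice (2 * d)"
    and reg: "char_regular (2 * d) (grass_parabolic d) (grass_schubert d) x m"
  shows "(\<Sum>i=1..2*d. of_int (m i) * \<mu> (i - 1)) \<ge> 0"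
proof -
  let ?n = "2 * d" and ?P = "grass_parabolic d"
  obtain x0 p q g where x0: "x0 \<in> grass_schubert d"
    "grass_schubert d \<subseteq> quot_closure ?n ?P (torus_orbit ?n x0)"
    and pq: "p \<in> poly_funs ?n" "q \<in> poly_funs ?n" "g \<in> x" "q g \<noteq> 0"
    "\<forall>t\<in>torus_SL ?n. \<forall>h\<in>t <#\<^bsub>SL ?n\<^esub> x0. character ?n m t * q h = p h"
    using reg unfolding char_regular_def by blast
  obtain g0 where g0: "g0 \<in> carrier (SL ?n)" "x0 = mat_coset g0 ?P"
    using x0(1) by (auto simp: schubert_variety_def quot_closure_def mem_hom_space)
  have "g0 * 1\<^sub>m ?n \<in> x0" unfolding g0(2) by (intro imageI one_parabolic_SL) simp
  hence "g0 \<in> x0" unfolding SL_mult_one[OF g0(1)] .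
  hence r0: "lower_rank1 d g0" using schubert_lower_rank1[OF d x0(1)] by blast
  obtain y N where b: "y \<in> borel_SL ?n" "N \<in> weyl_lifts ?n (w_perm d)"
    "y * N \<in> carrier (SL ?n)" "lower_rank1 d (y * N)" "\<forall>r\<in>adm_rows d. minor r d (y * N) \<noteq> 0"
    by (rule full_base_point[OF d])
  have "(y * N) * 1\<^sub>m ?n \<in> mat_coset (y * N) ?P" by (intro imageI one_parabolic_SL) simp
  hence bx: "y * N \<in> mat_coset (y * N) ?P" unfolding SL_mult_one[OF b(3)] .
  \<comment> \<open>The base point comes from the witness of regularity. The density of its orbit
    makes it generic, since the explicit point of the cell lies in the closure.\<close>
  have full: "\<forall>r\<in>adm_rows d. minor r d g0 \<noteq> 0"
  proof
    fix r assume r: "r \<in> adm_rows d"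
    show "minor r d g0 \<noteq> 0"
      using adm_rows_less[OF r] b(5) r
      by (intro minor_closure[OF g0(1) parabolic_SL_subset parabolic_SL_corner _ _ x0(2)[unfolded g0(2)]
            lower_rank1_in_schubert[OF d b(3,4)] bx]) auto
  qed
  show ?thesis
    using x pq(3) by (intro rank1_regular_pairing[OF d g0(1) r0 full _ _ _ \<mu> m pq(1,2,4) pq(5)[unfolded g0(2)]]) auto
qed

text \<open>Closed form of the letter of \<open>w_word d\<close> at position \<open>k\<close>,
  positions being counted from 1.\<close>

definition letter :: "nat \<Rightarrow> nat \<Rightarrow> nat" where
  "letter d k = (if k < d then 2 * d - k else Suc k - d)"

text \<open>The coordinates of a weight dual to the basis of \<open>simple_coordinates\<close>.
  Letters count from 1 and rows from 0, so minus the simple root of letter \<open>l\<close> pairs to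
  \<open>\<mu> l - \<mu> (l - 1)\<close>; constants added to \<open>\<mu>\<close> drop out.\<close>

definition root_diffs :: "nat \<Rightarrow> (nat \<Rightarrow> real) \<Rightarrow> nat \<Rightarrow> real" where
  "root_diffs d \<mu> k = (if k \<in> {1..2*d-1} then \<mu> (letter d k) - \<mu> (letter d k - 1) else 0)"

definition simple_coordinates :: "nat \<Rightarrow> (nat \<Rightarrow> nat \<Rightarrow> int) \<Rightarrow> bool" where
  "simple_coordinates d \<beta> \<longleftrightarrow> (\<forall>k\<in>{1..2*d-1}. \<beta> k = (\<lambda>i. of_bool (i = Suc (letter d k)) - of_bool (i = letter d k)))"

lemma letter_range: "k \<in> {1..2*d-1} \<Longrightarrow> letter d k \<in> {1..2*d-1}"
  by (auto simp: letter_def)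

lemma root_diffs_supported: "root_diffs d \<mu> \<in> supported (2 * d - 1)"
  by (auto simp: supported_def root_diffs_def)

lemma supported_root_diffs:
  assumes u: "u \<in> supported (2 * d - 1)"
  obtains \<mu> where "u = root_diffs d \<mu>"
proof -
  \<comment> \<open>The inverse of \<open>letter d\<close>; partial sums over consecutive letters
    then integrate the prescribed differences.\<close>
  define pos where "pos l = (if l \<le> d then d + l - 1 else 2 * d - l)" for l
  define \<mu> where "\<mu> r = (\<Sum>l=1..r. u (pos l))" for r
  have "u k = root_diffs d \<mu> k" for k
  proof (cases "k \<in> {1..2*d-1}")
    case True
    have l: "letter d k \<in> {1..2*d-1}" by (rule letter_range[OF True])
    have p: "pos (letter d k) = k" using True by (auto simp: pos_def letter_def)
    have "\<mu> (Suc (letter d k - 1)) = \<mu> (letter d k - 1) + u (pos (Suc (letter d k - 1)))"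
      unfolding \<mu>_def by simp
    hence "\<mu> (letter d k) = \<mu> (letter d k - 1) + u (pos (letter d k))" using l by simp
    thus ?thesis using True p by (simp add: root_diffs_def)
  next
    case False
    thus ?thesis using u by (auto simp: root_diffs_def supported_def)
  qed
  thus ?thesis by (intro that[of \<mu>]) auto
qed

lemma combination_pairing:
  assumes \<beta>: "simple_coordinates d \<beta>"
  shows "(\<Sum>k=1..2*d-1. of_int (a k) * root_diffs d \<mu> k) = (\<Sum>i=1..2*d. of_int (combination (2*d-1) \<beta> a i) * \<mu> (i - 1))"
proof -
  have e: "(\<Sum>i=1..2*d. of_int (\<beta> k i) * \<mu> (i - 1)) = root_diffs d \<mu> k" if k: "k \<in> {1..2*d-1}" for k
  proof -
    have l: "letter d k \<in> {1..2*d-1}" by (rule letter_range[OF k])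
    have "(\<Sum>i=1..2*d. of_int (\<beta> k i) * \<mu> (i - 1)) =
        (\<Sum>i\<in>{letter d k, Suc (letter d k)}. of_int (\<beta> k i) * \<mu> (i - 1))"
      using \<beta> k l by (intro sum.mono_neutral_right) (auto simp: simple_coordinates_def)
    also have "\<dots> = root_diffs d \<mu> k" using \<beta> k by (simp add: simple_coordinates_def root_diffs_def)
    finally show ?thesis .
  qed
  have "(\<Sum>i=1..2*d. of_int (combination (2*d-1) \<beta> a i) * \<mu> (i - 1)) =
      (\<Sum>i=1..2*d. \<Sum>k=1..2*d-1. of_int (a k) * (of_int (\<beta> k i) * \<mu> (i - 1)))"
    by (simp add: combination_def sum_distrib_right mult.assoc)
  also have "\<dots> = (\<Sum>k=1..2*d-1. \<Sum>i=1..2*d. of_int (a k) * (of_int (\<beta> k i) * \<mu> (i - 1)))"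
    by (rule sum.swap)
  also have "\<dots> = (\<Sum>k=1..2*d-1. of_int (a k) * root_diffs d \<mu> k)"
  proof (intro sum.cong refl)
    fix k assume "k \<in> {1..2*d-1}"
    from e[OF this] show "(\<Sum>i=1..2*d. of_int (a k) * (of_int (\<beta> k i) * \<mu> (i - 1))) = of_int (a k) * root_diffs d \<mu> k"
      by (simp only: sum_distrib_left[symmetric])
  qed
  finally show ?thesis by simp
qed

text \<open>The support is prescribed on the whole set \<open>x\<close>, because the witness of
  regularity may sit at any of its matrices. One inclusion tests against quotients of minors, which
  are combinations of \<open>\<beta>\<close> since these exhaust the root lattice; the other is the
  pairing along degenerations.\<close>

theorem toric_cone_support:
  assumes d: "d \<ge> 1" and \<beta>: "torus_coordinates (2 * d) \<beta>" "simple_coordinates d \<beta>"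
    and x: "\<forall>g\<in>x. g \<in> carrier (SL (2 * d)) \<and> lower_rank1 d g \<and> has_support d g R C z" "x \<noteq> {}"
  shows "toric_cone (2 * d) (grass_parabolic d) \<beta> (grass_schubert d) x = root_diffs d ` support_cone d R C z"
proof -
  let ?n = "2 * d" and ?P = "grass_parabolic d"
  obtain g where g: "g \<in> x" "has_support d g R C z" using x by blast
  have bij: "bij_betw (combination (?n - 1) \<beta>) (supported (?n - 1)) (root_lattice ?n)"
    using \<beta>(1) by (simp add: torus_coordinates_def)
  have "root_diffs d \<mu> \<in> toric_cone ?n ?P \<beta> (grass_schubert d) x \<longleftrightarrow> \<mu> \<in> support_cone d R C z" for \<mu>
  proof
    assume \<mu>: "root_diffs d \<mu> \<in> toric_cone ?n ?P \<beta> (grass_schubert d) x"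
    show "\<mu> \<in> support_cone d R C z"
      unfolding support_cone_iff[OF g(2)]
    proof (intro ballI impI)
      fix r r' assume r: "r \<in> adm_rows d" "r' \<in> adm_rows d" "minor r' d g \<noteq> 0"
      have rn: "\<forall>a<d. r a < ?n" "\<forall>a<d. r' a < ?n" using adm_rows_less r by blast+
      have "minor_weight r r' d \<in> root_lattice ?n" by (rule minor_weight_root_lattice[OF rn])
      then obtain a where a: "a \<in> supported (?n - 1)" "combination (?n - 1) \<beta> a = minor_weight r r' d"
        using bij by (metis (no_types, lifting) bij_betw_imp_surj_on imageE)
      have "(\<Sum>k=1..?n-1. of_int (a k) * root_diffs d \<mu> k) \<ge> 0"
        using \<mu> a schubert_char_regular[OF d r(1,2) g(1) r(3)] unfolding toric_cone_def by auto
      hence "(\<Sum>a<d. \<mu> (r a)) - (\<Sum>a<d. \<mu> (r' a)) \<ge> 0"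
        unfolding combination_pairing[OF \<beta>(2)] a(2) minor_weight_pairing[OF rn] .
      thus "row_sum d \<mu> r' \<le> row_sum d \<mu> r" by (simp add: row_sum_def)
    qed
  next
    assume \<mu>: "\<mu> \<in> support_cone d R C z"
    show "root_diffs d \<mu> \<in> toric_cone ?n ?P \<beta> (grass_schubert d) x"
      unfolding toric_cone_def
    proof (intro CollectI conjI ballI impI root_diffs_supported)
      fix a assume a: "a \<in> supported (?n - 1)" "char_regular ?n ?P (grass_schubert d) x (combination (?n - 1) \<beta> a)"
      have "combination (?n - 1) \<beta> a \<in> root_lattice ?n" using bij a(1) by (auto simp: bij_betw_def)
      thus "(\<Sum>k=1..?n-1. of_int (a k) * root_diffs d \<mu> k) \<ge> 0"
        unfolding combination_pairing[OF \<beta>(2)] by (rule schubert_regular_pairing[OF d x(1) \<mu> _ a(2)])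
    qed
  qed
  moreover have "toric_cone ?n ?P \<beta> (grass_schubert d) x \<subseteq> range (root_diffs d)"
    using supported_root_diffs by (auto simp: toric_cone_def) blast
  ultimately show ?thesis by blast
qed

section \<open>The coordinates of the flag variety\<close>

lemma w_word_nth:
  assumes "k \<in> {1..2*d-1}"
  shows "w_word d ! (k - 1) = letter d k"
  using assms by (auto simp: two_run_word_def letter_def nth_append rev_nth)

lemma subword_perm_empty: "subword_perm d {} = id"
  by (simp add: subword_perm_def word_perm_def)

lemma subword_perm_single:
  "k \<in> {1..2*d-1} \<Longrightarrow> subword_perm d {k} = simple_refl (letter d k)"
  unfolding subword_perm_def by (simp add: w_word_nth word_perm_def del: One_nat_def)

text \<open>The entries \<open>e\<close> are to be chosen such that each of the first
  \<open>l\<close> columns meets the rows \<open>r\<close> in exactly one nonzero entry, either the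
  pivot of the column or an entry above it.\<close>

lemma unip_weyl_minor_neq_0:
  assumes d: "d \<ge> 1" and N: "N \<in> weyl_lifts (2 * d) (w_perm d)" and l: "l \<le> 2 * d"
    and r: "\<forall>a<l. r a < 2 * d" and f: "inj_on f {..<l}" "f ` {..<l} \<subseteq> {..<l}"
    and e: "\<And>a c. a < l \<Longrightarrow> c < l \<Longrightarrow>
       (r a = w_perm d (Suc c) - 1 \<or> r a < w_perm d (Suc c) - 1 \<and> e (r a) (w_perm d (Suc c) - 1) \<noteq> 0) \<longleftrightarrow> a = f c"
  shows "minor r l (unip (2 * d) e * N) \<noteq> 0"
proof (rule minor_monomial_neq_0[OF f])
  fix a c assume ac: "a < l" "c < l"
  have c: "c < 2 * d" "r a < 2 * d" using ac l r by auto
  have u: "unip (2 * d) e \<in> carrier_mat (2 * d) (2 * d)" by (simp add: unip_def)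
  have "w_perm d (Suc c) \<in> {1..2 * d}" using permutes_in_image[OF w_perm_permutes] c by simp
  hence W: "w_perm d (Suc c) - 1 < 2 * d" by auto
  have "unip (2 * d) e $$ (r a, w_perm d (Suc c) - 1) \<noteq> 0 \<longleftrightarrow> a = f c"
    unfolding e[OF ac, symmetric] using c W by (auto simp: unip_def)
  thus "(unip (2 * d) e * N) $$ (r a, c) \<noteq> 0 \<longleftrightarrow> a = f c"
    using mult_weyl_lift_index[OF u N w_perm_permutes c(2,1)] by simp
qed

lemma w_perm_index:
  assumes "d \<ge> 1" "c < 2 * d"
  shows "w_perm d (Suc c) - 1 =
    (if c < d - 1 then Suc c else if c = d - 1 then 2 * d - 1 else if c = d then 0 else c - 1)"
  using assms by (auto simp: w_perm_eq)

text \<open>One point of the open cell is enough, since \<open>minor_closure\<close> transfers the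
  nonvanishing to the base point of any dense orbit.\<close>

lemma flag_leading_minor:
  assumes d: "d \<ge> 1" and N: "N \<in> weyl_lifts (2 * d) (w_perm d)" and l: "l \<in> {1..2*d-1}"
  shows "\<exists>e. minor id l (unip (2 * d) e * N) \<noteq> 0"
proof (cases "l \<le> d")
  case True
  let ?q = "w_perm d l - 1"
  have W: "w_perm d (Suc c) - 1 = (if c = l - 1 then ?q else Suc c)" if "c < l" for c
    using that True l by (auto simp: w_perm_eq)
  have q: "l \<le> ?q" using True l by (auto simp: w_perm_eq)
  \<comment> \<open>The pivots of the first \<open>l\<close> columns miss row 0 and the last pivot
    lies below the minor; one extra entry lets the last column meet row 0.\<close>
  have "minor id l (unip (2 * d) (\<lambda>i j. of_bool (i = 0 \<and> j = ?q)) * N) \<noteq> 0"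
  proof (rule unip_weyl_minor_neq_0[OF d N, where f = "\<lambda>c. if c = l - 1 then 0 else Suc c"])
    show "inj_on (\<lambda>c. if c = l - 1 then 0 else Suc c) {..<l}" by (auto simp: inj_on_def)
    fix a c assume ac: "a < l" "c < l"
    show "(id a = w_perm d (Suc c) - 1 \<or> id a < w_perm d (Suc c) - 1 \<and>
        (of_bool (id a = 0 \<and> w_perm d (Suc c) - 1 = ?q) :: complex) \<noteq> 0) \<longleftrightarrow> a = (if c = l - 1 then 0 else Suc c)"
      unfolding W[OF ac(2)] using q ac l by auto
  qed (use l in auto)
  thus ?thesis by blast
next
  case False
  let ?f = "\<lambda>c. if c < d - 1 then Suc c else if c = d - 1 then l - 1 else if c = d then 0 else c - 1"
  have W: "c < l \<Longrightarrow> c < 2 * d" for c using l by auto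
  \<comment> \<open>Now only row \<open>l - 1\<close> is missed, and the pivot
    \<open>2 * d - 1\<close> of column \<open>d - 1\<close> lies too low; the extra entry brings
    that column to row \<open>l - 1\<close>.\<close>
  have "minor id l (unip (2 * d) (\<lambda>i j. of_bool (i = l - 1 \<and> j = 2 * d - 1)) * N) \<noteq> 0"
  proof (rule unip_weyl_minor_neq_0[OF d N, where f = ?f])
    show "inj_on ?f {..<l}" using False d by (auto simp: inj_on_def split: if_splits)
    show "?f ` {..<l} \<subseteq> {..<l}" using False d by auto
    fix a c assume ac: "a < l" "c < l"
    show "(id a = w_perm d (Suc c) - 1 \<or> id a < w_perm d (Suc c) - 1 \<and>
        (of_bool (id a = l - 1 \<and> w_perm d (Suc c) - 1 = 2 * d - 1) :: complex) \<noteq> 0) \<longleftrightarrow> a = ?f c"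
      unfolding w_perm_index[OF d W[OF ac(2)]] using False ac l d by auto
  qed (use l in auto)
  thus ?thesis by blast
qed

lemma flag_next_minor:
  assumes d: "d \<ge> 1" and N: "N \<in> weyl_lifts (2 * d) (w_perm d)" and l: "l \<in> {1..2*d-1}"
  shows "\<exists>e. minor (id(l - 1 := l)) l (unip (2 * d) e * N) \<noteq> 0"
proof (cases "l \<le> d")
  case True
  let ?f = "\<lambda>c. if c = l - 1 then l - 1 else if Suc c = l - 1 then 0 else Suc c"
  let ?q = "if l = d then 2 * d - 1 else l"
  have W: "w_perm d (Suc c) - 1 = (if c = l - 1 then ?q else Suc c)" if "c < l" for c
    using that True l by (auto simp: w_perm_eq)
  \<comment> \<open>The pivot \<open>l - 1\<close> has left the selected rows, so its column is
    given an entry in row 0. The second extra entry matters for \<open>l = d\<close>, where the last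
    pivot is \<open>2 * d - 1\<close>.\<close>
  have "minor (id(l - 1 := l)) l (unip (2 * d) (\<lambda>i j. of_bool (i = 0 \<and> j = l - 1 \<or> i = l \<and> j = 2 * d - 1)) * N) \<noteq> 0"
  proof (rule unip_weyl_minor_neq_0[OF d N, where f = ?f])
    show "inj_on ?f {..<l}" using l by (auto simp: inj_on_def split: if_splits)
    show "?f ` {..<l} \<subseteq> {..<l}" using l by auto
    fix a c assume ac: "a < l" "c < l"
    show "((id(l - 1 := l)) a = w_perm d (Suc c) - 1 \<or> (id(l - 1 := l)) a < w_perm d (Suc c) - 1 \<and>
        (of_bool ((id(l - 1 := l)) a = 0 \<and> w_perm d (Suc c) - 1 = l - 1 \<or>
          (id(l - 1 := l)) a = l \<and> w_perm d (Suc c) - 1 = 2 * d - 1) :: complex) \<noteq> 0) \<longleftrightarrow> a = ?f c"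
      unfolding W[OF ac(2)] using True ac l d by auto
  qed (use l in auto)
  thus ?thesis by blast
next
  case False
  let ?f = "\<lambda>c. if c < d - 1 then Suc c else if c = d - 1 then l - 1 else if c = d then 0 else c - 1"
  have W: "c < l \<Longrightarrow> c < 2 * d" for c using l by auto
  have "minor (id(l - 1 := l)) l (unip (2 * d) (\<lambda>i j. of_bool (i = l \<and> j = 2 * d - 1)) * N) \<noteq> 0"
  proof (rule unip_weyl_minor_neq_0[OF d N, where f = ?f])
    show "inj_on ?f {..<l}" using False d by (auto simp: inj_on_def split: if_splits)
    show "?f ` {..<l} \<subseteq> {..<l}" using False d by auto
    fix a c assume ac: "a < l" "c < l"
    show "((id(l - 1 := l)) a = w_perm d (Suc c) - 1 \<or> (id(l - 1 := l)) a < w_perm d (Suc c) - 1 \<and>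
        (of_bool ((id(l - 1 := l)) a = l \<and> w_perm d (Suc c) - 1 = 2 * d - 1) :: complex) \<noteq> 0) \<longleftrightarrow> a = ?f c"
      unfolding w_perm_index[OF d W[OF ac(2)]] using False ac l d by auto
  qed (use l in auto)
  thus ?thesis by blast
qed

lemma one_weyl_lift: "1\<^sub>m n \<in> weyl_lifts n id"
  by (auto simp: weyl_lifts_def SL_iff split: if_splits)

lemma minor_weight_simple:
  assumes "l \<ge> 1"
  shows "minor_weight (id(l - 1 := l)) id l = (\<lambda>i. of_bool (i = Suc l) - of_bool (i = l))"
    and "minor_weight id (id(l - 1 := l)) l = (\<lambda>i. of_bool (i = l) - of_bool (i = Suc l))"
proof -
  have 1: "{..<l} = insert (l - 1) {..<l - 1}" using assms by auto
  have "(\<Sum>a<l - 1. of_bool (i = Suc ((id(l - 1 := l)) a)) - of_bool (i = Suc (id a))) = (0::int)"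
    "(\<Sum>a<l - 1. of_bool (i = Suc (id a)) - of_bool (i = Suc ((id(l - 1 := l)) a))) = (0::int)" for i
    by (auto intro!: sum.neutral)
  thus "minor_weight (id(l - 1 := l)) id l = (\<lambda>i. of_bool (i = Suc l) - of_bool (i = l))"
    "minor_weight id (id(l - 1 := l)) l = (\<lambda>i. of_bool (i = l) - of_bool (i = Suc l))"
    unfolding minor_weight_def 1 using assms by (auto simp: fun_eq_iff)
qed

lemma vvec_in_Cone:
  assumes "finite S" "vvec k \<in> S"
  shows "vvec k \<in> Cone S"
proof -
  have "vvec k = (\<lambda>i. \<Sum>s\<in>S. of_bool (s = vvec k) * s i)"
    using assms by (simp add: of_bool_def if_distrib[of "\<lambda>x. x * _"] cong: if_cong)
  thus ?thesis unfolding Cone_def by (intro CollectI exI[of _ "\<lambda>s. of_bool (s = vvec k)"]) auto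
qed

text \<open>Both characters are quotients of two minors, of the first \<open>l\<close> rows and of
  these with the last one replaced by the next. The former is nonzero at the identity, the latter at
  the simple reflection, so each can serve as denominator at its own point.\<close>

lemma fan_identification_regular:
  assumes d: "d \<ge> 1" and fan: "fan_identification d \<beta>" and l: "l \<in> {1..2*d-1}"
  shows "char_regular (2*d) (borel_SL (2*d)) (flag_schubert d) (fixed_point (2*d) (borel_SL (2*d)) id)
      (\<lambda>i. of_bool (i = Suc l) - of_bool (i = l))"
    and "char_regular (2*d) (borel_SL (2*d)) (flag_schubert d) (fixed_point (2*d) (borel_SL (2*d)) (simple_refl l))
      (\<lambda>i. of_bool (i = l) - of_bool (i = Suc l))"
proof -
  let ?n = "2 * d" and ?B = "borel_SL (2 * d)"
  \<comment> \<open>Without a dense orbit no character would be regular and the cone would be the whole space.\<close>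
  have "\<exists>m. char_regular ?n ?B (flag_schubert d) (fixed_point ?n ?B id) m"
  proof (rule ccontr)
    assume "\<not> ?thesis"
    hence "toric_cone ?n ?B \<beta> (flag_schubert d) (fixed_point ?n ?B id) = supported (?n - 1)"
      by (auto simp: toric_cone_def)
    moreover have "toric_cone ?n ?B \<beta> (flag_schubert d) (fixed_point ?n ?B id) = Cone (vvec ` {1..2*d-1})"
      using fan[unfolded fan_identification_def, THEN conjunct2, rule_format, of "{}"]
      by (simp add: subword_perm_empty)
    moreover have "(\<lambda>k. if k = 1 then -1 else 0) \<in> supported (?n - 1)" using d by (auto simp: supported_def)
    ultimately have "(\<lambda>k. if k = 1 then -1 else 0) \<in> Cone (vvec ` {1..2*d-1})" by simp
    then obtain c where c: "(\<lambda>k. if k = 1 then -1 else 0) = (\<lambda>k. \<Sum>s\<in>vvec ` {1..2*d-1}. c s * s k)"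
      "\<forall>s\<in>vvec ` {1..2*d-1}. 0 \<le> c s" unfolding Cone_def by blast
    have "(\<Sum>s\<in>vvec ` {1..2*d-1}. c s * s 1) \<ge> 0"
      using c(2) by (intro sum_nonneg mult_nonneg_nonneg) (auto simp: vvec_def)
    thus False using fun_cong[OF c(1), of 1] by simp
  qed
  then obtain x0 where x0: "x0 \<in> flag_schubert d"
    "flag_schubert d \<subseteq> quot_closure ?n ?B (torus_orbit ?n x0)"
    unfolding char_regular_def by blast
  obtain g0 where g0: "g0 \<in> carrier (SL ?n)" "x0 = mat_coset g0 ?B"
    using x0(1) by (auto simp: schubert_variety_def quot_closure_def mem_hom_space)
  obtain N where N: "N \<in> weyl_lifts ?n (w_perm d)"
    using weyl_lifts_exists[OF w_perm_permutes, of d] d by auto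
  \<comment> \<open>The point \<open>g0\<close> is only known to have a dense orbit; a single point
    of the cell with nonzero minor settles the minor at \<open>g0\<close>.\<close>
  have nz: "minor r l g0 \<noteq> 0" if r: "\<forall>a<l. r a < ?n" and e: "minor r l (unip ?n e * N) \<noteq> 0" for r e
  proof -
    have g: "unip ?n e * N \<in> carrier (SL ?n)"
      using unip_borel weyl_lifts_SL[OF N] borel_SL_subset by (intro SL_mult) blast+
    have "(unip ?n e * N) * 1\<^sub>m ?n \<in> mat_coset (unip ?n e * N) ?B"
      by (intro imageI one_borel_SL)
    hence mem: "unip ?n e * N \<in> mat_coset (unip ?n e * N) ?B" unfolding SL_mult_one[OF g] .
    have "l \<le> ?n" using l by auto
    from minor_closure[OF g0(1) borel_SL_subset borel_SL_corner this r x0(2)[unfolded g0(2)]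
        cell_in_schubert[OF unip_borel N borel_SL_subset] mem e]
    show ?thesis .
  qed
  let ?r = "id(l - 1 := l)"
  have r: "\<forall>a<l. id a < ?n" "\<forall>a<l. ?r a < ?n" using l by auto
  have nz1: "minor id l g0 \<noteq> 0" "minor ?r l g0 \<noteq> 0"
    using flag_leading_minor[OF d N l] flag_next_minor[OF d N l] nz r by blast+
  have ln: "l \<le> ?n" "l \<ge> 1" using l by auto
  note reg = char_regular_minor_weight[OF g0(1) borel_SL_subset borel_SL_corner ln(1) _ _
      x0(1)[unfolded g0(2)] x0(2)[unfolded g0(2)]]
  have mem: "\<sigma> \<in> fixed_point ?n ?B v" if "\<sigma> \<in> weyl_lifts ?n v" for \<sigma> v
  proof -
    have "\<sigma> * 1\<^sub>m ?n \<in> fixed_point ?n ?B v"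
      unfolding fixed_point_def set_mult_SL using that one_borel_SL by blast
    thus ?thesis unfolding SL_mult_one[OF weyl_lifts_SL[OF that]] .
  qed
  have "minor id l (1\<^sub>m ?n) \<noteq> (0::complex)"
    by (rule minor_monomial_neq_0[of id]) (use ln in auto)
  from reg[OF r(2,1) nz1(2,1) mem[OF one_weyl_lift] this]
  show "char_regular ?n ?B (flag_schubert d) (fixed_point ?n ?B id) (\<lambda>i. of_bool (i = Suc l) - of_bool (i = l))"
    unfolding minor_weight_simple[OF ln(2)] .
  have "simple_refl l permutes {1..?n}" unfolding simple_refl_def using l by (intro permutes_swap_id) auto
  then obtain \<sigma> where \<sigma>: "\<sigma> \<in> weyl_lifts ?n (simple_refl l)" using weyl_lifts_exists[of "simple_refl l" ?n] d by auto
  have "minor ?r l \<sigma> \<noteq> 0"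
  proof (rule minor_monomial_neq_0[of id])
    fix a c assume ac: "a < l" "c < l"
    have h: "?r a < ?n" "c < ?n" using ac l by auto
    have "simple_refl l (Suc c) = (if c = l - 1 then Suc l else Suc c)"
      using ac ln(2) by (auto simp: simple_refl_def Transposition.transpose_def)
    thus "\<sigma> $$ (?r a, c) \<noteq> 0 \<longleftrightarrow> a = id c"
      unfolding weyl_liftsD[OF \<sigma> h] using ac by (auto split: if_splits)
  qed auto
  from reg[OF r nz1 mem[OF \<sigma>] this]
  show "char_regular ?n ?B (flag_schubert d) (fixed_point ?n ?B (simple_refl l)) (\<lambda>i. of_bool (i = l) - of_bool (i = Suc l))"
    unfolding minor_weight_simple[OF ln(2)] .
qed

lemma toric_coneD:
  assumes "u \<in> toric_cone n H \<beta> X x" "a \<in> supported (n - 1)"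
    and "char_regular n H X x (combination (n - 1) \<beta> a)"
  shows "(\<Sum>k=1..n-1. of_int (a k) * u k) \<ge> 0"
  using assms unfolding toric_cone_def by blast

theorem fan_identification_coordinates:
  assumes d: "d \<ge> 1" and fan: "fan_identification d \<beta>"
  shows "simple_coordinates d \<beta>"
  unfolding simple_coordinates_def
proof
  fix k assume k: "k \<in> {1..2*d-1}"
  let ?n = "2 * d" and ?B = "borel_SL (2 * d)" and ?l = "letter d k"
  let ?m = "\<lambda>i. of_bool (i = Suc ?l) - of_bool (i = ?l) :: int"
  have l: "?l \<in> {1..2*d-1}" by (rule letter_range[OF k])
  note reg = fan_identification_regular[OF d fan l]
  have cone: "\<And>J. J \<subseteq> {1..2*d-1} \<Longrightarrow> toric_cone ?n ?B \<beta> (flag_schubert d) (fixed_point ?n ?B (subword_perm d J)) =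
      Cone (vvec ` ({1..2*d-1} - J) \<union> wvec d ` J)"
    and bij: "bij_betw (combination (?n - 1) \<beta>) (supported (?n - 1)) (root_lattice ?n)"
    using fan by (auto simp: fan_identification_def torus_coordinates_def)
  have "?m \<in> root_lattice ?n"
    using l by (subst minor_weight_simple(1)[symmetric], simp, intro minor_weight_root_lattice) auto
  then obtain a where a: "a \<in> supported (?n - 1)" "combination (?n - 1) \<beta> a = ?m"
    using bij by (metis (no_types, lifting) bij_betw_imp_surj_on imageE)
  have na: "(\<lambda>k. - a k) \<in> supported (?n - 1)" "combination (?n - 1) \<beta> (\<lambda>k. - a k) = (\<lambda>i. of_bool (i = ?l) - of_bool (i = Suc ?l))"
    using a(1) fun_cong[OF a(2)] by (auto simp: supported_def combination_def fun_eq_iff sum_negf)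
  have pair: "(\<Sum>i=1..?n-1. of_int (b i) * vvec j i) = of_int (b j)" if "j \<in> {1..2*d-1}" for b :: "nat \<Rightarrow> int" and j
  proof -
    have "(\<Sum>i=1..?n-1. of_int (b i) * vvec j i) = (\<Sum>i\<in>{j}. of_int (b i) * vvec j i)"
      using that by (intro sum.mono_neutral_right) (auto simp: vvec_def)
    thus ?thesis by (simp add: vvec_def)
  qed
  \<comment> \<open>For \<open>J = {}\<close> the cone contains all \<open>vvec j\<close>, and
    pairing with \<open>vvec j\<close> reads off \<open>a j\<close>.\<close>
  have pos: "a j \<ge> 0" if j: "j \<in> {1..2*d-1}" for j
  proof -
    have "vvec j \<in> toric_cone ?n ?B \<beta> (flag_schubert d) (fixed_point ?n ?B (subword_perm d {}))"
      unfolding cone[OF empty_subsetI] using j by (intro vvec_in_Cone) auto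
    from toric_coneD[OF this[unfolded subword_perm_empty] a(1), unfolded a(2), OF reg(1)]
    have "(\<Sum>i=1..?n-1. of_int (a i) * vvec j i) \<ge> 0" .
    thus ?thesis using pair[OF j, of a] by simp
  qed
  \<comment> \<open>For \<open>J = {k}\<close> the vectors \<open>vvec j\<close> with
    \<open>j \<noteq> k\<close> remain in the cone, while the regular character has changed
    sign.\<close>
  have neg: "a j \<le> 0" if j: "j \<in> {1..2*d-1}" "j \<noteq> k" for j
  proof -
    have "{k} \<subseteq> {1..2*d-1}" using k by auto
    have "vvec j \<in> toric_cone ?n ?B \<beta> (flag_schubert d) (fixed_point ?n ?B (subword_perm d {k}))"
      unfolding cone[OF \<open>{k} \<subseteq> _\<close>] using j by (intro vvec_in_Cone) auto
    from toric_coneD[OF this[unfolded subword_perm_single[OF k]] na(1), unfolded na(2), OF reg(2)]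
    have "(\<Sum>i=1..?n-1. of_int (- a i) * vvec j i) \<ge> 0" .
    thus ?thesis using pair[OF j(1), of "\<lambda>i. - a i"] by simp
  qed
  have comb: "?m i = a k * \<beta> k i" for i
  proof -
    have "?m i = (\<Sum>j=1..?n-1. a j * \<beta> j i)" using fun_cong[OF a(2), of i] by (simp add: combination_def)
    also have "\<dots> = (\<Sum>j\<in>{k}. a j * \<beta> j i)"
    proof (intro sum.mono_neutral_right ballI)
      fix j assume "j \<in> {1..?n-1} - {k}"
      hence "j \<in> {1..2*d-1}" "j \<noteq> k" by auto
      thus "a j * \<beta> j i = 0" using pos[of j] neg[of j] by simp
    qed (use k in auto)
    finally show ?thesis by simp
  qed
  \<comment> \<open>The character \<open>?m\<close> has an entry 1, so the nonnegative integer
    \<open>a k\<close> divides 1.\<close>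
  have ak: "a k * \<beta> k (Suc ?l) = 1" using comb[of "Suc ?l"] by simp
  hence "a k \<noteq> 0" by auto
  hence "a k > 0" using pos[OF k] by simp
  hence "a k = 1" using ak pos_zmult_eq_1_iff by blast
  thus "\<beta> k = ?m" using comb by (auto simp: fun_eq_iff)
qed

section \<open>Rays\<close>

text \<open>\<open>Cone\<close> sums over a set of vectors, while a family may repeat them, as
  \<open>ray\<close> does for \<open>d = 1\<close>. Coefficients are concentrated on representatives
  in one direction and merged in the other.\<close>

lemma Cone_image:
  assumes I: "finite I"
  shows "Cone (f ` I) = {(\<lambda>k. \<Sum>i\<in>I. c i * f i k) | c. \<forall>i\<in>I. 0 \<le> c i}" (is "?L = ?R")
proof
  show "?L \<subseteq> ?R"
  proof
    fix u assume "u \<in> ?L"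
    then obtain c where c: "u = (\<lambda>k. \<Sum>s\<in>f ` I. c s * s k)" "\<forall>s\<in>f ` I. 0 \<le> c s"
      unfolding Cone_def by blast
    obtain I' where I': "I' \<subseteq> I" "inj_on f I'" "f ` I = f ` I'" by (meson subset_image_inj subset_refl)
    let ?c = "\<lambda>i. if i \<in> I' then c (f i) else 0"
    have "u = (\<lambda>k. \<Sum>i\<in>I. ?c i * f i k)"
    proof
      fix k
      have "u k = (\<Sum>i\<in>I'. c (f i) * f i k)" unfolding c(1) I'(3) by (simp add: sum.reindex[OF I'(2)])
      also have "\<dots> = (\<Sum>i\<in>I. ?c i * f i k)" using I I'(1) by (intro sum.mono_neutral_cong_left) auto
      finally show "u k = (\<Sum>i\<in>I. ?c i * f i k)" .
    qed
    moreover have "\<forall>i\<in>I. 0 \<le> ?c i" using c(2) by auto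
    ultimately show "u \<in> ?R" by (intro CollectI exI[of _ ?c] conjI)
  qed
  show "?R \<subseteq> ?L"
  proof
    fix u assume "u \<in> ?R"
    then obtain c where c: "u = (\<lambda>k. \<Sum>i\<in>I. c i * f i k)" "\<forall>i\<in>I. 0 \<le> c i" by blast
    let ?c = "\<lambda>s. \<Sum>i\<in>{i \<in> I. f i = s}. c i"
    have "u = (\<lambda>k. \<Sum>s\<in>f ` I. ?c s * s k)"
    proof
      fix k
      have "u k = (\<Sum>s\<in>f ` I. \<Sum>i\<in>{i \<in> I. f i = s}. c i * f i k)"
        unfolding c(1) by (rule sum.image_gen[OF I])
      also have "\<dots> = (\<Sum>s\<in>f ` I. ?c s * s k)" by (intro sum.cong refl) (simp add: sum_distrib_right)
      finally show "u k = (\<Sum>s\<in>f ` I. ?c s * s k)" .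
    qed
    moreover have "\<forall>s\<in>f ` I. 0 \<le> ?c s" using c(2) by (auto intro: sum_nonneg)
    ultimately show "u \<in> ?L" unfolding Cone_def by (intro CollectI exI[of _ ?c] conjI)
  qed
qed

text \<open>
  The ray numbered \<open>r\<close> moves the minors involving row \<open>r\<close> (for \<open>r < d\<close>: those from which row \<open>r\<close>
  was removed) away from the minimal weight; for \<open>r = 2 * d\<close> it is the leading minor that is moved.
\<close>

definition ray_weight :: "nat \<Rightarrow> nat \<Rightarrow> nat \<Rightarrow> real" where
  "ray_weight d r i = (if r < d then - of_bool (i = r) else if r < 2 * d then of_bool (i = r) else - of_bool (d \<le> i))"

definition ray :: "nat \<Rightarrow> nat \<Rightarrow> nat \<Rightarrow> real" where
  "ray d r = root_diffs d (ray_weight d r)"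

definition face_rays :: "nat \<Rightarrow> nat set \<Rightarrow> nat set \<Rightarrow> bool \<Rightarrow> nat set" where
  "face_rays d R C z = {j. j < d \<and> j \<notin> C} \<union> {r. d \<le> r \<and> r < 2 * d \<and> r - d \<notin> R} \<union> (if z then {} else {2 * d})"

lemma finite_face_rays: "finite (face_rays d R C z)"
  by (rule finite_subset[of _ "{..2 * d}"]) (auto simp: face_rays_def)

lemma root_diffs_cong:
  assumes "\<And>i. i < 2 * d \<Longrightarrow> \<mu> i = \<nu> i + c"
  shows "root_diffs d \<mu> = root_diffs d \<nu>"
proof
  fix k
  show "root_diffs d \<mu> k = root_diffs d \<nu> k"
  proof (cases "k \<in> {1..2*d-1}")
    case True
    hence "letter d k < 2 * d" "letter d k - 1 < 2 * d" using letter_range[OF True] by auto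
    thus ?thesis using assms by (simp add: root_diffs_def)
  next
    case False
    thus ?thesis unfolding root_diffs_def by (simp only: if_False)
  qed
qed

lemma root_diffs_sum:
  "root_diffs d (\<lambda>i. \<Sum>r\<in>I. c r * w r i) = (\<lambda>k. \<Sum>r\<in>I. c r * root_diffs d (w r) k)"
  by (auto simp: fun_eq_iff root_diffs_def sum_subtractf right_diff_distrib)

lemma ray_weight_sum:
  assumes i: "i < 2 * d"
  shows "(\<Sum>r\<in>face_rays d R C z. c r * ray_weight d r i) =
    (if i < d then - (if i \<in> C then 0 else c i) else (if i - d \<in> R then 0 else c i) - (if z then 0 else c (2 * d)))"
proof -
  let ?M = "face_rays d R C z"
  have le: "r \<le> 2 * d" if "r \<in> ?M" for r using that by (auto simp: face_rays_def split: if_splits)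
  have "(\<Sum>r\<in>?M. c r * ray_weight d r i) = (\<Sum>r\<in>?M \<inter> {i, 2 * d}. c r * ray_weight d r i)"
  proof (intro sum.mono_neutral_right ballI finite_face_rays Int_lower1)
    fix r assume r: "r \<in> ?M - ?M \<inter> {i, 2 * d}"
    hence "r < 2 * d" "r \<noteq> i" using le[of r] by auto
    thus "c r * ray_weight d r i = 0" by (simp add: ray_weight_def)
  qed
  also have "?M \<inter> {i, 2 * d} = (if i \<in> ?M then {i} else {}) \<union> (if z then {} else {2 * d})"
    by (auto simp: face_rays_def)
  also have "(\<Sum>r\<in>\<dots>. c r * ray_weight d r i) =
      (if i \<in> ?M then c i * ray_weight d i i else 0) + (if z then 0 else c (2 * d) * ray_weight d (2 * d) i)"
    using i by (subst sum.union_disjoint) auto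
  also have "\<dots> = (if i < d then - (if i \<in> C then 0 else c i)
      else (if i - d \<in> R then 0 else c i) - (if z then 0 else c (2 * d)))"
    using i by (auto simp: ray_weight_def face_rays_def)
  finally show ?thesis .
qed

text \<open>Up to a constant, a weight in the cone is determined by its deviations from two
  reference values and by the gap between these, and exactly these numbers are the
  coefficients.\<close>

lemma support_cone_Cone:
  assumes d: "d \<ge> 1" and RC: "R \<subseteq> {..<d}" "C \<subseteq> {..<d}" "R \<noteq> {} \<and> C \<noteq> {} \<or> R = {} \<and> C = {} \<and> z"
  shows "root_diffs d ` support_cone d R C z = Cone (ray d ` face_rays d R C z)"
proof
  let ?M = "face_rays d R C z"
  show "root_diffs d ` support_cone d R C z \<subseteq> Cone (ray d ` ?M)"
  proof
    fix u assume "u \<in> root_diffs d ` support_cone d R C z"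
    then obtain \<mu> where \<mu>: "\<mu> \<in> support_cone d R C z" "u = root_diffs d \<mu>" by blast
    \<comment> \<open>If \<open>R\<close> and \<open>C\<close> are nonempty, \<open>t\<close> is the
      largest upper weight, attained on \<open>C\<close>, and \<open>b\<close> the smallest lower
      weight, attained on \<open>R\<close>. If both are empty, the largest upper weight separates
      the two blocks and serves for both.\<close>
    obtain t b where tb: "\<forall>j<d. \<mu> j \<le> t" "\<forall>j\<in>C. \<mu> j = t" "\<forall>i<d. b \<le> \<mu> (d + i)"
      "\<forall>i\<in>R. \<mu> (d + i) = b" "b \<le> t" "z \<longrightarrow> b = t"
    proof (cases "R = {}")
      case True
      hence e: "C = {}" z using RC by auto
      define t where "t = Max (\<mu> ` {..<d})"
      have ne: "\<mu> ` {..<d} \<noteq> {}" using d by (auto simp: lessThan_empty_iff)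
      have "t \<in> \<mu> ` {..<d}" unfolding t_def using ne by (intro Max_in) auto
      hence "t \<le> \<mu> (d + i)" if "i < d" for i using \<mu>(1) e that by (auto simp: support_cone_def)
      moreover have "\<mu> j \<le> t" if "j < d" for j unfolding t_def using that by (intro Max_ge) auto
      ultimately show ?thesis using True e by (intro that[of t t]) auto
    next
      case False
      then obtain i0 j0 where 0: "i0 \<in> R" "j0 \<in> C" using RC by blast
      hence lt0: "i0 < d" "j0 < d" using RC by auto
      have S: "\<mu> (d + i) \<le> \<mu> j \<and> (\<forall>i'<d. \<forall>j'<d. \<mu> (d + i) - \<mu> j \<le> \<mu> (d + i') - \<mu> j')" if "i \<in> R" "j \<in> C" for i j
        using \<mu>(1) that by (auto simp: support_cone_def)
      have S': "\<mu> (d + i) - \<mu> j \<le> \<mu> (d + i') - \<mu> j'" if "i \<in> R" "j \<in> C" "i' < d" "j' < d" for i j i' j'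
        using S[OF that(1,2)] that(3,4) by blast
      have 1: "\<mu> j \<le> \<mu> j0" if "j < d" for j using S'[OF 0 lt0(1) that] by simp
      have 2: "\<mu> (d + i0) \<le> \<mu> (d + i)" if "i < d" for i using S'[OF 0 that lt0(2)] by simp
      have 3: "\<mu> j = \<mu> j0" if "j \<in> C" for j
        using S'[OF 0(1) that lt0] 1[of j] that RC by force
      have 4: "\<mu> (d + i) = \<mu> (d + i0)" if "i \<in> R" for i
        using S'[OF that 0(2) lt0] 2[of i] that RC by force
      have 5: "\<mu> j0 \<le> \<mu> (d + i0)" if z using \<mu>(1) lt0 that by (auto simp: support_cone_def)
      have 6: "\<mu> (d + i0) \<le> \<mu> j0" using S[OF 0] by blast
      show ?thesis using 1 2 3 4 5 6 by (intro that[of "\<mu> j0" "\<mu> (d + i0)"]) auto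
    qed
    define c where "c r = (if r < d then t - \<mu> r else if r < 2 * d then \<mu> r - b else t - b)" for r
    \<comment> \<open>The combination differs from \<open>\<mu>\<close> by the constant
      \<open>t\<close>, which \<open>root_diffs\<close> does not see.\<close>
    have "root_diffs d \<mu> = root_diffs d (\<lambda>i. \<Sum>r\<in>?M. c r * ray_weight d r i)"
    proof (rule root_diffs_cong)
      fix i assume i: "i < 2 * d"
      show "\<mu> i = (\<Sum>r\<in>?M. c r * ray_weight d r i) + t"
        unfolding ray_weight_sum[OF i] using i
        by (cases rule: less_double_cases) (use tb(2,4,6) in \<open>auto simp: c_def\<close>)
    qed
    hence "u = (\<lambda>k. \<Sum>r\<in>?M. c r * ray d r k)" unfolding \<mu>(2) ray_def root_diffs_sum .
    moreover have "c r \<ge> 0" if "r \<in> ?M" for r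
    proof (cases "r < 2 * d")
      case True
      thus ?thesis by (cases rule: less_double_cases) (use tb in \<open>auto simp: c_def\<close>)
    qed (use tb in \<open>auto simp: c_def\<close>)
    ultimately show "u \<in> Cone (ray d ` ?M)" unfolding Cone_image[OF finite_face_rays] by (intro CollectI exI[of _ c] conjI ballI)
  qed
  show "Cone (ray d ` ?M) \<subseteq> root_diffs d ` support_cone d R C z"
  proof
    fix u assume "u \<in> Cone (ray d ` ?M)"
    then obtain c where c: "u = (\<lambda>k. \<Sum>r\<in>?M. c r * ray d r k)" "\<forall>r\<in>?M. 0 \<le> c r"
      unfolding Cone_image[OF finite_face_rays] by blast
    define \<mu> where "\<mu> i = (\<Sum>r\<in>?M. c r * ray_weight d r i)" for i
    have u: "u = root_diffs d \<mu>" unfolding c(1) \<mu>_def[abs_def] root_diffs_sum ray_def ..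
    have top: "\<mu> j = - (if j \<in> C then 0 else c j)" if "j < d" for j
      unfolding \<mu>_def using that by (subst ray_weight_sum) auto
    have bot: "\<mu> (d + i) = (if i \<in> R then 0 else c (d + i)) - (if z then 0 else c (2 * d))" if "i < d" for i
      unfolding \<mu>_def using that by (subst ray_weight_sum) auto
    have c0: "j < d \<Longrightarrow> j \<notin> C \<Longrightarrow> 0 \<le> c j" "i < d \<Longrightarrow> i \<notin> R \<Longrightarrow> 0 \<le> c (d + i)" "\<not> z \<Longrightarrow> 0 \<le> c (2 * d)" for i j
      using c(2) by (auto simp: face_rays_def)
    have t0: "\<mu> j \<le> 0" if "j < d" for j using top[OF that] c0(1)[OF that] by auto
    have b0: "\<mu> (d + i) \<ge> - (if z then 0 else c (2 * d))" if "i < d" for i using bot[OF that] c0(2)[OF that] by auto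
    have "\<mu> \<in> support_cone d R C z"
      unfolding support_cone_def
    proof (intro CollectI conjI impI allI ballI)
      fix i j assume "z" "i < d" "j < d"
      thus "\<mu> j \<le> \<mu> (d + i)" using t0[of j] b0[of i] by simp
    next
      fix i j assume ij: "i \<in> R" "j \<in> C"
      then have m: "\<mu> (d + i) = - (if z then 0 else c (2 * d))" "\<mu> j = 0" using bot[of i] top[of j] RC by auto
      show "\<mu> (d + i) \<le> \<mu> j" unfolding m using c0(3) by auto
      fix i' j' assume "i' < d" "j' < d"
      thus "\<mu> (d + i) - \<mu> j \<le> \<mu> (d + i') - \<mu> j'" unfolding m using t0[of j'] b0[of i'] by simp
    qed
    thus "u \<in> root_diffs d ` support_cone d R C z" unfolding u by blast
  qed
qed

text \<open>The only later letter adjacent to a given one is the next letter in its run. The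
  exception is the letter \<open>d + 1\<close>, which ends the first run at position
  \<open>d - 1\<close>: its later neighbour \<open>d\<close> stands at the last position.\<close>

lemma wvec_eq:
  assumes d: "d \<ge> 1" and k: "k \<in> {1..2*d-1}"
  shows "wvec d k l = - of_bool (l = k) + of_bool (k < l \<and> l \<le> 2 * d - 1 \<and> (if k = d - 1 then l = 2 * d - 1 else l = Suc k))"
proof -
  have "(\<Sum>j\<in>{k<..2*d-1}. of_int (cartan (w_word d ! (j - 1)) (w_word d ! (k - 1))) * vvec j l) =
      (\<Sum>j\<in>{k<..2*d-1} \<inter> {l}. of_int (cartan (letter d j) (letter d k)) * vvec j l)"
  proof (rule sum.mono_neutral_cong_right)
    fix j assume "j \<in> {k<..2*d-1} \<inter> {l}"
    hence "j \<in> {1..2*d-1}" by auto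
    thus "of_int (cartan (w_word d ! (j - 1)) (w_word d ! (k - 1))) * vvec j l =
        of_int (cartan (letter d j) (letter d k)) * vvec j l" by (simp only: w_word_nth k)
  qed (auto simp: vvec_def)
  also have "\<dots> = (if k < l \<and> l \<le> 2*d-1 then of_int (cartan (letter d l) (letter d k)) else 0)"
    by (auto simp: vvec_def)
  finally have w: "wvec d k l = - of_bool (l = k) - (if k < l \<and> l \<le> 2*d-1 then of_int (cartan (letter d l) (letter d k)) else 0)"
    unfolding wvec_def by (auto simp: vvec_def)
  have c: "cartan (letter d l) (letter d k) = - of_bool (if k = d - 1 then l = 2 * d - 1 else l = Suc k)"
    if "k < l" "l \<le> 2 * d - 1"
  proof -
    consider "l < d" | "k < d" "d \<le> l" | "d \<le> k" using that by linarith
    thus ?thesis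
    proof cases
      case 1
      thus ?thesis using that k d by (auto simp: cartan_def letter_def)
    next
      case 2
      thus ?thesis using that k d by (auto simp: cartan_def letter_def)
    next
      case 3
      thus ?thesis using that k d by (auto simp: cartan_def letter_def)
    qed
  qed
  show ?thesis
  proof (cases "k < l \<and> l \<le> 2 * d - 1")
    case True
    thus ?thesis unfolding w c[OF conjunct1[OF True] conjunct2[OF True]] by simp
  qed (auto simp: w)
qed

text \<open>The row number behind \<open>wvec d k\<close>. The two indices not attained,
  \<open>0\<close> and \<open>2 * d - 1\<close>, are those of \<open>vvec d\<close> and
  \<open>vvec 1\<close>.\<close>

definition ray_index :: "nat \<Rightarrow> nat \<Rightarrow> nat" where
  "ray_index d k = (if k < d then 2 * d - 1 - k else if k < 2 * d - 1 then Suc k - d else 2 * d)"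

lemma ray_eq:
  "ray d r l = (if l \<in> {1..2*d-1} then ray_weight d r (letter d l) - ray_weight d r (letter d l - 1) else 0)"
  by (simp add: ray_def root_diffs_def)

lemma vvec_1_ray:
  assumes d: "d \<ge> 1"
  shows "vvec 1 = ray d (2 * d - 1)"
proof
  fix l
  show "vvec 1 l = ray d (2 * d - 1) l"
  proof (cases "l \<in> {1..2*d-1}")
    case True
    hence "letter d l = 2 * d - 1 \<longleftrightarrow> l = 1" "letter d l - 1 \<noteq> 2 * d - 1"
      unfolding letter_def using d by (cases "l < d"; simp; linarith)+
    moreover have "\<not> 2 * d - 1 < d" "2 * d - 1 < 2 * d" using d by auto
    ultimately show ?thesis using True by (simp add: vvec_def ray_eq ray_weight_def del: One_nat_def)
  qed (use d in \<open>auto simp: vvec_def ray_eq\<close>)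
qed

lemma vvec_d_ray:
  assumes d: "d \<ge> 1"
  shows "vvec d = ray d 0"
proof
  fix l
  show "vvec d l = ray d 0 l"
  proof (cases "l \<in> {1..2*d-1}")
    case True
    hence "letter d l \<noteq> 0" "letter d l - 1 = 0 \<longleftrightarrow> l = d"
      unfolding letter_def using d by (cases "l < d"; simp; linarith)+
    thus ?thesis using True d by (simp add: vvec_def ray_eq ray_weight_def)
  qed (use d in \<open>auto simp: vvec_def ray_eq\<close>)
qed

lemma wvec_ray:
  assumes d: "d \<ge> 1" and k: "k \<in> {1..2*d-1}"
  shows "wvec d k = ray d (ray_index d k)"
proof
  fix l
  show "wvec d k l = ray d (ray_index d k) l"
  proof (cases "l \<in> {1..2*d-1}")
    case False
    thus ?thesis unfolding wvec_eq[OF d k] ray_eq using k by auto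
  next
    case l: True
    consider "k < d" | "d \<le> k" "k < 2 * d - 1" | "k = 2 * d - 1" using k by force
    thus ?thesis
    proof cases
      case 1
      hence "letter d l = 2*d-1-k \<longleftrightarrow> (if k = d-1 then l = 2*d-1 else l = Suc k)"
        unfolding letter_def using k l by (cases "l < d"; cases "k = d - 1"; simp; linarith)
      moreover have "letter d l - 1 = 2*d-1-k \<longleftrightarrow> l = k"
        unfolding letter_def using 1 k l by (cases "l < d"; simp; linarith)
      moreover have "ray_weight d (ray_index d k) = (\<lambda>i. of_bool (i = 2*d-1-k))"
        using 1 k by (auto simp: ray_weight_def ray_index_def)
      moreover have "(if k = d-1 then l = 2*d-1 else l = Suc k) \<Longrightarrow> k < l \<and> l \<le> 2*d-1"
        using 1 l by (auto split: if_splits)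
      ultimately show ?thesis unfolding wvec_eq[OF d k] ray_eq using l by auto
    next
      case 2
      hence "letter d l = Suc k - d \<longleftrightarrow> l = k"
        unfolding letter_def using k l by (cases "l < d"; simp; linarith)
      moreover have "letter d l - 1 = Suc k - d \<longleftrightarrow> l = Suc k"
        unfolding letter_def using 2 k l by (cases "l < d"; simp; linarith)
      moreover have "ray_weight d (ray_index d k) = (\<lambda>i. - of_bool (i = Suc k - d))"
        using 2 k by (auto simp: ray_weight_def ray_index_def)
      moreover have "k \<noteq> d - 1" using 2 d by auto
      ultimately show ?thesis unfolding wvec_eq[OF d k] ray_eq using l by auto
    next
      case 3
      have "d \<le> letter d l - 1 \<longleftrightarrow> d \<le> letter d l \<and> l \<noteq> 2*d-1" "l = 2*d-1 \<Longrightarrow> d \<le> letter d l"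
        unfolding letter_def using 3 k l by (cases "l < d"; simp; linarith)+
      moreover have "ray_weight d (ray_index d k) = (\<lambda>i. - of_bool (d \<le> i))"
        using 3 d by (auto simp: ray_weight_def ray_index_def)
      ultimately show ?thesis unfolding wvec_eq[OF d k] ray_eq using l 3 by auto
    qed
  qed
qed

section \<open>Cones and rays of the fan\<close>

lemma toric_cone_Cone:
  assumes d: "d \<ge> 1" and \<beta>: "torus_coordinates (2 * d) \<beta>" "simple_coordinates d \<beta>"
    and x: "\<forall>g\<in>x. g \<in> carrier (SL (2 * d)) \<and> lower_rank1 d g \<and> has_support d g R C z" "x \<noteq> {}"
  shows "toric_cone (2 * d) (grass_parabolic d) \<beta> (grass_schubert d) x = Cone (ray d ` face_rays d R C z)"
proof -
  obtain g where "has_support d g R C z" using x by blast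
  hence "R \<subseteq> {..<d}" "C \<subseteq> {..<d}" "R \<noteq> {} \<and> C \<noteq> {} \<or> R = {} \<and> C = {} \<and> z"
    by (auto simp: has_support_def)
  thus ?thesis unfolding toric_cone_support[OF d \<beta> x] by (rule support_cone_Cone[OF d])
qed

lemma toric_cone_coset:
  assumes d: "d \<ge> 1" and \<beta>: "torus_coordinates (2 * d) \<beta>" "simple_coordinates d \<beta>"
    and g: "g \<in> carrier (SL (2 * d))" "lower_rank1 d g" "has_support d g R C z"
  shows "toric_cone (2 * d) (grass_parabolic d) \<beta> (grass_schubert d) (mat_coset g (grass_parabolic d))
    = Cone (ray d ` face_rays d R C z)"
proof (rule toric_cone_Cone[OF d \<beta>])
  show "\<forall>h\<in>mat_coset g (grass_parabolic d). h \<in> carrier (SL (2 * d)) \<and> lower_rank1 d h \<and> has_support d h R C z"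
    using parabolic_coset_lower_rank1[OF g(1,2)] parabolic_coset_support[OF g(1)] g(3) by blast
  show "mat_coset g (grass_parabolic d) \<noteq> {}" using one_parabolic_SL[of d "2 * d"] by auto
qed

lemma Cone_in_grass_fan:
  assumes d: "d \<ge> 1" and \<beta>: "torus_coordinates (2 * d) \<beta>" "simple_coordinates d \<beta>"
    and g: "g \<in> carrier (SL (2 * d))" "lower_rank1 d g" "has_support d g R C z"
  shows "Cone (ray d ` face_rays d R C z) \<in> grass_fan d \<beta>"
  unfolding grass_fan_def toric_fan_def toric_cone_coset[OF assms, symmetric]
  by (intro imageI lower_rank1_in_schubert[OF d g(1,2)])

lemma grass_fanE:
  assumes d: "d \<ge> 1" and \<beta>: "torus_coordinates (2 * d) \<beta>" "simple_coordinates d \<beta>"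
    and \<sigma>: "\<sigma> \<in> grass_fan d \<beta>"
  obtains R C z where "\<sigma> = Cone (ray d ` face_rays d R C z)"
proof -
  obtain x where x: "x \<in> grass_schubert d"
    "\<sigma> = toric_cone (2 * d) (grass_parabolic d) \<beta> (grass_schubert d) x"
    using \<sigma> by (auto simp: grass_fan_def toric_fan_def)
  obtain g where g: "g \<in> carrier (SL (2 * d))" "x = mat_coset g (grass_parabolic d)"
    using x(1) by (auto simp: schubert_variety_def quot_closure_def mem_hom_space)
  have "g * 1\<^sub>m (2 * d) \<in> x" unfolding g(2) by (intro imageI one_parabolic_SL) simp
  hence "g \<in> x" unfolding SL_mult_one[OF g(1)] .
  hence r: "lower_rank1 d g" by (rule schubert_lower_rank1[OF d x(1)])
  obtain R C z where "has_support d g R C z" using has_support_exists[OF g(1) r] .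
  thus ?thesis using that toric_cone_coset[OF d \<beta> g(1) r] unfolding x(2) g(2) by blast
qed

text \<open>The lower block is the rank-one indicator of \<open>R \<times> C\<close> under a unit
  block, so the minors with one exchanged row are its entries.\<close>

lemma graph_point:
  assumes RC: "R \<subseteq> {..<d}" "C \<subseteq> {..<d}" "R \<noteq> {} \<and> C \<noteq> {} \<or> R = {} \<and> C = {}"
  obtains g where "g \<in> carrier (SL (2 * d))" "lower_rank1 d g" "has_support d g R C True"
proof -
  define g :: "complex mat" where "g = Matrix.mat (2 * d) (2 * d)
    (\<lambda>(i, j). if i = j then 1 else if j < d \<and> d \<le> i then of_bool (i - d \<in> R \<and> j \<in> C) else 0)"
  have gc: "g \<in> carrier_mat (2 * d) (2 * d)" by (simp add: g_def)
  have low: "g $$ (d + i, j) = of_bool (i \<in> R \<and> j \<in> C)" if "i < d" "j < d" for i j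
    using that by (simp add: g_def)
  have top: "g $$ (id a, c) = (if a = c then 1 else 0)" if "a < d" "c < d" for a c
    using that by (simp add: g_def)
  have "det g = prod_list (diag_mat g)"
    by (rule det_lower_triangular[OF _ gc]) (auto simp: g_def)
  also have "\<dots> = 1" by (auto simp: prod_list_diag_prod g_def)
  finally have "g \<in> carrier (SL (2 * d))" using gc by (simp add: SL_iff)
  moreover have "lower_rank1 d g" unfolding lower_rank1_def using low by auto
  moreover have "minor id d g \<noteq> 0" using top by (intro minor_monomial_neq_0[of id]) auto
  moreover have "minor (id(j := d + i)) d g = of_bool (i \<in> R \<and> j \<in> C)" if "i < d" "j < d" for i j
    using minor_replace_row[of j d g id "d + i"] top low that by simp
  ultimately show ?thesis using RC by (intro that[of g]) (auto simp: has_support_def)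
qed

lemma primitiveI:
  assumes u: "u \<in> lattice_points r" and k: "u k = 1 \<or> u k = -1"
  shows "primitive r u"
  unfolding primitive_def
proof (intro conjI u ballI allI impI)
  show "u \<noteq> (\<lambda>_. 0)"
  proof
    assume "u = (\<lambda>_. 0)"
    thus False using k by simp
  qed
  fix u' and c :: nat assume u': "u' \<in> lattice_points r" and e: "u = (\<lambda>k. real c * u' k)"
  obtain z where z: "u' k = of_int z" using u' by (auto simp: lattice_points_def elim: Ints_cases)
  have "real c * of_int z = 1 \<or> real c * of_int z = -1" using k fun_cong[OF e, of k] z by simp
  hence "of_int (int c * z) = (1::real) \<or> of_int (int c * z) = (-1::real)" by simp
  hence "int c * z = 1 \<or> int c * z = -1" by linarith
  hence "\<bar>int c\<bar> = 1" by (auto simp: zmult_eq_1_iff dest: zmult_eq_neg1_iff[THEN iffD1])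
  thus "c = 1" by simp
qed

lemma ray_image:
  assumes d: "d \<ge> 1" and M: "M \<subseteq> {..2 * d}"
  shows "ray d ` M = (if 2 * d - 1 \<in> M then {vvec 1} else {}) \<union> (if 0 \<in> M then {vvec d} else {})
    \<union> wvec d ` {k \<in> {1..2*d-1}. ray_index d k \<in> M}"
proof -
  let ?K = "{k \<in> {1..2*d-1}. ray_index d k \<in> M}"
  have "M = (if 2 * d - 1 \<in> M then {2 * d - 1} else {}) \<union> (if 0 \<in> M then {0} else {}) \<union> ray_index d ` ?K" (is "_ = ?R")
  proof
    show "?R \<subseteq> M" by (auto split: if_splits)
    show "M \<subseteq> ?R"
    proof
      fix r assume r: "r \<in> M"
      \<comment> \<open>The inverse of \<open>ray_index d\<close> away from the indices
        \<open>0\<close> and \<open>2 * d - 1\<close>.\<close>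
      let ?k = "if r < d then d + r - 1 else if r < 2 * d then 2 * d - 1 - r else 2 * d - 1"
      show "r \<in> ?R"
      proof (cases "r = 0 \<or> r = 2 * d - 1")
        case False
        hence k: "ray_index d ?k = r" "?k \<in> {1..2*d-1}" using r d M by (auto simp: ray_index_def)
        hence "?k \<in> ?K" unfolding mem_Collect_eq k(1) using r k(2) by blast
        thus ?thesis using imageI[of ?k ?K "ray_index d"] unfolding k(1) by blast
      qed (use r in auto)
    qed
  qed
  hence "ray d ` M = ray d ` ?R" by (rule arg_cong)
  also have "\<dots> = (if 2 * d - 1 \<in> M then {vvec 1} else {}) \<union> (if 0 \<in> M then {vvec d} else {})
      \<union> (\<lambda>k. ray d (ray_index d k)) ` ?K"
    unfolding vvec_1_ray[OF d] vvec_d_ray[OF d] image_Un image_image by simp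
  also have "(\<lambda>k. ray d (ray_index d k)) ` ?K = wvec d ` ?K"
    using wvec_ray[OF d] by (intro image_cong) auto
  finally show ?thesis .
qed

lemma ray_indices:
  assumes d: "d \<ge> 1"
  shows "ray d ` {..2 * d} = {vvec 1, vvec d} \<union> wvec d ` {1..2*d-1}"
proof -
  have "{k \<in> {1..2*d-1}. ray_index d k \<in> {..2 * d}} = {1..2*d-1}" by (auto simp: ray_index_def)
  thus ?thesis unfolding ray_image[OF d subset_refl] by auto
qed

lemma ray_unit_entry:
  assumes d: "d \<ge> 1" and r: "r \<le> 2 * d"
  shows "ray d r \<in> lattice_points (2 * d - 1)" "\<exists>k. ray d r k = 1 \<or> ray d r k = -1"
proof -
  show "ray d r \<in> lattice_points (2 * d - 1)"
    by (auto simp: lattice_points_def supported_def ray_eq ray_weight_def)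
  have "ray d r \<in> {vvec 1, vvec d} \<union> wvec d ` {1..2*d-1}"
    unfolding ray_indices[OF d, symmetric] using r by blast
  moreover have "vvec k k = 1" for k by (simp add: vvec_def)
  moreover have "wvec d k k = -1" if "k \<in> {1..2*d-1}" for k using wvec_eq[OF d that, of k] by simp
  ultimately show "\<exists>k. ray d r k = 1 \<or> ray d r k = -1" by fastforce
qed

lemma Cone_singleton: "Cone {u} = {(\<lambda>k. c * u k) | c. 0 \<le> c}"
proof -
  have "Cone {u} = Cone ((\<lambda>_. u) ` {()})" by simp
  also have "\<dots> = {(\<lambda>k. c * u k) | c. 0 \<le> c}" unfolding Cone_image[OF finite.insertI[OF finite.emptyI]] by auto
  finally show ?thesis .
qed

lemma Cone_empty: "Cone {} = {\<lambda>_. 0}"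
  by (auto simp: Cone_def)

text \<open>A ray is realised by a point whose support fails to be full in a single respect.
  Conversely, a half line of the fan contains some \<open>ray d r\<close>, and both generators are
  primitive.\<close>

theorem grass_ray_generators:
  assumes d: "d \<ge> 1" and \<beta>: "torus_coordinates (2 * d) \<beta>" "simple_coordinates d \<beta>"
  shows "ray_generators (2 * d - 1) (grass_fan d \<beta>) = ray d ` {..2 * d}"
proof
  show "ray d ` {..2 * d} \<subseteq> ray_generators (2 * d - 1) (grass_fan d \<beta>)"
  proof
    fix u assume "u \<in> ray d ` {..2 * d}"
    then obtain r where r: "r \<le> 2 * d" "u = ray d r" by auto
    have "primitive (2 * d - 1) u" using ray_unit_entry[OF d r(1)] primitiveI unfolding r(2) by blast
    moreover have "Cone {u} \<in> grass_fan d \<beta>"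
    proof (cases "r = 2 * d")
      case True
      \<comment> \<open>With \<open>z = 0\<close> the leading minor is the only admissible minor
        that vanishes.\<close>
      obtain y N where b: "y \<in> borel_SL (2 * d)" "N \<in> weyl_lifts (2 * d) (w_perm d)"
        "minor id d (y * N) \<noteq> 0 \<longleftrightarrow> 0 \<noteq> (0::complex)" "\<forall>i<d. \<forall>j<d. minor (id(j := d + i)) d (y * N) \<noteq> 0"
        by (rule base_point[OF d])
      have "y * N \<in> carrier (SL (2 * d))"
        using b(1) weyl_lifts_SL[OF b(2)] by (intro SL_mult) (auto simp: borel_SL_def)
      moreover have "has_support d (y * N) {..<d} {..<d} False"
        using b(3,4) d by (auto simp: has_support_def lessThan_empty_iff)
      ultimately have "Cone (ray d ` face_rays d {..<d} {..<d} False) \<in> grass_fan d \<beta>"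
        using cell_lower_rank1[OF d b(1,2)] by (intro Cone_in_grass_fan[OF d \<beta>])
      moreover have "face_rays d {..<d} {..<d} False = {r}" using True by (auto simp: face_rays_def)
      ultimately show ?thesis using r(2) by simp
    next
      case False
      \<comment> \<open>One index is dropped from the full support. For \<open>d = 1\<close> the
        product would become empty, so both sets are taken empty; the two generators that result
        coincide.\<close>
      define R where "R = (if d = 1 then {} else if r < d then {..<d} else {..<d} - {r - d})"
      define C where "C = (if d = 1 then {} else if r < d then {..<d} - {r} else {..<d})"
      have "{..<d} - {i} \<noteq> {}" if "d \<noteq> 1" for i
      proof -
        have "(if i = 0 then 1 else 0) \<in> {..<d} - {i}" using d that by auto
        thus ?thesis by blast
      qed
      hence RC: "R \<subseteq> {..<d}" "C \<subseteq> {..<d}" "R \<noteq> {} \<and> C \<noteq> {} \<or> R = {} \<and> C = {}"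
        using d by (auto simp: R_def C_def lessThan_empty_iff)
      obtain g where "g \<in> carrier (SL (2 * d))" "lower_rank1 d g" "has_support d g R C True"
        using graph_point[OF RC] .
      hence "Cone (ray d ` face_rays d R C True) \<in> grass_fan d \<beta>" by (rule Cone_in_grass_fan[OF d \<beta>])
      moreover have "ray d ` face_rays d R C True = {u}"
      proof (cases "d = 1")
        case True
        hence f: "face_rays d R C True = {0, 1}" by (auto simp: face_rays_def R_def C_def)
        have rr: "r = 0 \<or> r = 1" using True False r(1) by auto
        have e: "ray d 1 = ray d 0" using vvec_1_ray[OF d] vvec_d_ray[OF d] True by simp
        have "u = ray d 0" using rr by (elim disjE) (simp_all only: r(2) e)
        thus ?thesis unfolding f by (simp only: image_insert image_empty e insert_absorb2)
      next
        case d1: False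
        have "face_rays d R C True = {r}" using False r(1) d1 by (auto simp: face_rays_def R_def C_def)
        thus ?thesis using r(2) by simp
      qed
      ultimately show ?thesis by simp
    qed
    ultimately show "u \<in> ray_generators (2 * d - 1) (grass_fan d \<beta>)" by (simp add: ray_generators_def)
  qed
  show "ray_generators (2 * d - 1) (grass_fan d \<beta>) \<subseteq> ray d ` {..2 * d}"
  proof
    fix u assume "u \<in> ray_generators (2 * d - 1) (grass_fan d \<beta>)"
    hence p: "primitive (2 * d - 1) u" and f: "Cone {u} \<in> grass_fan d \<beta>" by (auto simp: ray_generators_def)
    obtain R C z where R: "Cone {u} = Cone (ray d ` face_rays d R C z)" using grass_fanE[OF d \<beta> f] .
    have "u \<in> Cone {u}" unfolding Cone_singleton by (intro CollectI exI[of _ 1]) auto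
    moreover have "u \<noteq> (\<lambda>_. 0)" using p by (simp add: primitive_def)
    ultimately have "face_rays d R C z \<noteq> {}" using R Cone_empty by auto
    then obtain r where r: "r \<in> face_rays d R C z" by blast
    hence r2: "r \<le> 2 * d" by (auto simp: face_rays_def split: if_splits)
    have "ray d r \<in> Cone (ray d ` face_rays d R C z)"
      unfolding Cone_image[OF finite_face_rays]
    proof (intro CollectI exI[of _ "\<lambda>i. of_bool (i = r)"] conjI ballI ext)
      fix k
      have "(\<Sum>i\<in>face_rays d R C z. of_bool (i = r) * ray d i k) = (\<Sum>i\<in>{r}. of_bool (i = r) * ray d i k)"
        using r by (intro sum.mono_neutral_right finite_face_rays) auto
      thus "ray d r k = (\<Sum>i\<in>face_rays d R C z. of_bool (i = r) * ray d i k)" by simp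
    qed auto
    \<comment> \<open>The unit entry of \<open>ray d r\<close> forces \<open>c\<close> to be the
      reciprocal of a positive integer, so \<open>u\<close> is an integral multiple of
      \<open>ray d r\<close>, and primitivity of \<open>u\<close> makes the factor 1.\<close>
    then obtain c where c: "ray d r = (\<lambda>k. c * u k)" "c \<ge> 0" unfolding R[symmetric] Cone_singleton by blast
    obtain k where k: "ray d r k = 1 \<or> ray d r k = -1" using ray_unit_entry(2)[OF d r2] by blast
    have "u k \<in> \<int>" using p by (simp add: primitive_def lattice_points_def)
    then obtain m where m: "u k = of_int m" by (rule Ints_cases)
    have "\<bar>c * of_int m\<bar> = 1" using k fun_cong[OF c(1), of k] m by auto
    hence cm: "c * of_int \<bar>m\<bar> = 1" using c(2) by (simp add: abs_mult)
    have "u = (\<lambda>i. real (nat \<bar>m\<bar>) * ray d r i)"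
    proof
      fix i
      have "real (nat \<bar>m\<bar>) * ray d r i = (c * of_int \<bar>m\<bar>) * u i" by (simp add: c(1))
      thus "u i = real (nat \<bar>m\<bar>) * ray d r i" unfolding cm by simp
    qed
    moreover from this have "nat \<bar>m\<bar> = 1"
      using p ray_unit_entry(1)[OF d r2] unfolding primitive_def by blast
    ultimately have "u = ray d r" by simp
    thus "u \<in> ray d ` {..2 * d}" using r2 by blast
  qed
qed

text \<open>The position of its only entry \<open>-1\<close> distinguishes each
  \<open>wvec d k\<close> from all the other vectors. For \<open>d = 1\<close> the vectors
  \<open>vvec 1\<close> and \<open>vvec d\<close> coincide.\<close>

lemma card_rays:
  assumes d: "d \<ge> 2"
  shows "card ({vvec 1, vvec d} \<union> wvec d ` {1..2*d-1}) = 2 * d + 1"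
proof -
  have d1: "d \<ge> 1" using d by simp
  have neg: "wvec d k l = -1 \<longleftrightarrow> l = k" if "k \<in> {1..2*d-1}" for k l
    unfolding wvec_eq[OF d1 that] by auto
  have "inj_on (wvec d) {1..2*d-1}"
    by (rule inj_onI) (metis neg)
  hence "card (wvec d ` {1..2*d-1}) = 2 * d - 1" by (simp add: card_image)
  moreover have "vvec j \<notin> wvec d ` {1..2*d-1}" for j
  proof
    assume "vvec j \<in> wvec d ` {1..2*d-1}"
    then obtain k where k: "k \<in> {1..2*d-1}" "vvec j = wvec d k" by blast
    have "vvec j k = -1" using neg[OF k(1), of k] k(2) by simp
    thus False by (simp add: vvec_def split: if_splits)
  qed
  moreover have "vvec 1 \<noteq> vvec d"
  proof
    assume "vvec 1 = vvec d"
    from fun_cong[OF this, of 1] show False using d by (simp add: vvec_def)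
  qed
  ultimately have "card (insert (vvec 1) (insert (vvec d) (wvec d ` {1..2*d-1}))) = 2 * d + 1"
    using d by (simp add: card_insert_if)
  thus ?thesis by simp
qed

section \<open>Fixed points\<close>

lemma fixed_point_parabolic:
  assumes N: "\<forall>N\<in>weyl_lifts (2 * d) v. lower_rank1 d N \<and> has_support d N R C z"
    and v: "v permutes {1..2*d}" and d: "d \<ge> 1"
  shows "\<forall>g\<in>fixed_point (2 * d) (grass_parabolic d) v.
      g \<in> carrier (SL (2 * d)) \<and> lower_rank1 d g \<and> has_support d g R C z"
    and "fixed_point (2 * d) (grass_parabolic d) v \<noteq> {}"
proof -
  show "\<forall>g\<in>fixed_point (2 * d) (grass_parabolic d) v.
      g \<in> carrier (SL (2 * d)) \<and> lower_rank1 d g \<and> has_support d g R C z"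
  proof
    fix g assume "g \<in> fixed_point (2 * d) (grass_parabolic d) v"
    then obtain \<sigma> p where g: "\<sigma> \<in> weyl_lifts (2 * d) v" "p \<in> grass_parabolic d" "g = \<sigma> * p"
      by (auto simp: fixed_point_def set_mult_SL)
    have "\<sigma> \<in> carrier (SL (2 * d))" "lower_rank1 d \<sigma>" "has_support d \<sigma> R C z"
      using g(1) weyl_lifts_SL N by blast+
    thus "g \<in> carrier (SL (2 * d)) \<and> lower_rank1 d g \<and> has_support d g R C z"
      using g(2) unfolding g(3) by (intro conjI parabolic_coset_lower_rank1 parabolic_coset_support[THEN iffD2])
  qed
  obtain \<sigma> where "\<sigma> \<in> weyl_lifts (2 * d) v" using weyl_lifts_exists[OF v] d by auto
  thus "fixed_point (2 * d) (grass_parabolic d) v \<noteq> {}"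
    using one_parabolic_SL[of d "2 * d"] unfolding fixed_point_def set_mult_SL by auto
qed

text \<open>The first \<open>d\<close> columns are multiples of unit vectors, in the upper rows
  other than \<open>b\<close> and in row \<open>2 * d - Suc a = d + (d - 1 - a)\<close>. Exactly one
  admissible minor therefore survives.\<close>

lemma two_run_lift_support:
  assumes ab: "a < d" "b < d" and N: "N \<in> weyl_lifts (2 * d) (word_perm (two_run_word d a b))"
  shows "lower_rank1 d N" "has_support d N {d - 1 - a} {b} False"
proof -
  let ?v = "word_perm (two_run_word d a b)"
  have e: "N $$ (i, c) \<noteq> 0 \<longleftrightarrow> i = (if c < b then c else if c < d - 1 then Suc c else 2 * d - Suc a)"
    if "i < 2 * d" "c < d" for i c
  proof -
    have "?v (Suc c) = Suc (if c < b then c else if c < d - 1 then Suc c else 2 * d - Suc a)"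
      using that ab by (auto simp: two_run_perm)
    thus ?thesis using weyl_liftsD[OF N that(1), of c] that by simp
  qed
  show "lower_rank1 d N"
  proof (rule lower_rank1_one_column)
    fix i c assume ic: "i < d" "c < d" "c \<noteq> d - 1"
    hence "d + i < 2 * d" "d + i \<noteq> (if c < b then c else if c < d - 1 then Suc c else 2 * d - Suc a)" by auto
    thus "N $$ (d + i, c) = 0" using e[OF _ ic(2)] by blast
  qed
  have rowb: "N $$ (b, c) = 0" if "c < d" for c
  proof -
    have "b < 2 * d" "b \<noteq> (if c < b then c else if c < d - 1 then Suc c else 2 * d - Suc a)" using ab by auto
    thus ?thesis using e[OF _ that] by blast
  qed
  have rowi: "N $$ (d + i, c) = 0" if "i < d" "c < d" "i \<noteq> d - 1 - a" for i c
  proof -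
    have "d + i < 2 * d" "d + i \<noteq> (if c < b then c else if c < d - 1 then Suc c else 2 * d - Suc a)"
      using that ab by auto
    thus ?thesis using e[OF _ that(2)] by blast
  qed
  \<comment> \<open>The redundant update exhibits the zero row \<open>b\<close> among the rows of
    \<open>id\<close>.\<close>
  have "minor (id(b := b)) d N = 0" using ab rowb by (intro minor_zero_row)
  hence "minor id d N = 0" by (simp add: fun_upd_idem)
  moreover have "minor (id(j := d + i)) d N \<noteq> 0 \<longleftrightarrow> i = d - 1 - a \<and> j = b" if ij: "i < d" "j < d" for i j
  proof (cases "i = d - 1 - a \<and> j = b")
    case True
    have "minor (id(j := d + i)) d N \<noteq> 0"
    proof (rule minor_monomial_neq_0[where f = "\<lambda>c. if c < b then c else if c < d - 1 then Suc c else b"])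
      show "inj_on (\<lambda>c. if c < b then c else if c < d - 1 then Suc c else b) {..<d}"
        by (auto simp: inj_on_def split: if_splits)
      show "(\<lambda>c. if c < b then c else if c < d - 1 then Suc c else b) ` {..<d} \<subseteq> {..<d}" using ab by auto
      fix r c assume rc: "r < d" "c < d"
      have "(id(j := d + i)) r < 2 * d" using rc ij by simp
      from e[OF this rc(2)] show "N $$ ((id(j := d + i)) r, c) \<noteq> 0 \<longleftrightarrow> r = (if c < b then c else if c < d - 1 then Suc c else b)"
        using True rc ab by (auto split: if_splits)
    qed
    thus ?thesis using True by simp
  next
    case False
    have "minor (id(j := d + i)) d N = 0"
    proof (cases "i = d - 1 - a")
      case True
      hence "id(j := d + i) = (id(j := d + i))(b := b)" using False by (auto simp: fun_eq_iff)
      thus ?thesis using minor_zero_row[OF ab(2) rowb, of "id(j := d + i)"] by simp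
    qed (use minor_zero_row[OF ij(2) rowi[OF ij(1)], of id] in auto)
    thus ?thesis using False by simp
  qed
  ultimately show "has_support d N {d - 1 - a} {b} False" using ab by (auto simp: has_support_def)
qed

lemma id_lift_support:
  assumes N: "N \<in> weyl_lifts (2 * d) id"
  shows "lower_rank1 d N" "has_support d N {} {} True"
proof -
  have e: "N $$ (i, c) \<noteq> 0 \<longleftrightarrow> i = c" if "i < 2 * d" "c < d" for i c
    using weyl_liftsD[OF N that(1), of c] that by simp
  have low: "N $$ (d + i, c) = 0" if "i < d" "c < d" for i c using e[of "d + i" c] that by auto
  show "lower_rank1 d N" using low by (auto simp: lower_rank1_def)
  have "minor id d N \<noteq> 0" using e by (intro minor_monomial_neq_0[of id]) auto
  moreover have "minor (id(j := d + i)) d N = 0" if "i < d" "j < d" for i j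
    using minor_zero_row[OF that(2) low[OF that(1)], of id] by simp
  ultimately show "has_support d N {} {} True" by (auto simp: has_support_def)
qed

text \<open>The surviving indices omit \<open>2 * d - 1 - a\<close> and \<open>b\<close>. These
  belong to \<open>wvec d a\<close> and \<open>wvec d (d + b - 1)\<close>, except that for
  \<open>a = 0\<close> or \<open>b = 0\<close> the omitted generator is \<open>vvec 1\<close> or
  \<open>vvec d\<close>.\<close>

lemma face_rays_two_run:
  assumes d: "d \<ge> 1" and ab: "a < d" "b < d"
  shows "ray d ` face_rays d {d - 1 - a} {b} False = (if a = 0 then {} else {vvec 1}) \<union> (if b = 0 then {} else {vvec d})
    \<union> wvec d ` ({1..2*d-1} - (if a = 0 then {} else {a}) - (if b = 0 then {} else {d + b - 1}))"
proof -
  have "face_rays d {d - 1 - a} {b} False \<subseteq> {..2 * d}" by (auto simp: face_rays_def)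
  moreover have "2 * d - 1 \<in> face_rays d {d - 1 - a} {b} False \<longleftrightarrow> a \<noteq> 0" "0 \<in> face_rays d {d - 1 - a} {b} False \<longleftrightarrow> b \<noteq> 0"
    using d ab by (auto simp: face_rays_def)
  moreover have "{k \<in> {1..2*d-1}. ray_index d k \<in> face_rays d {d - 1 - a} {b} False} =
      {1..2*d-1} - (if a = 0 then {} else {a}) - (if b = 0 then {} else {d + b - 1})"
    using d ab by (auto simp: ray_index_def face_rays_def split: if_splits)
  ultimately show ?thesis by (subst ray_image[OF d]) auto
qed

lemma face_rays_id:
  assumes d: "d \<ge> 1"
  shows "ray d ` face_rays d {} {} True = {vvec 1, vvec d} \<union> wvec d ` {1..2*d-2}"
proof -
  have "face_rays d {} {} True \<subseteq> {..2 * d}" "2 * d - 1 \<in> face_rays d {} {} True" "0 \<in> face_rays d {} {} True"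
    using d by (auto simp: face_rays_def)
  moreover have "{k \<in> {1..2*d-1}. ray_index d k \<in> face_rays d {} {} True} = {1..2*d-2}"
    using d by (auto simp: ray_index_def face_rays_def split: if_splits)
  ultimately show ?thesis by (subst ray_image[OF d]) auto
qed

theorem proposition4p8:
  fixes d :: nat and \<beta> :: "nat \<Rightarrow> nat \<Rightarrow> int"
  assumes "d \<ge> 1"
    and "fan_identification d \<beta>"
  shows
    "(\<forall>v\<in>grassmannian_perms d. bruhat_le (2*d) v (w_perm d) \<longrightarrow>
        (\<forall>a\<in>{1..d-1}. v = word_perm (two_run_word d a 0) \<longrightarrow>
           grass_cone d \<beta> v =
             Cone ({vvec 1} \<union> wvec d ` ({1..2*d-1} - {a}))) \<and>
        (\<forall>b\<in>{1..d-1}. v = word_perm (two_run_word d 0 b) \<longrightarrow>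
           grass_cone d \<beta> v =
             Cone ({vvec d} \<union> wvec d ` ({1..2*d-1} - {d+b-1}))) \<and>
        (\<forall>a\<in>{1..d-1}. \<forall>b\<in>{1..d-1}. v = word_perm (two_run_word d a b) \<longrightarrow>
           grass_cone d \<beta> v =
             Cone ({vvec 1, vvec d} \<union> wvec d ` ({1..2*d-1} - {a, d+b-1}))) \<and>
        (v = w_perm d \<longrightarrow> grass_cone d \<beta> v = Cone (wvec d ` {1..2*d-1})) \<and>
        (v = id \<longrightarrow> grass_cone d \<beta> v = Cone ({vvec 1, vvec d} \<union> wvec d ` {1..2*d-2})))
     \<and> {v \<in> grassmannian_perms d. bruhat_le (2*d) v (w_perm d)} =
          {word_perm (two_run_word d a 0) | a. a \<in> {1..d-1}} \<union>
          {word_perm (two_run_word d 0 b) | b. b \<in> {1..d-1}} \<union>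
          {word_perm (two_run_word d a b) | a b. a \<in> {1..d-1} \<and> b \<in> {1..d-1}} \<union>
          {w_perm d, id}
     \<and> ray_generators (2*d-1) (grass_fan d \<beta>) =
          {vvec 1, vvec d} \<union> wvec d ` {1..2*d-1}
     \<and> (d \<ge> 2 \<longrightarrow> card ({vvec 1, vvec d} \<union> wvec d ` {1..2*d-1}) = 2*d+1)"
proof -
  note d = assms(1)
  have \<beta>: "torus_coordinates (2 * d) \<beta>" "simple_coordinates d \<beta>"
    using assms fan_identification_coordinates by (auto simp: fan_identification_def)
  \<comment> \<open>One formula covers all fixed points but the identity; a parameter 0 stands for a
    complete run of letters.\<close>
  have run: "grass_cone d \<beta> (word_perm (two_run_word d a b)) = Cone ((if a = 0 then {} else {vvec 1}) \<union> (if b = 0 then {} else {vvec d})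
      \<union> wvec d ` ({1..2*d-1} - (if a = 0 then {} else {a}) - (if b = 0 then {} else {d + b - 1})))"
    if ab: "a < d" "b < d" for a b
  proof -
    have "\<forall>N\<in>weyl_lifts (2 * d) (word_perm (two_run_word d a b)).
        lower_rank1 d N \<and> has_support d N {d - 1 - a} {b} False"
      using two_run_lift_support[OF ab] by blast
    note fp = fixed_point_parabolic[OF this two_run_permutes d]
    show ?thesis unfolding grass_cone_def toric_cone_Cone[OF d \<beta> fp] face_rays_two_run[OF d ab] ..
  qed
  have cone_id: "grass_cone d \<beta> id = Cone ({vvec 1, vvec d} \<union> wvec d ` {1..2*d-2})"
  proof -
    have "\<forall>N\<in>weyl_lifts (2 * d) id. lower_rank1 d N \<and> has_support d N {} {} True"
      using id_lift_support by blast
    note fp = fixed_point_parabolic[OF this permutes_id d]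
    show ?thesis unfolding grass_cone_def toric_cone_Cone[OF d \<beta> fp] face_rays_id[OF d] ..
  qed
  have cone_w: "grass_cone d \<beta> (w_perm d) = Cone (wvec d ` {1..2*d-1})"
    using run[of 0 0] d by (simp add: w_perm_def)
  have cone_a: "grass_cone d \<beta> (word_perm (two_run_word d a 0)) = Cone ({vvec 1} \<union> wvec d ` ({1..2*d-1} - {a}))"
    if "a \<in> {1..d-1}" for a
    using run[of a 0] that by auto
  have cone_b: "grass_cone d \<beta> (word_perm (two_run_word d 0 b)) = Cone ({vvec d} \<union> wvec d ` ({1..2*d-1} - {d+b-1}))"
    if "b \<in> {1..d-1}" for b
    using run[of 0 b] that by auto
  have cone_ab: "grass_cone d \<beta> (word_perm (two_run_word d a b)) =
      Cone ({vvec 1, vvec d} \<union> wvec d ` ({1..2*d-1} - {a, d+b-1}))"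
    if "a \<in> {1..d-1}" "b \<in> {1..d-1}" for a b
  proof -
    have "a < d" "b < d" "a \<noteq> 0" "b \<noteq> 0" using that by auto
    moreover have "{1..2*d-1} - {a} - {d+b-1} = {1..2*d-1} - {a, d+b-1}" by blast
    moreover have "{vvec 1} \<union> {vvec d} = {vvec 1, vvec d}" by blast
    ultimately show ?thesis using run[of a b] by (simp only: if_False)
  qed
  have "{v \<in> grassmannian_perms d. bruhat_le (2*d) v (w_perm d)} =
          {word_perm (two_run_word d a 0) | a. a \<in> {1..d-1}} \<union>
          {word_perm (two_run_word d 0 b) | b. b \<in> {1..d-1}} \<union>
          {word_perm (two_run_word d a b) | a b. a \<in> {1..d-1} \<and> b \<in> {1..d-1}} \<union>
          {w_perm d, id}" (is "_ = ?R")
  proof -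
    \<comment> \<open>Separating the value 0 of each parameter splits the two-parameter family into
      the four listed ones.\<close>
    have lt: "a < d \<longleftrightarrow> a = 0 \<or> a \<in> {1..d-1}" for a using d by auto
    have "insert id {word_perm (two_run_word d a b) | a b. a < d \<and> b < d} = ?R"
      unfolding lt w_perm_def by blast
    thus ?thesis unfolding grassmannian_interval[OF d] .
  qed
  moreover have "ray_generators (2*d-1) (grass_fan d \<beta>) = {vvec 1, vvec d} \<union> wvec d ` {1..2*d-1}"
    unfolding grass_ray_generators[OF d \<beta>] by (rule ray_indices[OF d])
  ultimately show ?thesis
    using cone_a cone_b cone_ab cone_w cone_id card_rays by blast
qed

end
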